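(* Let $\mathcal M$ be a compact smooth manifold. Let $(X,f)$ be a hyperbolic or partially hyperbolic system, and let $\lambda=\max_{x\in X}\lambda(x)<1$ be its stable contraction constant. Let $\mathcal A$ and $\mathcal B$ be $\mathrm{Diff}^1(\mathcal M)$-valued cocycles over $(X,f)$ such that the maps $x\mapsto\mathcal A_x$ and $x\mapsto\mathcal B_x$ from $X$ to $\mathrm{Diff}^0(\mathcal M)$ are $\beta$-Hölder continuous. If there exist constants $K$ and $\sigma$ such that $$\sigma\lambda^\beta<1\quad\text{and}\quad \|D\mathcal A^n_x\|\le K\sigma^{|n|},\ \ \|D\mathcal B^n_x\|\le K\sigma^{|n|}\quad\text{for every }x\in X\text{ and }n\in\mathbb Z,$$ then $\mathcal A$ and $\mathcal B$ have stable holonomies in $\mathrm{Diff}^0(\mathcal M)$, and any $\beta$-Hölder continuous conjugacy $\Phi:X\to\mathrm{Diff}^0(\mathcal M)$ between $\mathcal A$ and $\mathcal B$ intertwines the stable holonomies, that is, $H^{\mathcal A,s}_{x,y}=\Phi_y\circ H^{\mathcal B,s}_{x,y}\circ\Phi_x^{-1}$ for all $x\in X$ and $y\in W^s(x)$.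
   Context: **Partially hyperbolic systems.** A diffeomorphism $f$ of a compact connected manifold $X$ is partially hyperbolic if there exist a nontrivial $Df$-invariant splitting $TX=E^s\oplus E^c\oplus E^u$, a Riemannian metric on $X$, and positive continuous functions $\lambda<1$, $\hat\lambda<1$, $\xi$, $\hat\xi$ on $X$ such that for any $x\in X$ and unit vectors $v^s\in E^s(x)$, $v^c\in E^c(x)$, $v^u\in E^u(x)$, $$\|Df_x v^s\|<\lambda(x)<\xi(x)<\|Df_xv^c\|<\hat\xi(x)^{-1}<\hat\lambda(x)^{-1}<\|Df_xv^u\|.$$ $E^s$ is tangent to the stable foliation $W^s$; $W^{s}_{loc}(x)$ is a ball of a fixed small radius centered at $x$ in the leaf $W^{s}(x)$. **Hyperbolic system** means: a transitive Anosov diffeomorphism of a compact connected manifold, or a mixing diffeomorphism of a locally maximal hyperbolic set $X$, or a mixing subshift of finite type. In the first two cases $\lambda$ is a positive continuous function on $X$ with $\lambda(x)<1$ and $\|Df_xv^s\|<\lambda(x)$ for every $x\in X$ and every unit vector $v^s$ in the stable subspace $E^s(x)$, with respect to an adapted Riemannian metric, and $W^s(x)$, $W^s_{loc}(x)$ are the (local) stable manifolds (intersected with $X$). For a subshift with metric $d_X(x,y)=\theta^{\min\{|i|:x_i\ne y_i\}}$, $\theta\in(0,1)$, one takes $\lambda=\theta$, $W^s_{loc}(x)=\{y:y_i=x_i,\ i\ge0\}$, $W^s(x)=\bigcup_{n\ge0} f^{-n}W^s_{loc}(f^nx)$. In all cases $d_X(f^nx,f^ny)\le\lambda^nd_X(x,y)$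 for all $x\in X$, $y\in W^s_{loc}(x)$, $n\in\mathbb N$. **Cocycles.** For $A:X\to \mathrm{Diff}^1(\mathcal M)$, the cocycle over $f$ generated by $A$ is $\mathcal A^0_x=\mathrm{Id}$, $\mathcal A^n_x=A(f^{n-1}x)\circ\cdots\circ A(x)$, $\mathcal A^{-n}_x=(\mathcal A^n_{f^{-n}x})^{-1}$ for $n\in\mathbb N$; $\mathcal A_x=\mathcal A^1_x$. Also $\|D\mathcal A^n_x\|=\max_{t\in\mathcal M}\|D_t\mathcal A^n_x\|$ with respect to a fixed smooth Riemannian metric on $\mathcal M$ with distance $d_{\mathcal M}$. **Distance.** $\mathrm{Diff}^0(\mathcal M)$ is the group of homeomorphisms of $\mathcal M$ with $d_{C^0}(g,h)=d_0(g,h)+d_0(g^{-1},h^{-1})$, $d_0(g,h)=\max_t d_{\mathcal M}(g(t),h(t))$. A map $\Psi:X\to\mathrm{Diff}^0(\mathcal M)$ is $\beta$-Hölder ($0<\beta\le1$) if $d_{C^0}(\Psi_x,\Psi_y)\le c\,d_X(x,y)^\beta$ for some $c$ and all $x,y\in X$. **Holonomies.** $\mathcal A$ has stable holonomies in $\mathrm{Diff}^0(\mathcal M)$ if $H^{\mathcal A,s}_{x,y}=\lim_{n\to+\infty}(\mathcal A^n_y)^{-1}\circ\mathcal A^n_x$ exists in $\mathrm{Diff}^0(\mathcal M)$ for every $x\in X$, $y\in W^s(x)$, the map $(x,y)\mapsto H^{\mathcal A,s}_{x,y}$ into $\mathrm{Diff}^0(\mathcal M)$ is continuous on the set of pairs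 with $x\in X$, $y\in W^s_{loc}(x)$, and the homeomorphisms $H^{\mathcal A,s}_{x,y}$ are Hölder continuous with uniform exponent and constant for all such pairs. **Conjugacy.** A conjugacy between $\mathcal A$ and $\mathcal B$ is $\Phi:X\to\mathrm{Diff}^0(\mathcal M)$ with $\mathcal A_x=\Phi_{fx}\circ\mathcal B_x\circ\Phi_x^{-1}$ for all $x\in X$. *)

theory Defs
  imports "HOL-Analysis.Analysis"
begin

section \<open>Smooth maps between Euclidean spaces\<close>

primrec Ck :: "nat \<Rightarrow> 'a::euclidean_space set \<Rightarrow> ('a \<Rightarrow> 'b::real_normed_vector) \<Rightarrow> bool" where
  "Ck 0 = (\<lambda>S f. continuous_on S f)"
| "Ck (Suc k) = (\<lambda>S f. (\<forall>x\<in>S. f differentiable (at x)) \<and>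
     (\<forall>v. Ck k S (\<lambda>x. frechet_derivative f (at x) v)))"

definition smooth_on :: "'a::euclidean_space set \<Rightarrow> ('a \<Rightarrow> 'b::real_normed_vector) \<Rightarrow> bool" where
  "smooth_on S f \<longleftrightarrow> (\<forall>k. Ck k S f)"

section \<open>Smooth manifolds\<close>

text \<open>
  A manifold is a type \<open>'m\<close> (whose metric induces the manifold topology) together with a smooth
  atlas \<open>M\<close>; it is modelled on \<open>'e\<close>. A chart is a pair of an open domain and a coordinate map.
\<close>

type_synonym ('m, 'e) chart = "'m set \<times> ('m \<Rightarrow> 'e)"

definition chart_inv :: "('m, 'e) chart \<Rightarrow> 'e \<Rightarrow> 'm" where
  "chart_inv c = inv_into (fst c) (snd c)"

definition smooth_manifold :: "('m::metric_space, 'e::euclidean_space) chart set \<Rightarrow> bool" where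
  "smooth_manifold M \<longleftrightarrow>
     (\<Union>c\<in>M. fst c) = UNIV \<and>
     (\<forall>c\<in>M. open (fst c) \<and> open (snd c ` fst c) \<and>
        homeomorphism (fst c) (snd c ` fst c) (snd c) (chart_inv c)) \<and>
     (\<forall>c\<in>M. \<forall>c'\<in>M. smooth_on (snd c ` (fst c \<inter> fst c')) (snd c' \<circ> chart_inv c))"

text \<open>
  The tangent space at \<open>x\<close> is the model space \<open>'e\<close>, a vector being represented by its
  coordinates in the preferred chart \<open>chart_at M x\<close>. The map \<open>chart_vec M c x\<close> takes the
  coordinates of a tangent vector at \<open>x\<close> with respect to another chart \<open>c\<close> around \<open>x\<close> to its
  coordinates in the preferred chart.
\<close>

definition chart_at :: "('m, 'e) chart set \<Rightarrow> 'm \<Rightarrow> ('m, 'e) chart" where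
  "chart_at M x = (SOME c. c \<in> M \<and> x \<in> fst c)"

definition chart_vec ::
    "('m, 'e::euclidean_space) chart set \<Rightarrow> ('m, 'e) chart \<Rightarrow> 'm \<Rightarrow> 'e \<Rightarrow> 'e" where
  "chart_vec M c x = frechet_derivative (snd (chart_at M x) \<circ> chart_inv c) (at (snd c x))"

definition C1_map_on :: "('m::metric_space, 'e::euclidean_space) chart set \<Rightarrow>
    ('n::metric_space, 'f::euclidean_space) chart set \<Rightarrow> 'm set \<Rightarrow> ('m \<Rightarrow> 'n) \<Rightarrow> bool" where
  "C1_map_on M N U h \<longleftrightarrow> continuous_on U h \<and>
     (\<forall>c\<in>M. \<forall>c'\<in>N. Ck 1 (snd c ` (U \<inter> fst c \<inter> h -` fst c')) (snd c' \<circ> h \<circ> chart_inv c))"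

definition mderiv :: "('m, 'e::euclidean_space) chart set \<Rightarrow>
    ('n, 'f::euclidean_space) chart set \<Rightarrow> ('m \<Rightarrow> 'n) \<Rightarrow> 'm \<Rightarrow> 'e \<Rightarrow> 'f" where
  "mderiv M N h x =
     frechet_derivative (snd (chart_at N (h x)) \<circ> h \<circ> chart_inv (chart_at M x))
       (at (snd (chart_at M x) x))"

definition C1_diffeo_on ::
    "('m::metric_space, 'e::euclidean_space) chart set \<Rightarrow> 'm set \<Rightarrow> ('m \<Rightarrow> 'm) \<Rightarrow> bool" where
  "C1_diffeo_on M U h \<longleftrightarrow> open U \<and> inj_on h U \<and> open (h ` U) \<and>
     C1_map_on M M U h \<and> C1_map_on M M (h ` U) (inv_into U h)"

definition Diff1 :: "('m::metric_space, 'e::euclidean_space) chart set \<Rightarrow> ('m \<Rightarrow> 'm) set" where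
  "Diff1 M = {h. C1_diffeo_on M UNIV h \<and> surj h}"

subsection \<open>Riemannian metrics\<close>

definition riemannian_metric ::
    "('m::metric_space, 'e::euclidean_space) chart set \<Rightarrow> ('m \<Rightarrow> 'e \<Rightarrow> 'e \<Rightarrow> real) \<Rightarrow> bool" where
  "riemannian_metric M g \<longleftrightarrow>
     (\<forall>x. bilinear (g x) \<and> (\<forall>v w. g x v w = g x w v) \<and> (\<forall>v. v \<noteq> 0 \<longrightarrow> 0 < g x v v)) \<and>
     (\<forall>c\<in>M. \<forall>v w. smooth_on (snd c ` fst c)
        (\<lambda>p. g (chart_inv c p) (chart_vec M c (chart_inv c p) v) (chart_vec M c (chart_inv c p) w)))"

definition rnorm :: "('m \<Rightarrow> 'e \<Rightarrow> 'e \<Rightarrow> real) \<Rightarrow> 'm \<Rightarrow> 'e \<Rightarrow> real" where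
  "rnorm g x v = sqrt (g x v v)"

definition piecewise_C1_curve ::
    "('m::metric_space, 'e::euclidean_space) chart set \<Rightarrow> (real \<Rightarrow> 'm) \<Rightarrow> bool" where
  "piecewise_C1_curve M \<gamma> \<longleftrightarrow> continuous_on {0..1} \<gamma> \<and>
     (\<exists>T. finite T \<and>
        (\<forall>c\<in>M. (snd c \<circ> \<gamma>) C1_differentiable_on (({0..1} - T) \<inter> \<gamma> -` fst c)))"

definition velocity ::
    "('m, 'e::euclidean_space) chart set \<Rightarrow> (real \<Rightarrow> 'm) \<Rightarrow> real \<Rightarrow> 'e" where
  "velocity M \<gamma> t = vector_derivative (snd (chart_at M (\<gamma> t)) \<circ> \<gamma>) (at t)"

definition curve_length :: "('m::metric_space, 'e::euclidean_space) chart set \<Rightarrow>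
    ('m \<Rightarrow> 'e \<Rightarrow> 'e \<Rightarrow> real) \<Rightarrow> (real \<Rightarrow> 'm) \<Rightarrow> ennreal" where
  "curve_length M g \<gamma> =
     (\<integral>\<^sup>+ t \<in> {0..1}. ennreal (rnorm g (\<gamma> t) (velocity M \<gamma> t)) \<partial>lborel)"

definition riemannian_edist :: "('m::metric_space, 'e::euclidean_space) chart set \<Rightarrow>
    ('m \<Rightarrow> 'e \<Rightarrow> 'e \<Rightarrow> real) \<Rightarrow> 'm \<Rightarrow> 'm \<Rightarrow> ennreal" where
  "riemannian_edist M g x y =
     (INF \<gamma> \<in> {\<gamma>. piecewise_C1_curve M \<gamma> \<and> \<gamma> 0 = x \<and> \<gamma> 1 = y}. curve_length M g \<gamma>)"

text \<open>
  The distance \<open>dist\<close> of \<open>'m\<close> is the Riemannian distance. The infimum of lengths is infinite for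
  points in different connected components. There it does not define a distance, and any
  (topologically compatible) choice of \<open>dist\<close> between components is allowed.
\<close>

definition riemannian_manifold :: "('m::metric_space, 'e::euclidean_space) chart set \<Rightarrow>
    ('m \<Rightarrow> 'e \<Rightarrow> 'e \<Rightarrow> real) \<Rightarrow> bool" where
  "riemannian_manifold M g \<longleftrightarrow> smooth_manifold M \<and> riemannian_metric M g \<and>
     (\<forall>x y. riemannian_edist M g x y < \<infinity> \<longrightarrow> ennreal (dist x y) = riemannian_edist M g x y)"

definition deriv_norm_at :: "('m, 'e::euclidean_space) chart set \<Rightarrow>
    ('m \<Rightarrow> 'e \<Rightarrow> 'e \<Rightarrow> real) \<Rightarrow> ('m \<Rightarrow> 'm) \<Rightarrow> 'm \<Rightarrow> real" where
  "deriv_norm_at M g h t = (SUP v \<in> {v. rnorm g t v = 1}. rnorm g (h t) (mderiv M M h t v))"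

definition deriv_norm :: "('m, 'e::euclidean_space) chart set \<Rightarrow>
    ('m \<Rightarrow> 'e \<Rightarrow> 'e \<Rightarrow> real) \<Rightarrow> ('m \<Rightarrow> 'm) \<Rightarrow> real" where
  "deriv_norm M g h = (SUP t. deriv_norm_at M g h t)"

section \<open>Hyperbolic systems\<close>

text \<open>
  A system is described by its phase space \<open>X\<close> (a subset of a metric space), the map \<open>f\<close>, the
  function \<open>l\<close> (the \<open>\<lambda>(x)\<close> of the estimates), the stable sets \<open>Ws x\<close> and the local
  stable sets \<open>Wl x\<close>. Its distance is \<open>dist\<close>. The argument \<open>N\<close> is an atlas of the ambient
  manifold; it plays no role for subshifts.
\<close>

definition transitive_on :: "'x::metric_space set \<Rightarrow> ('x \<Rightarrow> 'x) \<Rightarrow> bool" where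
  "transitive_on X f \<longleftrightarrow>
     (\<forall>U V. openin (top_of_set X) U \<and> openin (top_of_set X) V \<and> U \<noteq> {} \<and> V \<noteq> {} \<longrightarrow>
        (\<exists>n>0. (f ^^ n) ` U \<inter> V \<noteq> {}))"

definition mixing_on :: "'x::metric_space set \<Rightarrow> ('x \<Rightarrow> 'x) \<Rightarrow> bool" where
  "mixing_on X f \<longleftrightarrow>
     (\<forall>U V. openin (top_of_set X) U \<and> openin (top_of_set X) V \<and> U \<noteq> {} \<and> V \<noteq> {} \<longrightarrow>
        (\<exists>n0. \<forall>n\<ge>n0. (f ^^ n) ` U \<inter> V \<noteq> {}))"

text \<open>The hyperbolic splitting on an invariant set, with \<open>g\<close> an adapted metric.\<close>

definition hyperbolic_splitting :: "('x::metric_space, 'k::euclidean_space) chart set \<Rightarrow>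
    ('x \<Rightarrow> 'k \<Rightarrow> 'k \<Rightarrow> real) \<Rightarrow> 'x set \<Rightarrow> ('x \<Rightarrow> 'x) \<Rightarrow> ('x \<Rightarrow> real) \<Rightarrow> bool" where
  "hyperbolic_splitting N g X f l \<longleftrightarrow>
     (\<exists>(Es :: 'x \<Rightarrow> 'k set) (Eu :: 'x \<Rightarrow> 'k set) (lh :: 'x \<Rightarrow> real).
        continuous_on X l \<and> continuous_on X lh \<and>
        (\<forall>x\<in>X. 0 < l x \<and> l x < 1 \<and> 0 < lh x \<and> lh x < 1) \<and>
        (\<forall>x\<in>X. subspace (Es x) \<and> subspace (Eu x) \<and>
           (\<forall>v. \<exists>!(a, b). a \<in> Es x \<and> b \<in> Eu x \<and> v = a + b) \<and>
           mderiv N N f x ` Es x = Es (f x) \<and> mderiv N N f x ` Eu x = Eu (f x) \<and>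
           (\<forall>v\<in>Es x. rnorm g x v = 1 \<longrightarrow> rnorm g (f x) (mderiv N N f x v) < l x) \<and>
           (\<forall>v\<in>Eu x. rnorm g x v = 1 \<longrightarrow> inverse (lh x) < rnorm g (f x) (mderiv N N f x v))))"

text \<open>
  Stable manifolds of a hyperbolic set, intersected with it. The size \<open>r\<close> of the local ones is
  required to be so small that \<open>f ^^ n\<close> contracts them by the factor \<open>\<lambda>\<^sup>n\<close>, where
  \<open>\<lambda> = max l\<close>.
\<close>

definition stable_sets :: "'x::metric_space set \<Rightarrow> ('x \<Rightarrow> 'x) \<Rightarrow> ('x \<Rightarrow> real) \<Rightarrow>
    ('x \<Rightarrow> 'x set) \<Rightarrow> ('x \<Rightarrow> 'x set) \<Rightarrow> bool" where
  "stable_sets X f l Ws Wl \<longleftrightarrow>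
     (\<forall>x\<in>X. Ws x = {y\<in>X. (\<lambda>n. dist ((f ^^ n) x) ((f ^^ n) y)) \<longlonglongrightarrow> 0}) \<and>
     (\<exists>r>0. \<forall>x\<in>X. Wl x = {y\<in>X. \<forall>n. dist ((f ^^ n) x) ((f ^^ n) y) \<le> r}) \<and>
     (\<forall>x\<in>X. \<forall>y\<in>Wl x. \<forall>n. dist ((f ^^ n) x) ((f ^^ n) y) \<le> (SUP z\<in>X. l z) ^ n * dist x y)"

definition transitive_anosov_system :: "('x::metric_space, 'k::euclidean_space) chart set \<Rightarrow>
    'x set \<Rightarrow> ('x \<Rightarrow> 'x) \<Rightarrow> ('x \<Rightarrow> real) \<Rightarrow> ('x \<Rightarrow> 'x set) \<Rightarrow> ('x \<Rightarrow> 'x set) \<Rightarrow> bool" where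
  "transitive_anosov_system N X f l Ws Wl \<longleftrightarrow>
     X = UNIV \<and> compact X \<and> connected X \<and> f \<in> Diff1 N \<and> transitive_on X f \<and>
     (\<exists>g. riemannian_manifold N g \<and> hyperbolic_splitting N g X f l) \<and>
     stable_sets X f l Ws Wl"

definition mixing_hyperbolic_set_system :: "('x::metric_space, 'k::euclidean_space) chart set \<Rightarrow>
    'x set \<Rightarrow> ('x \<Rightarrow> 'x) \<Rightarrow> ('x \<Rightarrow> real) \<Rightarrow> ('x \<Rightarrow> 'x set) \<Rightarrow> ('x \<Rightarrow> 'x set) \<Rightarrow> bool" where
  "mixing_hyperbolic_set_system N X f l Ws Wl \<longleftrightarrow>
     X \<noteq> {} \<and> compact X \<and> f ` X = X \<and> mixing_on X f \<and>
     (\<exists>U. X \<subseteq> U \<and> C1_diffeo_on N U f \<and>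
        (\<exists>V. open V \<and> X \<subseteq> V \<and> V \<subseteq> U \<and>
           (\<forall>z::int \<Rightarrow> 'x. (\<forall>i. z i \<in> V \<and> z (i + 1) = f (z i)) \<longrightarrow> z 0 \<in> X))) \<and>
     (\<exists>g. riemannian_manifold N g \<and> hyperbolic_splitting N g X f l) \<and>
     stable_sets X f l Ws Wl"

definition subshift_of_finite_type :: "nat \<Rightarrow> nat list set \<Rightarrow> (int \<Rightarrow> nat) set" where
  "subshift_of_finite_type k F =
     {s. (\<forall>i. s i < k) \<and> (\<forall>w\<in>F. \<forall>i. \<exists>j<length w. s (i + int j) \<noteq> w ! j)}"

text \<open>
  Since the metric of a subshift depends on \<open>\<theta>\<close>, the sequence space is not itself taken as
  the phase space: the points of \<open>X\<close> are labels of sequences, via the bijection \<open>s\<close>.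
\<close>

definition mixing_sft_system :: "'x::metric_space set \<Rightarrow> ('x \<Rightarrow> 'x) \<Rightarrow> ('x \<Rightarrow> real) \<Rightarrow>
    ('x \<Rightarrow> 'x set) \<Rightarrow> ('x \<Rightarrow> 'x set) \<Rightarrow> bool" where
  "mixing_sft_system X f l Ws Wl \<longleftrightarrow>
     (\<exists>k F (s :: 'x \<Rightarrow> int \<Rightarrow> nat) \<theta>. finite F \<and> 0 < \<theta> \<and> \<theta> < 1 \<and> X \<noteq> {} \<and>
        bij_betw s X (subshift_of_finite_type k F) \<and>
        (\<forall>x\<in>X. f x \<in> X \<and> s (f x) = (\<lambda>i. s x (i + 1))) \<and>
        (\<forall>x\<in>X. \<forall>y\<in>X. x \<noteq> y \<longrightarrow> dist x y = \<theta> ^ (LEAST n. \<exists>i. n = nat \<bar>i\<bar> \<and> s x i \<noteq> s y i)) \<and>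
        mixing_on X f \<and>
        (\<forall>x\<in>X. l x = \<theta> \<and>
           Wl x = {y\<in>X. \<forall>i\<ge>0. s y i = s x i} \<and>
           Ws x = {y\<in>X. \<exists>n. (f ^^ n) y \<in> Wl ((f ^^ n) x)}))"

definition hyperbolic_system :: "('x::metric_space, 'k::euclidean_space) chart set \<Rightarrow>
    'x set \<Rightarrow> ('x \<Rightarrow> 'x) \<Rightarrow> ('x \<Rightarrow> real) \<Rightarrow> ('x \<Rightarrow> 'x set) \<Rightarrow> ('x \<Rightarrow> 'x set) \<Rightarrow> bool" where
  "hyperbolic_system N X f l Ws Wl \<longleftrightarrow>
     transitive_anosov_system N X f l Ws Wl \<or>
     mixing_hyperbolic_set_system N X f l Ws Wl \<or>
     mixing_sft_system X f l Ws Wl"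

section \<open>Partially hyperbolic systems\<close>

text \<open>
  A foliation box is an open set \<open>U\<close> with a homeomorphism \<open>h\<close> onto the product of the unit balls
  of a subspace \<open>S\<close> and of its orthogonal complement. Its plaques are the preimages of the slices
  \<open>ball \<times> {q}\<close>, so that \<open>a, b \<in> U\<close> are in the same plaque iff \<open>h a - h b \<in> S\<close>.
\<close>

definition foliation_box ::
    "'k::euclidean_space set \<Rightarrow> 'x::metric_space set \<times> ('x \<Rightarrow> 'k) \<Rightarrow> bool" where
  "foliation_box S b \<longleftrightarrow> open (fst b) \<and>
     snd b ` fst b = {p + q | p q. p \<in> S \<inter> ball 0 1 \<and> q \<in> S\<^sup>\<bottom> \<inter> ball 0 1} \<and>
     homeomorphism (fst b) (snd b ` fst b) (snd b) (chart_inv b)"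

definition same_plaque ::
    "'k::euclidean_space set \<Rightarrow> 'x set \<times> ('x \<Rightarrow> 'k) \<Rightarrow> 'x \<Rightarrow> 'x \<Rightarrow> bool" where
  "same_plaque S b x y \<longleftrightarrow> x \<in> fst b \<and> y \<in> fst b \<and> snd b x - snd b y \<in> S"

text \<open>The plaques are injectively immersed \<open>C\<^sup>1\<close> discs tangent to \<open>E\<close>.\<close>

definition plaques_tangent :: "('x::metric_space, 'k::euclidean_space) chart set \<Rightarrow>
    'k set \<Rightarrow> 'x set \<times> ('x \<Rightarrow> 'k) \<Rightarrow> ('x \<Rightarrow> 'k set) \<Rightarrow> bool" where
  "plaques_tangent N S b E \<longleftrightarrow>
     (\<forall>q \<in> S\<^sup>\<bottom> \<inter> ball 0 1. \<forall>c\<in>N.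
        let P = {p \<in> S \<inter> ball 0 1. chart_inv b (p + q) \<in> fst c} in
        \<exists>D :: 'k \<Rightarrow> 'k \<Rightarrow>\<^sub>L 'k. continuous_on P D \<and>
          (\<forall>p\<in>P. ((\<lambda>p. snd c (chart_inv b (p + q))) has_derivative blinfun_apply (D p)) (at p within S) \<and>
             inj_on (blinfun_apply (D p)) S \<and>
             chart_vec N c (chart_inv b (p + q)) ` (blinfun_apply (D p) ` S)
               = E (chart_inv b (p + q))))"

text \<open>
  \<open>W x\<close> is the leaf through \<open>x\<close> of a continuous foliation with \<open>C\<^sup>1\<close> leaves tangent to \<open>E\<close>: the
  boxes cover the manifold, where two boxes meet their plaques agree locally, and the
  leaves are the classes of points connected by chains of plaques.
\<close>

definition foliation_tangent_to :: "('x::metric_space, 'k::euclidean_space) chart set \<Rightarrow>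
    ('x \<Rightarrow> 'k set) \<Rightarrow> ('x \<Rightarrow> 'x set) \<Rightarrow> bool" where
  "foliation_tangent_to N E W \<longleftrightarrow>
     (\<exists>S \<B>. subspace S \<and>
        (\<forall>b\<in>\<B>. foliation_box S b \<and> plaques_tangent N S b E) \<and>
        (\<Union>b\<in>\<B>. fst b) = UNIV \<and>
        (\<forall>b\<in>\<B>. \<forall>b'\<in>\<B>. \<forall>x \<in> fst b \<inter> fst b'. \<exists>V. open V \<and> x \<in> V \<and> V \<subseteq> fst b \<inter> fst b' \<and>
           (\<forall>y\<in>V. \<forall>z\<in>V. same_plaque S b y z \<longleftrightarrow> same_plaque S b' y z)) \<and>
        (\<forall>x. W x = {y. (x, y) \<in> {(y, z). \<exists>b\<in>\<B>. same_plaque S b y z}\<^sup>*}))"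

text \<open>The intrinsic distance of the leaves of a foliation \<open>W\<close> tangent to \<open>E\<close>.\<close>

definition leaf_edist :: "('x::metric_space, 'k::euclidean_space) chart set \<Rightarrow>
    ('x \<Rightarrow> 'k \<Rightarrow> 'k \<Rightarrow> real) \<Rightarrow> ('x \<Rightarrow> 'k set) \<Rightarrow> ('x \<Rightarrow> 'x set) \<Rightarrow> 'x \<Rightarrow> 'x \<Rightarrow> ennreal" where
  "leaf_edist N g E W x y =
     (INF \<gamma> \<in> {\<gamma>. piecewise_C1_curve N \<gamma> \<and> \<gamma> 0 = x \<and> \<gamma> 1 = y \<and> (\<forall>t\<in>{0..1}. \<gamma> t \<in> W x) \<and>
                finite {t\<in>{0..1}. velocity N \<gamma> t \<notin> E (\<gamma> t)}}.
        curve_length N g \<gamma>)"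

definition partially_hyperbolic_system :: "('x::metric_space, 'k::euclidean_space) chart set \<Rightarrow>
    'x set \<Rightarrow> ('x \<Rightarrow> 'x) \<Rightarrow> ('x \<Rightarrow> real) \<Rightarrow> ('x \<Rightarrow> 'x set) \<Rightarrow> ('x \<Rightarrow> 'x set) \<Rightarrow> bool" where
  "partially_hyperbolic_system N X f l Ws Wl \<longleftrightarrow>
     X = UNIV \<and> compact X \<and> connected X \<and> f \<in> Diff1 N \<and>
     (\<exists>g (Es :: 'x \<Rightarrow> 'k set) (Ec :: 'x \<Rightarrow> 'k set) (Eu :: 'x \<Rightarrow> 'k set)
        (lh :: 'x \<Rightarrow> real) (xi :: 'x \<Rightarrow> real) (xih :: 'x \<Rightarrow> real).
        riemannian_manifold N g \<and>
        continuous_on X l \<and> continuous_on X lh \<and> continuous_on X xi \<and> continuous_on X xih \<and>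
        (\<forall>x. 0 < l x \<and> l x < 1 \<and> 0 < lh x \<and> lh x < 1 \<and> 0 < xi x \<and> 0 < xih x) \<and>
        (\<forall>x. subspace (Es x) \<and> subspace (Ec x) \<and> subspace (Eu x) \<and> Es x \<noteq> {0} \<and> Eu x \<noteq> {0} \<and>
           (\<forall>v. \<exists>!(a, b, c). a \<in> Es x \<and> b \<in> Ec x \<and> c \<in> Eu x \<and> v = a + b + c) \<and>
           mderiv N N f x ` Es x = Es (f x) \<and>
           mderiv N N f x ` Ec x = Ec (f x) \<and>
           mderiv N N f x ` Eu x = Eu (f x) \<and>
           (\<forall>v\<in>Es x. rnorm g x v = 1 \<longrightarrow> rnorm g (f x) (mderiv N N f x v) < l x) \<and>
           l x < xi x \<and>
           (\<forall>v\<in>Ec x. rnorm g x v = 1 \<longrightarrow>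
              xi x < rnorm g (f x) (mderiv N N f x v) \<and>
              rnorm g (f x) (mderiv N N f x v) < inverse (xih x)) \<and>
           inverse (xih x) < inverse (lh x) \<and>
           (\<forall>v\<in>Eu x. rnorm g x v = 1 \<longrightarrow> inverse (lh x) < rnorm g (f x) (mderiv N N f x v))) \<and>
        foliation_tangent_to N Es Ws \<and> (\<forall>x. f ` Ws x = Ws (f x)) \<and>
        (\<exists>r>0. \<forall>x. Wl x = {y. leaf_edist N g Es Ws x y < ennreal r}))"

section \<open>Cocycles\<close>

primrec cocycle_nat :: "('x \<Rightarrow> 'x) \<Rightarrow> ('x \<Rightarrow> 'm \<Rightarrow> 'm) \<Rightarrow> nat \<Rightarrow> 'x \<Rightarrow> 'm \<Rightarrow> 'm" where
  "cocycle_nat f A 0 x = id"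
| "cocycle_nat f A (Suc n) x = A ((f ^^ n) x) \<circ> cocycle_nat f A n x"

definition cocycle ::
    "'x set \<Rightarrow> ('x \<Rightarrow> 'x) \<Rightarrow> ('x \<Rightarrow> 'm \<Rightarrow> 'm) \<Rightarrow> int \<Rightarrow> 'x \<Rightarrow> 'm \<Rightarrow> 'm" where
  "cocycle X f A n x =
     (if 0 \<le> n then cocycle_nat f A (nat n) x
      else inv (cocycle_nat f A (nat (- n)) ((inv_into X f ^^ nat (- n)) x)))"

definition Diff0 :: "('m::metric_space \<Rightarrow> 'm) set" where
  "Diff0 = {h. homeomorphism UNIV UNIV h (inv h)}"

definition dist0 :: "('m::metric_space \<Rightarrow> 'm) \<Rightarrow> ('m \<Rightarrow> 'm) \<Rightarrow> real" where
  "dist0 g h = (SUP t. dist (g t) (h t))"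

definition distC0 :: "('m::metric_space \<Rightarrow> 'm) \<Rightarrow> ('m \<Rightarrow> 'm) \<Rightarrow> real" where
  "distC0 g h = dist0 g h + dist0 (inv g) (inv h)"

definition Diff0_topology :: "('m::metric_space \<Rightarrow> 'm) topology" where
  "Diff0_topology = Metric_space.mtopology Diff0 distC0"

definition holder_Diff0 :: "real \<Rightarrow> 'x::metric_space set \<Rightarrow> ('x \<Rightarrow> 'm::metric_space \<Rightarrow> 'm) \<Rightarrow> bool" where
  "holder_Diff0 \<beta> X \<Psi> \<longleftrightarrow> (\<forall>x\<in>X. \<Psi> x \<in> Diff0) \<and>
     (\<exists>C. \<forall>x\<in>X. \<forall>y\<in>X. distC0 (\<Psi> x) (\<Psi> y) \<le> C * dist x y powr \<beta>)"

definition is_stable_holonomy :: "'x set \<Rightarrow> ('x \<Rightarrow> 'x) \<Rightarrow> ('x \<Rightarrow> 'm::metric_space \<Rightarrow> 'm) \<Rightarrow>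
    'x \<Rightarrow> 'x \<Rightarrow> ('m \<Rightarrow> 'm) \<Rightarrow> bool" where
  "is_stable_holonomy X f A x y H \<longleftrightarrow>
     limitin Diff0_topology
       (\<lambda>n. inv (cocycle X f A (int n) y) \<circ> cocycle X f A (int n) x) H sequentially"

definition stable_holonomy :: "'x set \<Rightarrow> ('x \<Rightarrow> 'x) \<Rightarrow> ('x \<Rightarrow> 'm::metric_space \<Rightarrow> 'm) \<Rightarrow>
    'x \<Rightarrow> 'x \<Rightarrow> 'm \<Rightarrow> 'm" where
  "stable_holonomy X f A x y = (THE H. is_stable_holonomy X f A x y H)"

definition has_stable_holonomies :: "'x::metric_space set \<Rightarrow> ('x \<Rightarrow> 'x) \<Rightarrow> ('x \<Rightarrow> 'x set) \<Rightarrow>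
    ('x \<Rightarrow> 'x set) \<Rightarrow> ('x \<Rightarrow> 'm::metric_space \<Rightarrow> 'm) \<Rightarrow> bool" where
  "has_stable_holonomies X f Ws Wl A \<longleftrightarrow>
     (\<forall>x\<in>X. \<forall>y\<in>Ws x. \<exists>H. is_stable_holonomy X f A x y H) \<and>
     continuous_map (top_of_set (SIGMA x:X. Wl x)) Diff0_topology
       (\<lambda>(x, y). stable_holonomy X f A x y) \<and>
     (\<exists>\<alpha> C. 0 < \<alpha> \<and> \<alpha> \<le> 1 \<and>
        (\<forall>x\<in>X. \<forall>y\<in>Wl x. \<forall>s t.
           dist (stable_holonomy X f A x y s) (stable_holonomy X f A x y t)
             \<le> C * dist s t powr \<alpha>))"

definition conjugacy :: "'x set \<Rightarrow> ('x \<Rightarrow> 'x) \<Rightarrow> ('x \<Rightarrow> 'm::metric_space \<Rightarrow> 'm) \<Rightarrow>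
    ('x \<Rightarrow> 'm \<Rightarrow> 'm) \<Rightarrow> ('x \<Rightarrow> 'm \<Rightarrow> 'm) \<Rightarrow> bool" where
  "conjugacy X f A B \<Phi> \<longleftrightarrow>
     (\<forall>x\<in>X. \<Phi> x \<in> Diff0) \<and> (\<forall>x\<in>X. A x = \<Phi> (f x) \<circ> B x \<circ> inv (\<Phi> x))"

end

theory Submission
  imports Defs
begin

text \<open>
  Along a stable leaf \<open>d(f\<^sup>n x, f\<^sup>n y) \<le> c \<lambda>\<^sup>n\<close>. Since \<open>\<A>\<^sup>n\<close> and its inverse are Lipschitz with
  constant \<open>L \<sigma>\<^sup>n\<close>, two successive approximations \<open>(\<A>\<^sup>n\<^sub>y)\<^sup>-\<^sup>1 \<circ> \<A>\<^sup>n\<^sub>x\<close> differ by at most a constant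
  times \<open>(\<sigma> \<lambda>\<^sup>\<beta>)\<^sup>n\<close>, so they converge uniformly together with their inverses, which are the
  approximations for \<open>(y, x)\<close>. Balancing this rate against the Lipschitz constant \<open>L\<^sup>2 \<sigma>\<^sup>2\<^sup>n\<close> of the
  approximations gives the Hoelder bound on the limit. For a conjugacy, \<open>\<Phi>\<close> at \<open>f\<^sup>n x\<close> and
  \<open>f\<^sup>n y\<close> differs by \<open>O(\<lambda>\<^sup>\<beta>\<^sup>n)\<close>, an error which \<open>(\<B>\<^sup>n\<^sub>y)\<^sup>-\<^sup>1\<close> cannot amplify beyond \<open>(\<sigma> \<lambda>\<^sup>\<beta>)\<^sup>n\<close>.

  Replacing \<open>\<sigma>\<close> by \<open>max 1 \<sigma>\<close> preserves the hypothesis \<open>\<sigma> \<lambda>\<^sup>\<beta> < 1\<close>, because \<open>\<lambda> < 1\<close>.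
\<close>

section \<open>Derivatives in charts\<close>

text \<open>The derivative hypotheses become Lipschitz bounds, but the fibre need not be connected:
  between components \<open>dist\<close> is no Riemannian distance, and derivatives say nothing
  about it. Compactness supplies a constant for such pairs that is independent of the iterate; as it
  does not decay with \<open>n\<close>, the growth rate must be at least 1, whence
  \<open>max 1 \<sigma>\<close>. From there on the fibre is a mere compact metric space
  (\<open>holder_cocycle\<close>).

  On the base, all systems are reduced to \<open>contracting_system\<close>. There one constant
  \<open>c\<close> works for all pairs in local stable sets, while on global stable sets it may
  depend on the pair. The first gives the uniform Hoelder bound and the continuity, the second
  suffices for existence and intertwining. For partially hyperbolic systems the contraction is
  proved for the distance inside the leaves, because only curves tangent to \<open>Es\<close> are
  known to shrink.

  Tangent vectors are coordinates in a preferred chart that may jump from point to point, so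
  continuity arguments are carried out in fixed charts.\<close>

lemma continuous_on_linear_family:
  fixes F :: "'a::topological_space \<Rightarrow> 'b::euclidean_space \<Rightarrow> 'c::real_normed_vector"
  assumes F: "\<And>v. continuous_on S (\<lambda>x. F x v)" and lin: "\<And>x. x \<in> S \<Longrightarrow> linear (F x)"
    and u: "continuous_on S u"
  shows "continuous_on S (\<lambda>x. F x (u x))"
proof -
  \<comment> \<open>In finite dimension a linear map is determined by its values on the basis, so
    continuity for each fixed vector gives continuity along a varying one.\<close>
  have "F x (u x) = (\<Sum>b\<in>Basis. (u x \<bullet> b) *\<^sub>R F x b)" if "x \<in> S" for x
  proof -
    interpret linear "F x" by (rule lin[OF that])
    have "F x (u x) = F x (\<Sum>b\<in>Basis. (u x \<bullet> b) *\<^sub>R b)" by (simp add: euclidean_representation)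
    then show ?thesis by (simp add: sum scale)
  qed
  moreover have "continuous_on S (\<lambda>x. \<Sum>b\<in>Basis. (u x \<bullet> b) *\<^sub>R F x b)"
    by (intro continuous_intros F u)
  ultimately show ?thesis by (simp cong: continuous_on_cong_simp)
qed

text \<open>\<open>mderiv\<close> refers to preferred charts, which may change abruptly with the
  point, so it need not be continuous in the point even for a C1 map. With both charts fixed the
  derivative is continuous, and the chain rule holds for any choice of charts.\<close>

definition loc_deriv :: "('m, 'e::euclidean_space) chart \<Rightarrow> ('n, 'f::euclidean_space) chart \<Rightarrow>
    ('m \<Rightarrow> 'n) \<Rightarrow> 'm \<Rightarrow> 'e \<Rightarrow> 'f" where
  "loc_deriv c c' h x = frechet_derivative (snd c' \<circ> h \<circ> chart_inv c) (at (snd c x))"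

lemma mderiv_loc_deriv: "mderiv M N h x = loc_deriv (chart_at M x) (chart_at N (h x)) h x"
  by (simp add: mderiv_def loc_deriv_def)

text \<open>A change of coordinates is the derivative of the identity in two charts, so the facts
  about C1 maps apply to it through \<open>C1_map_on_id\<close>.\<close>

lemma chart_vec_loc_deriv: "chart_vec M c x = loc_deriv c (chart_at M x) id x"
  by (simp add: chart_vec_def loc_deriv_def)

context
  fixes M :: "('m::metric_space, 'e::euclidean_space) chart set"
  assumes M: "smooth_manifold M"
begin

lemma chart_at: "chart_at M x \<in> M" "x \<in> fst (chart_at M x)"
proof -
  have "\<exists>c. c \<in> M \<and> x \<in> fst c" using M unfolding smooth_manifold_def by blast
  then have "chart_at M x \<in> M \<and> x \<in> fst (chart_at M x)" unfolding chart_at_def by (rule someI_ex)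
  then show "chart_at M x \<in> M" "x \<in> fst (chart_at M x)" by auto
qed

lemma
  assumes "c \<in> M"
  shows open_chart: "open (fst c)" and open_chart_image: "open (snd c ` fst c)"
    and chart_homeomorphism: "homeomorphism (fst c) (snd c ` fst c) (snd c) (chart_inv c)"
  using M assms unfolding smooth_manifold_def by auto

lemma chart_inv_chart: "c \<in> M \<Longrightarrow> x \<in> fst c \<Longrightarrow> chart_inv c (snd c x) = x"
  using chart_homeomorphism unfolding homeomorphism_def by blast

lemma continuous_on_chart: "c \<in> M \<Longrightarrow> continuous_on (fst c) (snd c)"
  using chart_homeomorphism unfolding homeomorphism_def by blast

lemma continuous_on_chart_inv: "c \<in> M \<Longrightarrow> continuous_on (snd c ` fst c) (chart_inv c)"
  using chart_homeomorphism unfolding homeomorphism_def by blast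

lemma open_chart_image_subset:
  assumes "c \<in> M" "open U" "U \<subseteq> fst c"
  shows "open (snd c ` U)"
proof -
  have "openin (top_of_set (fst c)) U" using assms open_chart by (simp add: openin_open_eq)
  then have "openin (top_of_set (snd c ` fst c)) (snd c ` U)"
    using homeomorphism_imp_open_map[OF chart_homeomorphism[OF assms(1)]] by blast
  then show ?thesis using open_chart_image[OF assms(1)] by (simp add: openin_open_eq)
qed

text \<open>Charts are homeomorphisms, so continuity of the derivatives can be tested on the
  manifold itself. In this form it composes directly with curves and maps.\<close>

lemma C1_map_on_iff:
  fixes N :: "('n::metric_space, 'f::euclidean_space) chart set"
  shows "C1_map_on M N UNIV h \<longleftrightarrow> continuous_on UNIV h \<and> (\<forall>c\<in>M. \<forall>c'\<in>N.
     (\<forall>x\<in>fst c \<inter> h -` fst c'. (snd c' \<circ> h \<circ> chart_inv c) differentiable at (snd c x)) \<and>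
     (\<forall>v. continuous_on (fst c \<inter> h -` fst c') (\<lambda>x. loc_deriv c c' h x v)))"
proof -
  have *: "continuous_on (snd c ` U) F \<longleftrightarrow> continuous_on U (\<lambda>x. F (snd c x))"
    if "c \<in> M" "U \<subseteq> fst c" for c U and F :: "'e \<Rightarrow> 'f"
  proof
    assume "continuous_on (snd c ` U) F"
    then show "continuous_on U (\<lambda>x. F (snd c x))"
      using continuous_on_compose2[OF _ continuous_on_subset[OF continuous_on_chart that(2)]] that(1) by blast
  next
    assume a: "continuous_on U (\<lambda>x. F (snd c x))"
    have "continuous_on (snd c ` U) (\<lambda>p. F (snd c (chart_inv c p)))"
    proof (rule continuous_on_compose2[OF a])
      show "continuous_on (snd c ` U) (chart_inv c)"
        using continuous_on_chart_inv that by (meson continuous_on_subset image_mono)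
      show "chart_inv c ` snd c ` U \<subseteq> U" using that chart_inv_chart[OF that(1)] by auto
    qed
    then show "continuous_on (snd c ` U) F"
      by (rule continuous_on_eq) (use that chart_inv_chart[OF that(1)] in auto)
  qed
  have "Ck 1 (snd c ` (UNIV \<inter> fst c \<inter> h -` fst c')) (snd c' \<circ> h \<circ> chart_inv c) \<longleftrightarrow>
     (\<forall>x\<in>fst c \<inter> h -` fst c'. (snd c' \<circ> h \<circ> chart_inv c) differentiable at (snd c x)) \<and>
     (\<forall>v. continuous_on (fst c \<inter> h -` fst c') (\<lambda>x. loc_deriv c c' h x v))" if "c \<in> M" "c' \<in> N" for c c'
    using *[OF that(1) Int_lower1, of "h -` fst c'"] by (simp add: loc_deriv_def)
  then show ?thesis by (simp add: C1_map_on_def)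
qed

lemma C1_map_on_id: "C1_map_on M M UNIV id"
proof -
  have "Ck 1 (snd c ` (fst c \<inter> fst c')) (snd c' \<circ> chart_inv c)" if "c \<in> M" "c' \<in> M" for c c'
    using M that unfolding smooth_manifold_def smooth_on_def by blast
  then show ?thesis by (simp add: C1_map_on_def)
qed

end

context
  fixes M :: "('m::metric_space, 'e::euclidean_space) chart set"
    and N :: "('n::metric_space, 'f::euclidean_space) chart set" and h :: "'m \<Rightarrow> 'n"
  assumes M: "smooth_manifold M" and N: "smooth_manifold N" and h: "C1_map_on M N UNIV h"
begin

lemma C1_map_on_isCont: "isCont h x"
  using h unfolding C1_map_on_def by (simp add: continuous_on_eq_continuous_at)

lemma open_chart_vimage: "c \<in> M \<Longrightarrow> c' \<in> N \<Longrightarrow> open (fst c \<inter> h -` fst c')"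
  by (intro open_Int open_vimage open_chart[OF M] open_chart[OF N])
    (simp_all add: C1_map_on_isCont continuous_on_eq_continuous_at)

lemma loc_deriv:
  assumes "c \<in> M" "c' \<in> N" "x \<in> fst c" "h x \<in> fst c'"
  shows "((snd c' \<circ> h \<circ> chart_inv c) has_derivative loc_deriv c c' h x) (at (snd c x))"
  using h assms unfolding C1_map_on_iff[OF M] loc_deriv_def
  by (auto simp: frechet_derivative_works[symmetric])

lemma linear_loc_deriv:
  assumes "c \<in> M" "c' \<in> N" "x \<in> fst c" "h x \<in> fst c'"
  shows "linear (loc_deriv c c' h x)"
  using loc_deriv[OF assms] by (rule has_derivative_linear)

lemma linear_mderiv: "linear (mderiv M N h x)"
  unfolding mderiv_loc_deriv by (intro linear_loc_deriv chart_at M N)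

lemma continuous_on_loc_deriv:
  assumes c: "c \<in> M" "c' \<in> N" and p: "continuous_on S p" "p ` S \<subseteq> fst c \<inter> h -` fst c'"
    and u: "continuous_on S u"
  shows "continuous_on S (\<lambda>x. loc_deriv c c' h (p x) (u x))"
proof (rule continuous_on_linear_family[where F = "\<lambda>x. loc_deriv c c' h (p x)"])
  show "continuous_on S (\<lambda>x. loc_deriv c c' h (p x) v)" for v
    using h c p unfolding C1_map_on_iff[OF M]
    by (intro continuous_on_compose2[OF _ p(1), of "fst c \<inter> h -` fst c'"]) auto
  show "linear (loc_deriv c c' h (p x))" if "x \<in> S" for x
    using c p that by (intro linear_loc_deriv) auto
qed fact

lemma has_vector_derivative_C1_map_on:
  assumes "c \<in> M" "c' \<in> N" "\<gamma> t \<in> fst c" "h (\<gamma> t) \<in> fst c'" "isCont \<gamma> t"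
    and w: "((snd c \<circ> \<gamma>) has_vector_derivative w) (at t)"
  shows "((snd c' \<circ> (h \<circ> \<gamma>)) has_vector_derivative loc_deriv c c' h (\<gamma> t) w) (at t)"
proof -
  have "((\<lambda>s. (snd c' \<circ> h \<circ> chart_inv c) ((snd c \<circ> \<gamma>) s)) has_vector_derivative
      loc_deriv c c' h (\<gamma> t) w) (at t)"
    unfolding has_vector_derivative_def linear_scale[OF linear_loc_deriv[OF assms(1-4)], symmetric]
    by (rule has_derivative_compose[OF w[unfolded has_vector_derivative_def]])
      (use loc_deriv[OF assms(1-4)] in \<open>simp add: o_def\<close>)
  \<comment> \<open>\<open>chart_inv c\<close> cancels \<open>snd c\<close> only while the curve
    stays in the domain of \<open>c\<close>, which continuity guarantees near
    \<open>t\<close>.\<close>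
  moreover have "\<forall>\<^sub>F s in nhds t. (snd c' \<circ> h \<circ> chart_inv c) ((snd c \<circ> \<gamma>) s) = (snd c' \<circ> (h \<circ> \<gamma>)) s"
  proof -
    have "\<forall>\<^sub>F s in nhds t. \<gamma> s \<in> fst c"
      using \<open>isCont \<gamma> t\<close> open_chart[OF M assms(1)] assms(3)
      by (simp add: isCont_def tendsto_at_iff_tendsto_nhds topological_tendstoD)
    then show ?thesis by eventually_elim (use chart_inv_chart[OF M assms(1)] in auto)
  qed
  ultimately show ?thesis
    by (subst has_vector_derivative_cong_ev[where x = t and S = UNIV, symmetric])
      (use assms(3) chart_inv_chart[OF M assms(1)] in auto)
qed

end

lemma
  fixes M :: "('m::metric_space, 'e::euclidean_space) chart set"
    and N :: "('n::metric_space, 'f::euclidean_space) chart set"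
    and L :: "('l::metric_space, 'd::euclidean_space) chart set"
  assumes M: "smooth_manifold M" and N: "smooth_manifold N" and L: "smooth_manifold L"
    and h: "C1_map_on M N UNIV h" and k: "C1_map_on N L UNIV k"
    and "c \<in> M" "c' \<in> N" "c'' \<in> L" "x \<in> fst c" "h x \<in> fst c'" "k (h x) \<in> fst c''"
  shows has_derivative_comp_charts: "((snd c'' \<circ> (k \<circ> h) \<circ> chart_inv c) has_derivative
      (\<lambda>v. loc_deriv c' c'' k (h x) (loc_deriv c c' h x v))) (at (snd c x))" 
    and loc_deriv_comp: "loc_deriv c c'' (k \<circ> h) x = (\<lambda>v. loc_deriv c' c'' k (h x) (loc_deriv c c' h x v))"
proof -
  let ?p = "snd c x"
  have p: "chart_inv c ?p = x" using chart_inv_chart[OF M] assms by blast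
  have "((\<lambda>q. (snd c'' \<circ> k \<circ> chart_inv c') ((snd c' \<circ> h \<circ> chart_inv c) q)) has_derivative
      (\<lambda>v. loc_deriv c' c'' k (h x) (loc_deriv c c' h x v))) (at ?p)"
    by (rule has_derivative_compose[OF loc_deriv[OF M N h]])
      (use assms p loc_deriv[OF N L k, of c' c'' "h x"] in \<open>auto simp: o_def\<close>)
  then show 1: "((snd c'' \<circ> (k \<circ> h) \<circ> chart_inv c) has_derivative
      (\<lambda>v. loc_deriv c' c'' k (h x) (loc_deriv c c' h x v))) (at ?p)"
  proof (rule has_derivative_transform_within_open)
    show "open (snd c ` (fst c \<inter> h -` fst c'))"
      using assms by (intro open_chart_image_subset[OF M] open_chart_vimage[OF M N h]) auto
    show "?p \<in> snd c ` (fst c \<inter> h -` fst c')" using assms by auto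
  qed (use assms chart_inv_chart[OF M \<open>c \<in> M\<close>] chart_inv_chart[OF N \<open>c' \<in> N\<close>] in auto)
  show "loc_deriv c c'' (k \<circ> h) x = (\<lambda>v. loc_deriv c' c'' k (h x) (loc_deriv c c' h x v))"
    using frechet_derivative_at[OF 1] by (simp add: loc_deriv_def[of c c''])
qed


lemma C1_map_on_comp:
  fixes M :: "('m::metric_space, 'e::euclidean_space) chart set"
    and N :: "('n::metric_space, 'f::euclidean_space) chart set"
    and L :: "('l::metric_space, 'd::euclidean_space) chart set"
  assumes M: "smooth_manifold M" and N: "smooth_manifold N" and L: "smooth_manifold L"
    and h: "C1_map_on M N UNIV h" and k: "C1_map_on N L UNIV k"
  shows "C1_map_on M L UNIV (k \<circ> h)"
  unfolding C1_map_on_iff[OF M]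
proof (intro conjI ballI allI)
  show "continuous_on UNIV (k \<circ> h)"
    using continuous_on_compose[of UNIV h k] h k continuous_on_subset[of UNIV k]
    unfolding C1_map_on_def by blast
  fix c c'' assume c: "c \<in> M" "c'' \<in> L"
  let ?U = "fst c \<inter> (k \<circ> h) -` fst c''"
  show "(snd c'' \<circ> (k \<circ> h) \<circ> chart_inv c) differentiable at (snd c x)" if "x \<in> ?U" for x
    using has_derivative_comp_charts[OF M N L h k c(1) chart_at(1)[OF N, of "h x"] c(2)]
      chart_at(2)[OF N, of "h x"] that unfolding differentiable_def by fastforce
  fix v
  show "continuous_on ?U (\<lambda>x. loc_deriv c c'' (k \<circ> h) x v)"
  proof (rule continuous_at_imp_continuous_on, rule ballI)
    fix x assume x: "x \<in> ?U"
    \<comment> \<open>The intermediate chart is chosen around \<open>h x\<close> and serves only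
      nearby points; this is why continuity is proved point by point.\<close>
    define c' where "c' = chart_at N (h x)"
    have c': "c' \<in> N" "h x \<in> fst c'" using chart_at[OF N] by (auto simp: c'_def)
    let ?V = "(fst c \<inter> h -` fst c') \<inter> h -` (fst c' \<inter> k -` fst c'')"
    have "open ?V"
      using C1_map_on_isCont[OF M N h] c c'
      by (intro open_Int open_vimage open_chart_vimage[OF M N h] open_chart_vimage[OF N L k])
        (auto simp: continuous_on_eq_continuous_at)
    moreover have "x \<in> ?V" using x c' by auto
    moreover have "continuous_on ?V (\<lambda>x. loc_deriv c' c'' k (h x) (loc_deriv c c' h x v))"
      using c c' h
      by (intro continuous_on_loc_deriv[OF N L k] continuous_on_loc_deriv[OF M N h, of _ _ _ "\<lambda>x. x"]
          continuous_intros) (auto simp: C1_map_on_def intro: continuous_on_subset)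
    then have "continuous_on ?V (\<lambda>x. loc_deriv c c'' (k \<circ> h) x v)"
      by (rule continuous_on_eq) (use c c' loc_deriv_comp[OF M N L h k] in auto)
    ultimately show "isCont (\<lambda>x. loc_deriv c c'' (k \<circ> h) x v) x"
      by (simp add: continuous_on_eq_continuous_at)
  qed
qed

lemma loc_deriv_id:
  assumes M: "smooth_manifold M" and "c \<in> M" "x \<in> fst c"
  shows "loc_deriv c c id x = id"
proof -
  have "(id has_derivative id) (at (snd c x))" by (simp add: id_def)
  then have "((snd c \<circ> id \<circ> chart_inv c) has_derivative id) (at (snd c x))"
    by (rule has_derivative_transform_within_open[OF _ open_chart_image[OF M]])
      (use assms chart_inv_chart[OF M assms(2)] in auto)
  then show ?thesis unfolding loc_deriv_def by (rule frechet_derivative_at[symmetric])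
qed

lemma loc_deriv_inverse:
  assumes M: "smooth_manifold M" and "c \<in> M" "x \<in> fst c" "c' \<in> M" "x \<in> fst c'"
  shows "loc_deriv c c' id x (loc_deriv c' c id x v) = v"
  using loc_deriv_comp[OF M M M C1_map_on_id[OF M] C1_map_on_id[OF M], of c' c c' x] assms
    loc_deriv_id[OF M, of c' x] by (metis comp_id id_apply)

text \<open>The chain rule for \<open>h\<close> with \<open>id\<close> inserted on either side. It
  links the derivative in preferred charts, of which the hypotheses speak, with the one in fixed
  charts, which is continuous.\<close>

lemma mderiv_chart_vec:
  assumes M: "smooth_manifold M" and N: "smooth_manifold N" and h: "C1_map_on M N UNIV h"
    and "c \<in> M" "x \<in> fst c" "c' \<in> N" "h x \<in> fst c'"
  shows "mderiv M N h x (chart_vec M c x w) = chart_vec N c' (h x) (loc_deriv c c' h x w)"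
  unfolding mderiv_loc_deriv chart_vec_loc_deriv
  using loc_deriv_comp[OF M M N C1_map_on_id[OF M] h, of c "chart_at M x" "chart_at N (h x)" x]
    loc_deriv_comp[OF M N N h C1_map_on_id[OF N], of c c' "chart_at N (h x)" x]
    assms chart_at[OF M] chart_at[OF N] by (simp add: fun_eq_iff)

section \<open>Riemannian norms and bounds on derivatives\<close>

context
  fixes M :: "('m::metric_space, 'e::euclidean_space) chart set"
    and g :: "'m \<Rightarrow> 'e \<Rightarrow> 'e \<Rightarrow> real"
  assumes M: "smooth_manifold M" and g: "riemannian_metric M g"
begin

lemma metric_pos: "v \<noteq> 0 \<Longrightarrow> 0 < g x v v" and metric_bilinear: "bilinear (g x)"
  using g unfolding riemannian_metric_def by auto

lemma metric_nonneg: "0 \<le> g x v v"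
  using metric_pos[of v x] bilinear_lzero[OF metric_bilinear] by (cases "v = 0") auto

lemma rnorm_nonneg: "0 \<le> rnorm g x v"
  by (simp add: rnorm_def metric_nonneg)

lemma rnorm_eq_0_iff: "rnorm g x v = 0 \<longleftrightarrow> v = 0"
  using metric_pos[of v x] bilinear_lzero[OF metric_bilinear] by (cases "v = 0") (auto simp: rnorm_def)

lemma rnorm_scaleR: "rnorm g x (r *\<^sub>R v) = \<bar>r\<bar> * rnorm g x v"
  by (simp add: rnorm_def bilinear_lmul[OF metric_bilinear] bilinear_rmul[OF metric_bilinear]
      real_sqrt_mult flip: power2_eq_square mult.assoc)

lemma linear_chart_vec: "c \<in> M \<Longrightarrow> x \<in> fst c \<Longrightarrow> linear (chart_vec M c x)"
  unfolding chart_vec_loc_deriv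
  by (intro linear_loc_deriv[OF M M C1_map_on_id[OF M]] chart_at[OF M]) (auto simp: chart_at[OF M])

text \<open>Smoothness of the metric controls its coefficients for constant coordinate vectors.
  Linearity in one argument and then in the other extends this to vectors that vary with the
  parameter.\<close>

lemma continuous_on_metric:
  assumes c: "c \<in> M" and p: "continuous_on S p" "p ` S \<subseteq> fst c" and u: "continuous_on S u"
    and w: "continuous_on S w"
  shows "continuous_on S (\<lambda>s. g (p s) (chart_vec M c (p s) (u s)) (chart_vec M c (p s) (w s)))"
proof -
  have lin: "linear (chart_vec M c (p s))" if "s \<in> S" for s
    using linear_chart_vec[OF c] p(2) that by blast
  have base: "continuous_on S (\<lambda>s. g (p s) (chart_vec M c (p s) v) (chart_vec M c (p s) v'))" for v v'
  proof -
    have "Ck 0 (snd c ` fst c) (\<lambda>q. g (chart_inv c q) (chart_vec M c (chart_inv c q) v)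
        (chart_vec M c (chart_inv c q) v'))"
      using g c unfolding riemannian_metric_def smooth_on_def by blast
    then have "continuous_on (snd c ` fst c) (\<lambda>q. g (chart_inv c q) (chart_vec M c (chart_inv c q) v)
        (chart_vec M c (chart_inv c q) v'))" by simp
    from continuous_on_compose2[OF this continuous_on_chart[OF M c]]
    have "continuous_on (fst c) (\<lambda>x. g x (chart_vec M c x v) (chart_vec M c x v'))"
      by (rule continuous_on_eq) (use chart_inv_chart[OF M c] in auto)
    then show ?thesis using continuous_on_compose2[OF _ p] by blast
  qed
  have 1: "continuous_on S (\<lambda>s. g (p s) (chart_vec M c (p s) v) (chart_vec M c (p s) (w s)))" for v
    by (rule continuous_on_linear_family[OF base _ w])
      (use linear_compose[OF lin] metric_bilinear in \<open>auto simp: bilinear_def o_def\<close>)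
  have "linear (\<lambda>v. g (p s) (chart_vec M c (p s) v) (chart_vec M c (p s) (w s)))" if "s \<in> S" for s
    using linear_compose[OF lin[OF that], of "\<lambda>v. g (p s) v (chart_vec M c (p s) (w s))"] metric_bilinear
    by (simp add: bilinear_def o_def)
  then show ?thesis
    by (rule continuous_on_linear_family[OF 1 _ u])
qed

lemma chart_vec_surj:
  assumes "c \<in> M" "x \<in> fst c"
  obtains w where "v = chart_vec M c x w"
  using that[of "loc_deriv (chart_at M x) c id x v"] loc_deriv_inverse[OF M assms chart_at[OF M, of x], of v]
  by (simp add: chart_vec_loc_deriv)

lemma chart_vec_eq_0_iff:
  assumes "c \<in> M" "x \<in> fst c"
  shows "chart_vec M c x w = 0 \<longleftrightarrow> w = 0"
proof
  have L: "linear (loc_deriv (chart_at M x) c id x)"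
    using assms by (intro linear_loc_deriv[OF M M C1_map_on_id[OF M]] chart_at[OF M]) auto
  assume "chart_vec M c x w = 0"
  then show "w = 0"
    using loc_deriv_inverse[OF M chart_at[OF M, of x] assms, of w] linear_0[OF L]
    by (simp add: chart_vec_loc_deriv)
qed (simp add: linear_0[OF linear_chart_vec[OF assms]])

end

text \<open>In a fixed chart the quotient of the norms after and before differentiation is
  continuous. By homogeneity it suffices to bound it for coordinate vectors of Euclidean length 1,
  that is, on the compact product of a small closed ball with a sphere.\<close>

lemma mderiv_locally_bounded:
  fixes M :: "('m::metric_space, 'e::euclidean_space) chart set"
    and N :: "('n::metric_space, 'f::euclidean_space) chart set"
  assumes comp: "compact (UNIV :: 'm set)"
    and M: "smooth_manifold M" and g: "riemannian_metric M g"
    and N: "smooth_manifold N" and g': "riemannian_metric N g'" and h: "C1_map_on M N UNIV h"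
  shows "\<exists>e>0. \<exists>B. \<forall>x\<in>ball x0 e. \<forall>v. rnorm g' (h x) (mderiv M N h x v) \<le> B * rnorm g x v"
proof -
  define c where "c = chart_at M x0"
  define c' where "c' = chart_at N (h x0)"
  have c: "c \<in> M" "x0 \<in> fst c" "c' \<in> N" "h x0 \<in> fst c'"
    using chart_at[OF M] chart_at[OF N] by (auto simp: c_def c'_def)
  obtain e where e: "e > 0" "cball x0 e \<subseteq> fst c \<inter> h -` fst c'"
    using open_chart_vimage[OF M N h c(1,3)] c by (metis IntI open_contains_cball vimageI)
  let ?S = "cball x0 e \<times> sphere 0 1 :: ('m \<times> 'e) set"
  define \<phi> where "\<phi> = (\<lambda>(x, w). rnorm g x (chart_vec M c x w))"
  define \<psi> where "\<psi> = (\<lambda>(x, w). rnorm g' (h x) (chart_vec N c' (h x) (loc_deriv c c' h x w)))"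
  have "compact (cball x0 e)" using closed_Int_compact[OF closed_cball comp] by simp
  then have cS: "compact ?S" by (intro compact_Times) auto
  have hp: "continuous_on S (\<lambda>s. h (p s))" if "continuous_on S p" for S :: "('m \<times> 'e) set" and p
    using h that continuous_on_compose2[of UNIV h S p] unfolding C1_map_on_def by auto
  have "continuous_on ?S \<phi>" unfolding \<phi>_def rnorm_def split_beta
    by (intro continuous_intros continuous_on_metric[OF M g c(1)]) (use e in auto)
  moreover have "continuous_on ?S \<psi>" unfolding \<psi>_def rnorm_def split_beta
    by (intro continuous_intros continuous_on_metric[OF N g' c(3)] hp continuous_on_loc_deriv[OF M N h c(1,3)])
      (use e in auto)
  moreover have pos: "\<phi> s > 0" if "s \<in> ?S" for s
  proof -
    have "chart_vec M c (fst s) (snd s) \<noteq> 0"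
      using chart_vec_eq_0_iff[OF M g c(1), of "fst s" "snd s"] that e by auto
    then show ?thesis using rnorm_nonneg[OF M g] rnorm_eq_0_iff[OF M g]
      unfolding \<phi>_def split_beta by (metis less_eq_real_def)
  qed
  ultimately have "continuous_on ?S (\<lambda>s. \<psi> s / \<phi> s)" by (intro continuous_intros) force+
  then have "bounded ((\<lambda>s. \<psi> s / \<phi> s) ` ?S)"
    by (intro compact_imp_bounded compact_continuous_image cS)
  then obtain B where B: "\<And>s. s \<in> ?S \<Longrightarrow> norm (\<psi> s / \<phi> s) \<le> B"
    unfolding bounded_iff by fast
  have "rnorm g' (h x) (mderiv M N h x v) \<le> B * rnorm g x v" if x: "x \<in> ball x0 e" for x v
  proof -
    have "x \<in> cball x0 e" using x by simp
    then have x': "x \<in> fst c" "h x \<in> fst c'" using e(2) by auto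
    obtain w where w: "v = chart_vec M c x w" using chart_vec_surj[OF M g c(1) x'(1)] by blast
    define u where "u = inverse (norm w) *\<^sub>R w"
    show ?thesis
    proof (cases "w = 0")
      case True
      then show ?thesis
        using w linear_0[OF linear_mderiv[OF M N h]] chart_vec_eq_0_iff[OF M g c(1) x'(1), of w]
          rnorm_eq_0_iff[OF M g, of x 0] rnorm_eq_0_iff[OF N g', of "h x" 0] by simp
    next
      case False
      then have s: "(x, u) \<in> ?S" using x by (auto simp: u_def)
      have "w = norm w *\<^sub>R u" using False by (simp add: u_def)
      then have v: "v = norm w *\<^sub>R chart_vec M c x u"
        using w linear_scale[OF linear_chart_vec[OF M g c(1) x'(1)]] by metis
      have "\<psi> (x, u) \<le> B * \<phi> (x, u)" using B[OF s] pos[OF s] by (simp add: divide_le_eq abs_le_iff)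
      then have "norm w * \<psi> (x, u) \<le> B * (norm w * \<phi> (x, u))"
        using mult_left_mono[of "\<psi> (x, u)" "B * \<phi> (x, u)" "norm w"] by (simp add: mult.left_commute)
      then show ?thesis
        unfolding v linear_scale[OF linear_mderiv[OF M N h]] rnorm_scaleR[OF M g] rnorm_scaleR[OF N g']
          mderiv_chart_vec[OF M N h c(1) x'(1) c(3) x'(2)] \<phi>_def \<psi>_def by simp
    qed
  qed
  then show ?thesis using e(1) by blast
qed

text \<open>A real supremum bounds its set only if the set is bounded above, so
  \<open>deriv_norm\<close> becomes usable only after this a priori bound. Compactness patches the
  local bounds together.\<close>

lemma mderiv_bounded:
  fixes M :: "('m::metric_space, 'e::euclidean_space) chart set"
    and N :: "('n::metric_space, 'f::euclidean_space) chart set"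
  assumes comp: "compact (UNIV :: 'm set)"
    and M: "smooth_manifold M" and g: "riemannian_metric M g"
    and N: "smooth_manifold N" and g': "riemannian_metric N g'" and h: "C1_map_on M N UNIV h"
  obtains B where "\<And>x v. rnorm g' (h x) (mderiv M N h x v) \<le> B * rnorm g x v"
proof -
  obtain e B where e: "\<And>x. e x > 0"
    and B: "\<And>y x v. x \<in> ball y (e y) \<Longrightarrow> rnorm g' (h x) (mderiv M N h x v) \<le> B y * rnorm g x v"
    using mderiv_locally_bounded[OF assms] by metis
  have "UNIV \<subseteq> (\<Union>y\<in>UNIV. ball y (e y))" using e by auto
  then obtain C where C: "finite C" "UNIV \<subseteq> (\<Union>y\<in>C. ball y (e y))"
    using compactE_image[OF comp, of UNIV "\<lambda>y. ball y (e y)"] by (metis open_ball)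
  show thesis
  proof
    fix x v
    obtain y where y: "y \<in> C" "x \<in> ball y (e y)" using C(2) by blast
    have "B y \<le> Max (B ` C)" using y C(1) by simp
    then show "rnorm g' (h x) (mderiv M N h x v) \<le> Max (B ` C) * rnorm g x v"
      using B[OF y(2), of v] mult_right_mono[OF _ rnorm_nonneg[OF M g]] by (meson order_trans)
  qed
qed

lemma
  fixes M :: "('m::metric_space, 'e::euclidean_space) chart set"
  assumes comp: "compact (UNIV :: 'm set)"
    and M: "smooth_manifold M" and g: "riemannian_metric M g" and h: "C1_map_on M M UNIV h"
  shows deriv_norm_nonneg: "0 \<le> deriv_norm M g h"
    and rnorm_mderiv_le: "rnorm g (h x) (mderiv M M h x v) \<le> deriv_norm M g h * rnorm g x v"
proof -
  obtain B where B: "\<And>x v. rnorm g (h x) (mderiv M M h x v) \<le> B * rnorm g x v"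
    using mderiv_bounded[OF comp M g M g h] by blast
  have unit: "rnorm g x (inverse (rnorm g x v) *\<^sub>R v) = 1" if "v \<noteq> 0" for x v
    using that rnorm_eq_0_iff[OF M g, of x v] rnorm_nonneg[OF M g, of x v] by (simp add: rnorm_scaleR[OF M g])
  \<comment> \<open>The model space has positive dimension, so there are unit vectors and no
    supremum is taken over the empty set.\<close>
  obtain b :: 'e where "b \<noteq> 0" using nonzero_Basis by blast
  then have ne: "{v. rnorm g x v = 1} \<noteq> {}" for x using unit by blast
  have bdd: "bdd_above ((\<lambda>v. rnorm g (h x) (mderiv M M h x v)) ` {v. rnorm g x v = 1})" for x
  proof (rule bdd_aboveI2)
    show "rnorm g (h x) (mderiv M M h x v) \<le> B" if "v \<in> {v. rnorm g x v = 1}" for v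
      using B[of x v] that by simp
  qed
  have le: "deriv_norm_at M g h x \<le> B" for x
    unfolding deriv_norm_at_def by (rule cSUP_least[OF ne]) (metis B mem_Collect_eq mult.right_neutral)
  have at: "rnorm g (h x) (mderiv M M h x v) \<le> deriv_norm_at M g h x" if "rnorm g x v = 1" for x v
    unfolding deriv_norm_at_def by (rule cSUP_upper[OF _ bdd]) (use that in auto)
  have "deriv_norm_at M g h x \<le> deriv_norm M g h" for x
    unfolding deriv_norm_def by (rule cSUP_upper) (use le in \<open>auto intro!: bdd_aboveI[of _ B]\<close>)
  then have at': "rnorm g (h x) (mderiv M M h x v) \<le> deriv_norm M g h" if "rnorm g x v = 1" for x v
    using at[OF that] order_trans by blast
  obtain u where u: "rnorm g undefined u = 1" using ne[of undefined] by blast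
  show "0 \<le> deriv_norm M g h"
    by (rule order_trans[OF rnorm_nonneg[OF M g] at'[OF u]])
  show "rnorm g (h x) (mderiv M M h x v) \<le> deriv_norm M g h * rnorm g x v"
  proof (cases "v = 0")
    case True
    then show ?thesis
      using linear_0[OF linear_mderiv[OF M M h], of x] rnorm_eq_0_iff[OF M g, of x 0]
        rnorm_eq_0_iff[OF M g, of "h x" 0] by simp
  next
    case False
    then have pos: "rnorm g x v > 0" using rnorm_eq_0_iff[OF M g] rnorm_nonneg[OF M g] by (metis less_eq_real_def)
    have "\<bar>inverse (rnorm g x v)\<bar> * rnorm g (h x) (mderiv M M h x v) \<le> deriv_norm M g h"
      using at'[OF unit[OF False], of x]
      by (simp only: linear_scale[OF linear_mderiv[OF M M h]] rnorm_scaleR[OF M g])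
    then show ?thesis using pos by (simp add: field_simps)
  qed
qed

section \<open>Curves and Riemannian distance\<close>

text \<open>No measurability of \<open>f\<close> is assumed: dividing a simple function below
  \<open>r * f\<close> by \<open>r\<close> yields one below \<open>f\<close>. Curve lengths can thus
  be compared without measurability of the speed.\<close>

lemma nn_integral_cmult_le:
  "(\<integral>\<^sup>+x. ennreal r * f x \<partial>M) \<le> ennreal r * (\<integral>\<^sup>+x. f x \<partial>M)"
proof (cases "r \<le> 0")
  case True
  then show ?thesis by (simp add: ennreal_neg)
next
  case False
  let ?c = "ennreal r"
  have c: "?c \<noteq> 0" "?c \<noteq> top" using False by auto
  show ?thesis
    unfolding nn_integral_def[of M "\<lambda>x. ?c * f x"]
  proof (rule SUP_least, safe)
    fix u assume u: "simple_function M u" "u \<le> (\<lambda>x. ?c * f x)"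
    have u': "simple_function M (\<lambda>x. u x / ?c)" using u(1) by (rule simple_function_compose1)
    have "u x / ?c \<le> f x" for x
      using divide_right_mono_ennreal[OF le_funD[OF u(2)], of x ?c] ennreal_mult_divide_eq[OF c, of "f x"]
      by (simp add: mult.commute)
    then have "integral\<^sup>S M (\<lambda>x. u x / ?c) \<le> integral\<^sup>N M f"
      unfolding nn_integral_def using u' by (intro SUP_upper) (auto simp: le_fun_def)
    then have "?c * integral\<^sup>S M (\<lambda>x. u x / ?c) \<le> ?c * integral\<^sup>N M f" by (rule mult_left_mono) simp
    moreover have "?c * integral\<^sup>S M (\<lambda>x. u x / ?c) = integral\<^sup>S M (\<lambda>x. ?c * (u x / ?c))"
      by (rule simple_integral_mult[OF u', symmetric])
    moreover have "?c * (u x / ?c) = u x" for x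
      using ennreal_mult_divide_eq[OF c, of "u x"] by (simp add: ennreal_times_divide mult.commute)
    ultimately show "integral\<^sup>S M u \<le> ?c * integral\<^sup>N M f" by simp
  qed
qed

text \<open>For positive \<open>r\<close> one divides by it. For \<open>r \<le> 0\<close> the right
  side is 0 whatever the infimum is, and it takes an index in \<open>I\<close> to see that
  \<open>a\<close> vanishes too.\<close>

lemma le_mult_INF_ennreal:
  fixes f :: "'a \<Rightarrow> ennreal"
  assumes "I \<noteq> {}" and le: "\<And>i. i \<in> I \<Longrightarrow> a \<le> ennreal r * f i"
  shows "a \<le> ennreal r * (INF i\<in>I. f i)"
proof (cases "r \<le> 0")
  case True
  then show ?thesis using assms by (auto simp: ennreal_neg)
next
  case False
  then have c: "ennreal r \<noteq> 0" "ennreal r \<noteq> top" by auto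
  have "a / ennreal r \<le> f i" if "i \<in> I" for i
    using divide_right_mono_ennreal[OF le[OF that], of "ennreal r"] ennreal_mult_divide_eq[OF c, of "f i"]
    by (simp add: mult.commute)
  then have "ennreal r * (a / ennreal r) \<le> ennreal r * (INF i\<in>I. f i)"
    by (intro mult_left_mono INF_greatest) auto
  then show ?thesis
    using ennreal_mult_divide_eq[OF c, of a] by (simp add: ennreal_times_divide mult.commute)
qed

section \<open>Piecewise C1 curves: speed, composition with maps, and length\<close>

lemma continuous_on_locally:
  fixes f :: "'a::metric_space \<Rightarrow> 'b::topological_space"
  assumes "\<And>x. x \<in> S \<Longrightarrow> \<exists>V. open V \<and> x \<in> V \<and> continuous_on (S \<inter> V) f"
  shows "continuous_on S f"
  unfolding continuous_on_eq_continuous_within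
proof
  fix x assume x: "x \<in> S"
  then obtain V where V: "open V" "x \<in> V" "continuous_on (S \<inter> V) f" using assms by blast
  have "at x within S \<inter> V = at x within S" by (rule at_within_nhd[OF V(2,1)]) auto
  then show "continuous (at x within S) f"
    using V x unfolding continuous_on_eq_continuous_within continuous_within by force
qed

text \<open>The smooth part of a piecewise C1 curve. Continuity and derivatives are two-sided at
  every parameter of \<open>I\<close>, endpoints included, because \<open>velocity\<close> is a
  derivative \<open>at t\<close> and not within the interval.\<close>

definition C1_curve_on ::
    "('m::metric_space, 'e::euclidean_space) chart set \<Rightarrow> real set \<Rightarrow> (real \<Rightarrow> 'm) \<Rightarrow> bool" where
  "C1_curve_on M I \<gamma> \<longleftrightarrow> (\<forall>t\<in>I. isCont \<gamma> t) \<and>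
     (\<forall>c\<in>M. (snd c \<circ> \<gamma>) C1_differentiable_on (I \<inter> \<gamma> -` fst c))"

lemma piecewise_C1_curve_iff:
  "piecewise_C1_curve M \<gamma> \<longleftrightarrow>
    continuous_on {0..1} \<gamma> \<and> (\<exists>T. finite T \<and> C1_curve_on M ({0..1} - T) \<gamma>)"
proof (intro iffI conjI)
  assume g: "piecewise_C1_curve M \<gamma>"
  then obtain T where T: "finite T" "continuous_on {0..1} \<gamma>"
    "\<And>c. c \<in> M \<Longrightarrow> (snd c \<circ> \<gamma>) C1_differentiable_on (({0..1} - T) \<inter> \<gamma> -` fst c)"
    unfolding piecewise_C1_curve_def by auto
  \<comment> \<open>The endpoints join the exceptional set: continuity on \<open>{0..1}\<close> is
    two-sided only in the interior.\<close>
  have "isCont \<gamma> t" if "t \<in> {0..1} - insert 0 (insert 1 T)" for t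
    using continuous_on_interior[OF T(2), of t] that by auto
  moreover have "(snd c \<circ> \<gamma>) C1_differentiable_on (({0..1} - insert 0 (insert 1 T)) \<inter> \<gamma> -` fst c)"
    if "c \<in> M" for c
    by (rule C1_differentiable_on_subset[OF T(3)[OF that]]) auto
  ultimately show "\<exists>T. finite T \<and> C1_curve_on M ({0..1} - T) \<gamma>"
    using T(1) unfolding C1_curve_on_def by (intro exI[of _ "insert 0 (insert 1 T)"]) auto
qed (auto simp: piecewise_C1_curve_def C1_curve_on_def)

context
  fixes M :: "('m::metric_space, 'e::euclidean_space) chart set" and I \<gamma>
  assumes M: "smooth_manifold M" and \<gamma>: "C1_curve_on M I \<gamma>"
begin

lemma C1_curve_on_nhd:
  assumes "c \<in> M" "t \<in> I" "\<gamma> t \<in> fst c"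
  obtains V where "open V" "t \<in> V" "\<And>s. s \<in> V \<Longrightarrow> \<gamma> s \<in> fst c"
proof -
  have "isCont \<gamma> t" using \<gamma> assms unfolding C1_curve_on_def by blast
  then have "\<forall>\<^sub>F s in nhds t. \<gamma> s \<in> fst c"
    using open_chart[OF M assms(1)] assms(3)
    by (simp add: isCont_def tendsto_at_iff_tendsto_nhds topological_tendstoD)
  then show thesis using that unfolding eventually_nhds by blast
qed

lemma C1_curve_on_continuous: "continuous_on I \<gamma>"
  using \<gamma> by (auto simp: C1_curve_on_def intro: continuous_at_imp_continuous_on)

lemma C1_curve_on_chart:
  assumes "c \<in> M"
  obtains D where "\<And>t. t \<in> I \<Longrightarrow> \<gamma> t \<in> fst c \<Longrightarrow> ((snd c \<circ> \<gamma>) has_vector_derivative D t) (at t)"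
    and "continuous_on (I \<inter> \<gamma> -` fst c) D"
  using \<gamma> assms unfolding C1_curve_on_def C1_differentiable_on_def by blast

lemma velocity_chart:
  assumes "c \<in> M" "t \<in> I" "\<gamma> t \<in> fst c" "((snd c \<circ> \<gamma>) has_vector_derivative w) (at t)"
  shows "velocity M \<gamma> t = chart_vec M c (\<gamma> t) w"
proof -
  have "((snd (chart_at M (\<gamma> t)) \<circ> (id \<circ> \<gamma>)) has_vector_derivative
      loc_deriv c (chart_at M (\<gamma> t)) id (\<gamma> t) w) (at t)"
    using assms \<gamma> chart_at[OF M]
    by (intro has_vector_derivative_C1_map_on[OF M M C1_map_on_id[OF M]]) (auto simp: C1_curve_on_def)
  then show ?thesis
    unfolding velocity_def chart_vec_loc_deriv by (simp add: vector_derivative_at)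
qed

text \<open>The coordinates of the velocity may jump with the preferred chart, but the speed does
  not: near each parameter it can be computed in a single chart.\<close>

lemma continuous_on_speed:
  assumes g: "riemannian_metric M g"
  shows "continuous_on I (\<lambda>t. rnorm g (\<gamma> t) (velocity M \<gamma> t))"
proof (rule continuous_on_locally)
  fix t0 assume t0: "t0 \<in> I"
  define c where "c = chart_at M (\<gamma> t0)"
  have c: "c \<in> M" "\<gamma> t0 \<in> fst c" using chart_at[OF M] by (auto simp: c_def)
  obtain V where V: "open V" "t0 \<in> V" "\<And>s. s \<in> V \<Longrightarrow> \<gamma> s \<in> fst c"
    using C1_curve_on_nhd[OF c(1) t0 c(2)] by blast
  obtain D where D: "\<And>t. t \<in> I \<Longrightarrow> \<gamma> t \<in> fst c \<Longrightarrow> ((snd c \<circ> \<gamma>) has_vector_derivative D t) (at t)"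
    "continuous_on (I \<inter> \<gamma> -` fst c) D" using C1_curve_on_chart[OF c(1)] by blast
  have sub: "I \<inter> V \<subseteq> I \<inter> \<gamma> -` fst c" using V by auto
  have "continuous_on (I \<inter> V) (\<lambda>t. rnorm g (\<gamma> t) (chart_vec M c (\<gamma> t) (D t)))"
    unfolding rnorm_def using sub continuous_on_subset[OF C1_curve_on_continuous] continuous_on_subset[OF D(2)]
    by (intro continuous_intros continuous_on_metric[OF M g c(1)]) auto
  then have "continuous_on (I \<inter> V) (\<lambda>t. rnorm g (\<gamma> t) (velocity M \<gamma> t))"
    by (rule continuous_on_eq) (use velocity_chart[OF c(1) _ _ D(1)] V(3) in auto)
  then show "\<exists>V. open V \<and> t0 \<in> V \<and> continuous_on (I \<inter> V) (\<lambda>t. rnorm g (\<gamma> t) (velocity M \<gamma> t))"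
    using V by blast
qed

lemma
  fixes N :: "('n::metric_space, 'f::euclidean_space) chart set"
  assumes N: "smooth_manifold N" and h: "C1_map_on M N UNIV h"
  shows C1_curve_on_comp: "C1_curve_on N I (h \<circ> \<gamma>)"
    and velocity_comp: "t \<in> I \<Longrightarrow> velocity N (h \<circ> \<gamma>) t = mderiv M N h (\<gamma> t) (velocity M \<gamma> t)"
proof -
  have cont: "isCont \<gamma> t" if "t \<in> I" for t using \<gamma> that by (simp add: C1_curve_on_def)
  have vd: "((snd c' \<circ> (h \<circ> \<gamma>)) has_vector_derivative loc_deriv c c' h (\<gamma> t) w) (at t)"
    if "c \<in> M" "c' \<in> N" "t \<in> I" "\<gamma> t \<in> fst c" "h (\<gamma> t) \<in> fst c'"
      "((snd c \<circ> \<gamma>) has_vector_derivative w) (at t)" for c c' t w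
    using has_vector_derivative_C1_map_on[OF M N h that(1,2,4,5) cont[OF that(3)] that(6)] .
  show "C1_curve_on N I (h \<circ> \<gamma>)"
    unfolding C1_curve_on_def C1_differentiable_on_def
  proof (intro conjI ballI)
    show "isCont (h \<circ> \<gamma>) t" if "t \<in> I" for t
      using cont[OF that] C1_map_on_isCont[OF M N h] by (rule continuous_at_compose)
    fix c' assume c': "c' \<in> N"
    let ?J = "I \<inter> (h \<circ> \<gamma>) -` fst c'"
    \<comment> \<open>Different parameters call for different charts of the source. Expressing all
      local derivatives by \<open>vector_derivative\<close> gives one function, so that local
      continuity glues.\<close>
    let ?D = "\<lambda>t. vector_derivative (snd c' \<circ> (h \<circ> \<gamma>)) (at t)"
    have "\<exists>V. open V \<and> t0 \<in> V \<and> continuous_on (?J \<inter> V) ?D \<and>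
        ((snd c' \<circ> (h \<circ> \<gamma>)) has_vector_derivative ?D t0) (at t0)" if t0: "t0 \<in> ?J" for t0
    proof -
      define c where "c = chart_at M (\<gamma> t0)"
      have c: "c \<in> M" "\<gamma> t0 \<in> fst c" using chart_at[OF M] by (auto simp: c_def)
      obtain V where V: "open V" "t0 \<in> V" "\<And>s. s \<in> V \<Longrightarrow> \<gamma> s \<in> fst c"
        using C1_curve_on_nhd[OF c(1) _ c(2)] t0 by blast
      obtain D where D: "\<And>t. t \<in> I \<Longrightarrow> \<gamma> t \<in> fst c \<Longrightarrow> ((snd c \<circ> \<gamma>) has_vector_derivative D t) (at t)"
        "continuous_on (I \<inter> \<gamma> -` fst c) D" using C1_curve_on_chart[OF c(1)] by blast
      have sub: "?J \<inter> V \<subseteq> I \<inter> \<gamma> -` fst c" "?J \<inter> V \<subseteq> I" using V by auto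
      have 1: "((snd c' \<circ> (h \<circ> \<gamma>)) has_vector_derivative loc_deriv c c' h (\<gamma> t) (D t)) (at t)"
        if "t \<in> ?J \<inter> V" for t
        using that V by (intro vd[OF c(1) c'] D(1)) auto
      have "continuous_on (?J \<inter> V) (\<lambda>t. loc_deriv c c' h (\<gamma> t) (D t))"
        using V continuous_on_subset[OF C1_curve_on_continuous sub(2)] continuous_on_subset[OF D(2) sub(1)]
        by (intro continuous_on_loc_deriv[OF M N h c(1) c']) auto
      then have "continuous_on (?J \<inter> V) ?D"
        by (rule continuous_on_eq) (use vector_derivative_at[OF 1] in auto)
      then show ?thesis using V 1[of t0] t0 vector_derivative_at[OF 1[of t0]] by auto
    qed
    then show "\<exists>D. (\<forall>t\<in>?J. ((snd c' \<circ> (h \<circ> \<gamma>)) has_vector_derivative D t) (at t)) \<and> continuous_on ?J D"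
      by (intro exI[of _ ?D] conjI continuous_on_locally) blast+
  qed
  assume t: "t \<in> I"
  obtain w where w: "((snd (chart_at M (\<gamma> t)) \<circ> \<gamma>) has_vector_derivative w) (at t)"
    using C1_curve_on_chart[OF chart_at(1)[OF M, of "\<gamma> t"]] t chart_at(2)[OF M, of "\<gamma> t"] by metis
  show "velocity N (h \<circ> \<gamma>) t = mderiv M N h (\<gamma> t) (velocity M \<gamma> t)"
    using vector_derivative_at[OF vd[OF chart_at(1)[OF M] chart_at(1)[OF N] t chart_at(2)[OF M] chart_at(2)[OF N] w]]
      vector_derivative_at[OF w]
    by (simp add: velocity_def mderiv_loc_deriv o_assoc)
qed

end

lemma C1_curve_on_finite_length:
  assumes M: "smooth_manifold M" and g: "riemannian_metric M g" and \<gamma>: "C1_curve_on M {0..1} \<gamma>"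
  shows "piecewise_C1_curve M \<gamma>" and "curve_length M g \<gamma> < \<infinity>"
proof -
  show "piecewise_C1_curve M \<gamma>"
    unfolding piecewise_C1_curve_iff using \<gamma> C1_curve_on_continuous[OF M \<gamma>]
    by (auto intro!: exI[of _ "{}"])
  let ?s = "\<lambda>t. rnorm g (\<gamma> t) (velocity M \<gamma> t)"
  have "bounded (?s ` {0..1})"
    by (intro compact_imp_bounded compact_continuous_image continuous_on_speed[OF M \<gamma> g]) simp
  then obtain B where B: "\<And>t. t \<in> {0..1} \<Longrightarrow> ?s t \<le> B" unfolding bounded_iff real_norm_def abs_le_iff by fast
  have "curve_length M g \<gamma> \<le> (\<integral>\<^sup>+t. ennreal B * indicator {0..1::real} t \<partial>lborel)"
    unfolding curve_length_def
    by (intro nn_integral_mono) (use B in \<open>auto simp: indicator_def intro: ennreal_leI\<close>)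
  also have "\<dots> = ennreal B" by (simp add: nn_integral_cmult)
  finally show "curve_length M g \<gamma> < \<infinity>" by (simp add: order_le_less_trans ennreal_less_top)
qed

lemma
  fixes M :: "('m::metric_space, 'e::euclidean_space) chart set"
    and N :: "('n::metric_space, 'f::euclidean_space) chart set"
  assumes M: "smooth_manifold M" and N: "smooth_manifold N" and h: "C1_map_on M N UNIV h"
    and \<gamma>: "piecewise_C1_curve M \<gamma>"
  shows piecewise_C1_curve_comp: "piecewise_C1_curve N (h \<circ> \<gamma>)"
    and finite_velocity_comp:
      "finite {t\<in>{0..1}. velocity N (h \<circ> \<gamma>) t \<noteq> mderiv M N h (\<gamma> t) (velocity M \<gamma> t)}"
proof -
  obtain T where T: "finite T" "C1_curve_on M ({0..1} - T) \<gamma>" "continuous_on {0..1} \<gamma>"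
    using \<gamma> unfolding piecewise_C1_curve_iff by blast
  have "continuous_on {0..1} (h \<circ> \<gamma>)"
    using continuous_on_compose[OF T(3), of h] h continuous_on_subset[of UNIV h]
    unfolding C1_map_on_def by blast
  then show "piecewise_C1_curve N (h \<circ> \<gamma>)"
    unfolding piecewise_C1_curve_iff using T(1) C1_curve_on_comp[OF M T(2) N h] by blast
  show "finite {t\<in>{0..1}. velocity N (h \<circ> \<gamma>) t \<noteq> mderiv M N h (\<gamma> t) (velocity M \<gamma> t)}"
    by (rule finite_subset[OF _ T(1)]) (use velocity_comp[OF M T(2) N h] in blast)
qed

text \<open>The bound is required only along the curve and off a finite set, which does not affect
  the length. This covers a global bound on the derivative of \<open>h\<close> as well as a
  contraction that holds only in the directions to which the curve is tangent.\<close>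

lemma curve_length_comp_le:
  fixes M :: "('m::metric_space, 'e::euclidean_space) chart set"
    and N :: "('n::metric_space, 'f::euclidean_space) chart set"
  assumes M: "smooth_manifold M" and N: "smooth_manifold N" and h: "C1_map_on M N UNIV h"
    and \<gamma>: "piecewise_C1_curve M \<gamma>" and B: "0 \<le> B"
    and T: "finite T" "\<And>t. t \<in> {0..1} - T \<Longrightarrow>
      rnorm g' (h (\<gamma> t)) (mderiv M N h (\<gamma> t) (velocity M \<gamma> t)) \<le> B * rnorm g (\<gamma> t) (velocity M \<gamma> t)"
  shows "curve_length N g' (h \<circ> \<gamma>) \<le> ennreal B * curve_length M g \<gamma>"
proof -
  define T' where "T' = T \<union> {t\<in>{0..1}. velocity N (h \<circ> \<gamma>) t \<noteq> mderiv M N h (\<gamma> t) (velocity M \<gamma> t)}"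
  have "finite T'" using T(1) finite_velocity_comp[OF M N h \<gamma>] by (simp add: T'_def)
  then have "AE t in lborel. t \<notin> T'" by (intro AE_not_in finite_imp_null_set_lborel)
  then have "curve_length N g' (h \<circ> \<gamma>) \<le>
      (\<integral>\<^sup>+t. ennreal B * (ennreal (rnorm g (\<gamma> t) (velocity M \<gamma> t)) * indicator {0..1} t) \<partial>lborel)"
    unfolding curve_length_def
  proof (intro nn_integral_mono_AE, eventually_elim)
    case (elim t)
    then show ?case using T(2)[of t] B unfolding T'_def
      by (auto simp: indicator_def ennreal_mult'[symmetric] intro!: ennreal_leI)
  qed
  also have "\<dots> \<le> ennreal B * curve_length M g \<gamma>"
    unfolding curve_length_def by (rule nn_integral_cmult_le)
  finally show ?thesis .
qed


lemma riemannian_edist_comp_le: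
  fixes M :: "('m::metric_space, 'e::euclidean_space) chart set"
    and N :: "('n::metric_space, 'f::euclidean_space) chart set"
  assumes M: "smooth_manifold M" and N: "smooth_manifold N" and h: "C1_map_on M N UNIV h"
    and B: "0 \<le> B" "\<And>x v. rnorm g' (h x) (mderiv M N h x v) \<le> B * rnorm g x v"
    and fin: "riemannian_edist M g x y < \<infinity>"
  shows "riemannian_edist N g' (h x) (h y) \<le> ennreal B * riemannian_edist M g x y"
proof -
  let ?C = "{\<gamma>. piecewise_C1_curve M \<gamma> \<and> \<gamma> 0 = x \<and> \<gamma> 1 = y}"
  have le: "riemannian_edist N g' (h x) (h y) \<le> ennreal B * curve_length M g \<gamma>" if "\<gamma> \<in> ?C" for \<gamma>
  proof -
    have "riemannian_edist N g' (h x) (h y) \<le> curve_length N g' (h \<circ> \<gamma>)"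
      unfolding riemannian_edist_def
      by (rule INF_lower) (use that piecewise_C1_curve_comp[OF M N h] in auto)
    also have "\<dots> \<le> ennreal B * curve_length M g \<gamma>"
      by (rule curve_length_comp_le[OF M N h, of \<gamma> B "{}"]) (use that B in auto)
    finally show ?thesis .
  qed
  have "?C \<noteq> {}" using fin unfolding riemannian_edist_def by (auto simp: INF_less_iff)
  then show ?thesis
    unfolding riemannian_edist_def[of M] by (rule le_mult_INF_ennreal) (rule le)
qed

lemma dist_comp_le:
  assumes M: "riemannian_manifold M g" and N: "riemannian_manifold N g'" and h: "C1_map_on M N UNIV h"
    and B: "0 \<le> B" "\<And>x v. rnorm g' (h x) (mderiv M N h x v) \<le> B * rnorm g x v"
    and fin: "riemannian_edist M g x y < \<infinity>"
  shows "dist (h x) (h y) \<le> B * dist x y"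
proof -
  have le: "riemannian_edist N g' (h x) (h y) \<le> ennreal B * riemannian_edist M g x y"
    using M N by (intro riemannian_edist_comp_le h B fin) (auto simp: riemannian_manifold_def)
  also have d: "riemannian_edist M g x y = ennreal (dist x y)"
    using M fin by (auto simp: riemannian_manifold_def)
  finally have le': "riemannian_edist N g' (h x) (h y) \<le> ennreal (B * dist x y)"
    using B(1) by (simp add: ennreal_mult)
  \<comment> \<open>Finiteness carries over to the images, which permits identifying their
    \<open>dist\<close> with the Riemannian distance.\<close>
  then have "riemannian_edist N g' (h x) (h y) < \<infinity>"
    by (simp add: order_le_less_trans ennreal_less_top)
  then have "ennreal (dist (h x) (h y)) \<le> ennreal (B * dist x y)"
    using N le' by (simp add: riemannian_manifold_def)
  then show ?thesis using B(1) by (simp add: ennreal_le_iff)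
qed

text \<open>The segment between the coordinates stays in the convex set \<open>C\<close>; its
  preimage under the chart is a C1 curve of finite length.\<close>

lemma riemannian_edist_finite_chart:
  fixes M :: "('m::metric_space, 'e::euclidean_space) chart set"
  assumes M: "smooth_manifold M" and g: "riemannian_metric M g"
    and c: "c \<in> M" and C: "convex C" "open C" "C \<subseteq> snd c ` fst c"
    and x: "x \<in> fst c" "snd c x \<in> C" and y: "y \<in> fst c" "snd c y \<in> C"
  shows "riemannian_edist M g x y < \<infinity>"
proof -
  define l where "l = (\<lambda>t. snd c x + t *\<^sub>R (snd c y - snd c x))"
  define \<gamma> where "\<gamma> = chart_inv c \<circ> l"
  have l: "l t \<in> C" if "t \<in> {0..1}" for t
    using convexD[OF C(1) x(2) y(2), of "1 - t" t] that by (simp add: l_def algebra_simps)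
  have dl: "(l has_vector_derivative (snd c y - snd c x)) (at t)" for t
    unfolding l_def by (auto intro!: derivative_eq_intros)
  have cl: "isCont l t" for t unfolding l_def by (intro continuous_intros)
  have \<gamma>: "\<gamma> t \<in> fst c" "snd c (\<gamma> t) = l t" if "l t \<in> C" for t
    using that C(3) chart_inv_chart[OF M c] unfolding \<gamma>_def by (auto simp: image_iff subset_iff)
  have ci: "isCont \<gamma> t" if "l t \<in> C" for t
  proof -
    have "isCont (chart_inv c) (l t)"
      using continuous_on_subset[OF continuous_on_chart_inv[OF M c] C(3)] that C(2)
      by (simp add: continuous_on_eq_continuous_at)
    then show ?thesis unfolding \<gamma>_def by (rule continuous_at_compose[OF cl])
  qed
  \<comment> \<open>Since \<open>C\<close> is open, the segment can be prolonged a little beyond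
    both ends, which provides the two-sided derivatives at 0 and 1.\<close>
  have nhd: "\<forall>\<^sub>F s in nhds t. l s \<in> C" if "l t \<in> C" for t
    using cl[of t] C(2) that by (simp add: isCont_def tendsto_at_iff_tendsto_nhds topological_tendstoD)
  have "C1_curve_on M {0..1} \<gamma>"
    unfolding C1_curve_on_def C1_differentiable_on_def
  proof (intro conjI ballI exI)
    show "isCont \<gamma> t" if "t \<in> {0..1}" for t using ci l that by blast
    fix c' assume c': "c' \<in> M"
    show "((snd c' \<circ> \<gamma>) has_vector_derivative loc_deriv c c' id (\<gamma> t) (snd c y - snd c x)) (at t)"
      if t: "t \<in> {0..1} \<inter> \<gamma> -` fst c'" for t
    proof -
      have lt: "l t \<in> C" using l t by blast
      have "((snd c \<circ> \<gamma>) has_vector_derivative (snd c y - snd c x)) (at t)"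
        by (subst has_vector_derivative_cong_ev[where x = t and S = UNIV and g = l])
          (use nhd[OF lt] \<gamma> lt dl in \<open>auto elim!: eventually_mono\<close>)
      then show ?thesis
        using has_vector_derivative_C1_map_on[OF M M C1_map_on_id[OF M] c c', of \<gamma> t] \<gamma>(1)[OF lt] ci[OF lt] t
        by simp
    qed
    show "continuous_on ({0..1} \<inter> \<gamma> -` fst c') (\<lambda>t. loc_deriv c c' id (\<gamma> t) (snd c y - snd c x))"
      using ci l \<gamma>(1) by (intro continuous_on_loc_deriv[OF M M C1_map_on_id[OF M] c c'])
        (auto intro: continuous_at_imp_continuous_on)
  qed
  from C1_curve_on_finite_length[OF M g this]
  have "piecewise_C1_curve M \<gamma>" "curve_length M g \<gamma> < \<infinity>" by auto
  moreover have "\<gamma> 0 = x" "\<gamma> 1 = y"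
    using chart_inv_chart[OF M c] x y by (auto simp: \<gamma>_def l_def)
  ultimately show ?thesis
    unfolding riemannian_edist_def by (auto simp: INF_less_iff)
qed

text \<open>Points in different components have infinite \<^const>\<open>riemannian_edist\<close>, so a derivative bound
  gives a Lipschitz bound only below this scale.\<close>

lemma riemannian_edist_finite_nearby:
  fixes M :: "('m::metric_space, 'e::euclidean_space) chart set"
  assumes comp: "compact (UNIV :: 'm set)" and M: "smooth_manifold M" and g: "riemannian_metric M g"
  obtains \<delta> where "\<delta> > 0" "\<And>x y. dist x y < \<delta> \<Longrightarrow> riemannian_edist M g x y < \<infinity>"
proof -
  have "\<forall>z. \<exists>V. open V \<and> z \<in> V \<and> (\<forall>x\<in>V. \<forall>y\<in>V. riemannian_edist M g x y < \<infinity>)"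
  proof
    fix z
    define c where "c = chart_at M z"
    have c: "c \<in> M" "z \<in> fst c" using chart_at[OF M] by (auto simp: c_def)
    obtain e where e: "e > 0" "ball (snd c z) e \<subseteq> snd c ` fst c"
      using open_chart_image[OF M c(1)] c(2) by (metis imageI openE)
    let ?V = "fst c \<inter> snd c -` ball (snd c z) e"
    have "open ?V"
      by (intro continuous_open_preimage continuous_on_chart[OF M] open_chart[OF M] c open_ball)
    moreover have "riemannian_edist M g x y < \<infinity>" if "x \<in> ?V" "y \<in> ?V" for x y
      by (rule riemannian_edist_finite_chart[OF M g c(1), where C = "ball (snd c z) e"]) (use that e in auto)
    ultimately show "\<exists>V. open V \<and> z \<in> V \<and> (\<forall>x\<in>V. \<forall>y\<in>V. riemannian_edist M g x y < \<infinity>)"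
      using c(2) e(1) by (intro exI[of _ ?V]) auto
  qed
  from choice[OF this] obtain V where V: "\<And>z. open (V z)" "\<And>z. z \<in> V z"
    "\<And>z x y. x \<in> V z \<Longrightarrow> y \<in> V z \<Longrightarrow> riemannian_edist M g x y < \<infinity>" by blast
  have "UNIV \<subseteq> \<Union> (range V)" using V(2) by blast
  moreover have "open G" if "G \<in> range V" for G using V(1) that by blast
  \<comment> \<open>A Lebesgue number of the cover turns the local statement into one with a uniform
    scale.\<close>
  ultimately obtain \<delta> where \<delta>: "\<delta> > 0" "\<And>x. x \<in> UNIV \<Longrightarrow> \<exists>G\<in>range V. ball x \<delta> \<subseteq> G"
    using Heine_Borel_lemma[OF comp] by metis
  show thesis
  proof (rule that[OF \<delta>(1)])
    fix x y :: 'm assume "dist x y < \<delta>"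
    moreover obtain z where "ball x \<delta> \<subseteq> V z" using \<delta>(2)[of x] by blast
    ultimately show "riemannian_edist M g x y < \<infinity>"
      using \<delta>(1) by (intro V(3)[of _ z]) auto
  qed
qed

section \<open>Lipschitz bounds for cocycles\<close>

text \<open>\<open>D\<close> does not depend on \<open>h\<close>, so it serves all iterates of a
  cocycle at once. It is the diameter divided by the scale below which Riemannian distances are
  finite, and it takes care of the pairs above that scale.\<close>

lemma C1_map_on_lipschitz:
  fixes M :: "('m::metric_space, 'e::euclidean_space) chart set"
  assumes comp: "compact (UNIV :: 'm set)" and Mg: "riemannian_manifold M g"
  obtains D where "D \<ge> 0" "\<And>h s t. C1_map_on M M UNIV h \<Longrightarrow>
    dist (h s) (h t) \<le> max (deriv_norm M g h) D * dist s t"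
proof -
  have M: "smooth_manifold M" and g: "riemannian_metric M g"
    using Mg by (auto simp: riemannian_manifold_def)
  obtain \<delta> where \<delta>: "\<delta> > 0" "\<And>x y. dist x y < \<delta> \<Longrightarrow> riemannian_edist M g x y < \<infinity>"
    using riemannian_edist_finite_nearby[OF comp M g] by blast
  obtain d where d: "\<And>x y :: 'm. dist x y \<le> d"
    using compact_imp_bounded[OF comp] unfolding bounded_two_points by auto
  have d0: "d \<ge> 0" using d[of undefined undefined] by simp
  show thesis
  proof
    show "0 \<le> d / \<delta>" using d0 \<delta>(1) by simp
    fix h s t assume h: "C1_map_on M M UNIV h"
    show "dist (h s) (h t) \<le> max (deriv_norm M g h) (d / \<delta>) * dist s t"
    proof (cases "dist s t < \<delta>")
      case True
      have "dist (h s) (h t) \<le> deriv_norm M g h * dist s t"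
        by (rule dist_comp_le[OF Mg Mg h deriv_norm_nonneg[OF comp M g h] rnorm_mderiv_le[OF comp M g h] \<delta>(2)[OF True]])
      also have "\<dots> \<le> max (deriv_norm M g h) (d / \<delta>) * dist s t" by (intro mult_right_mono) auto
      finally show ?thesis .
    next
      case False
      have "dist (h s) (h t) \<le> d / \<delta> * \<delta>" using d \<delta>(1) by simp
      also have "\<dots> \<le> d / \<delta> * dist s t" using False d0 \<delta>(1) by (intro mult_left_mono) auto
      also have "\<dots> \<le> max (deriv_norm M g h) (d / \<delta>) * dist s t" by (intro mult_right_mono) auto
      finally show ?thesis .
    qed
  qed
qed

lemma Diff1_iff:
  "h \<in> Diff1 M \<longleftrightarrow> bij h \<and> C1_map_on M M UNIV h \<and> C1_map_on M M UNIV (inv h)"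
  unfolding Diff1_def C1_diffeo_on_def bij_def by auto

lemma Diff1_comp:
  assumes M: "smooth_manifold M" and "h \<in> Diff1 M" "k \<in> Diff1 M"
  shows "k \<circ> h \<in> Diff1 M"
  using assms C1_map_on_comp[OF M M M] by (simp add: Diff1_iff o_inv_distrib bij_comp)

lemma funpow_in: "f ` X \<subseteq> X \<Longrightarrow> x \<in> X \<Longrightarrow> (f ^^ n) x \<in> X"
  by (induction n) auto

lemma cocycle_nat_Diff1:
  assumes M: "smooth_manifold M" and A: "\<forall>x\<in>X. A x \<in> Diff1 M" and f: "f ` X \<subseteq> X" and x: "x \<in> X"
  shows "cocycle_nat f A n x \<in> Diff1 M"
proof (induction n)
  case 0
  show ?case using C1_map_on_id[OF M] bij_id inv_id by (simp add: Diff1_iff id_def)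
next
  case (Suc n)
  then show ?case using Diff1_comp[OF M Suc] A funpow_in[OF f x, of n] by (simp del: o_apply)
qed

lemma cocycle_of_nat: "cocycle X f A (int n) x = cocycle_nat f A n x"
  by (simp add: cocycle_def)

text \<open>Read at the endpoint \<open>(f ^^ n) x\<close>, the hypothesis on negative times becomes
  a bound for the inverse of the iterate at \<open>x\<close>. Injectivity on \<open>X\<close> makes
  \<open>inv_into\<close> retrace the orbit.\<close>

lemma cocycle_minus_of_nat:
  assumes f: "inj_on f X" "f ` X \<subseteq> X" and x: "x \<in> X"
  shows "cocycle X f A (- int n) ((f ^^ n) x) = inv (cocycle_nat f A n x)"
proof -
  have "(inv_into X f ^^ n) ((f ^^ n) x) = x"
  proof (induction n)
    case (Suc n)
    then show ?case
      using inv_into_f_f[OF f(1) funpow_in[OF f(2) x, of n]] by (simp add: funpow_swap1)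
  qed simp
  then show ?thesis by (cases "n = 0") (simp_all add: cocycle_def)
qed

lemma cocycle_lipschitz:
  fixes M :: "('m::metric_space, 'e::euclidean_space) chart set"
  assumes comp: "compact (UNIV :: 'm set)" and Mg: "riemannian_manifold M g"
    and A: "\<forall>x\<in>X. A x \<in> Diff1 M" and f: "inj_on f X" "f ` X \<subseteq> X" and ne: "X \<noteq> {}"
    and K: "\<forall>x\<in>X. \<forall>n::int. deriv_norm M g (cocycle X f A n x) \<le> K * \<sigma> ^ nat \<bar>n\<bar>"
  obtains L where "L \<ge> 0"
    "\<And>x n s t. x \<in> X \<Longrightarrow> dist (cocycle_nat f A n x s) (cocycle_nat f A n x t) \<le> L * max 1 \<sigma> ^ n * dist s t"
    "\<And>x n s t. x \<in> X \<Longrightarrow>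
      dist (inv (cocycle_nat f A n x) s) (inv (cocycle_nat f A n x) t) \<le> L * max 1 \<sigma> ^ n * dist s t"
proof -
  have M: "smooth_manifold M" and g: "riemannian_metric M g"
    using Mg by (auto simp: riemannian_manifold_def)
  obtain D where D: "D \<ge> 0" "\<And>h s t. C1_map_on M M UNIV h \<Longrightarrow>
      dist (h s) (h t) \<le> max (deriv_norm M g h) D * dist s t"
    using C1_map_on_lipschitz[OF comp Mg] by blast
  have C1: "C1_map_on M M UNIV (cocycle_nat f A n x)" "C1_map_on M M UNIV (inv (cocycle_nat f A n x))"
    if "x \<in> X" for n x
    using cocycle_nat_Diff1[OF M A f(2) that] by (auto simp: Diff1_iff)
  have K': "deriv_norm M g (cocycle_nat f A n x) \<le> K * \<sigma> ^ n"
    "deriv_norm M g (inv (cocycle_nat f A n x)) \<le> K * \<sigma> ^ n" if "x \<in> X" for n x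
    using K[rule_format, OF that, of "int n"] K[rule_format, OF funpow_in[OF f(2) that], of "- int n" n]
    by (simp_all add: cocycle_of_nat cocycle_minus_of_nat[OF f that])
  obtain x0 where x0: "x0 \<in> X" using ne by blast
  have nn: "0 \<le> K * \<sigma> ^ n" for n
    using order_trans[OF deriv_norm_nonneg[OF comp M g C1(1)[OF x0]] K'(1)[OF x0]] .
  \<comment> \<open>No signs are assumed for \<open>K\<close> and \<open>\<sigma>\<close>.
    Derivative norms are nonnegative, so the bounds at \<open>n = 0\<close> and \<open>n = 1\<close>
    give the signs unless \<open>K = 0\<close>.\<close>
  have Kle: "K * \<sigma> ^ n \<le> K * max 1 \<sigma> ^ n" for n
  proof (cases "K = 0")
    case False
    then have "0 < K" "0 \<le> \<sigma>" using nn[of 0] nn[of 1] by (auto simp: zero_le_mult_iff)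
    then show ?thesis by (intro mult_left_mono power_mono) auto
  qed simp
  have bound: "dist (h s) (h t) \<le> max K D * max 1 \<sigma> ^ n * dist s t"
    if "C1_map_on M M UNIV h" "deriv_norm M g h \<le> K * \<sigma> ^ n" for h n s t
  proof -
    \<comment> \<open>The constant \<open>D\<close> does not shrink with \<open>n\<close>; it is
      absorbed because the growth rate is at least 1.\<close>
    have "1 \<le> max 1 \<sigma> ^ n" by (intro one_le_power) simp
    then have "D \<le> D * max 1 \<sigma> ^ n" using mult_left_mono[OF _ D(1), of 1 "max 1 \<sigma> ^ n"] by simp
    moreover have "K * max 1 \<sigma> ^ n \<le> max K D * max 1 \<sigma> ^ n" "D * max 1 \<sigma> ^ n \<le> max K D * max 1 \<sigma> ^ n"
      by (intro mult_right_mono; simp)+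
    ultimately have "max (deriv_norm M g h) D \<le> max K D * max 1 \<sigma> ^ n"
      using that(2) Kle[of n] by linarith
    then show ?thesis by (rule order_trans[OF D(2)[OF that(1)] mult_right_mono[OF _ zero_le_dist]])
  qed
  show thesis
  proof (rule that[of "max K D"])
    show "0 \<le> max K D" using D(1) by simp
  qed (rule bound[OF C1(1) K'(1)] bound[OF C1(2) K'(2)]; assumption)+
qed

section \<open>Holonomies of Hoelder cocycles\<close>

lemma Diff0_iff: "h \<in> Diff0 \<longleftrightarrow> bij h \<and> continuous_on UNIV h \<and> continuous_on UNIV (inv h)"
proof
  assume "h \<in> Diff0"
  then have *: "\<And>x. inv h (h x) = x" "\<And>x. h (inv h x) = x" "continuous_on UNIV h" "continuous_on UNIV (inv h)"
    by (auto simp: Diff0_def homeomorphism_def)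
  then have "bij h" by (metis bij_betw_byWitness subset_UNIV UNIV_I)
  then show "bij h \<and> continuous_on UNIV h \<and> continuous_on UNIV (inv h)" using * by blast
next
  assume "bij h \<and> continuous_on UNIV h \<and> continuous_on UNIV (inv h)"
  then show "h \<in> Diff0"
    unfolding Diff0_def homeomorphism_def
    by (simp add: bij_is_inj bij_is_surj surj_f_inv_f bij_imp_bij_inv)
qed

lemma Diff0I:
  assumes "continuous_on UNIV h" "continuous_on UNIV k" "\<And>t. h (k t) = t" "\<And>t. k (h t) = t"
  shows "h \<in> Diff0" "inv h = k"
proof -
  have "bij h" using assms(3,4) by (metis bij_betw_byWitness subset_UNIV UNIV_I)
  show "inv h = k" using assms(3,4) by (auto intro: inv_equality)
  then show "h \<in> Diff0" using \<open>bij h\<close> assms by (simp add: Diff0_iff)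
qed

lemma Diff0_comp: "h \<in> Diff0 \<Longrightarrow> k \<in> Diff0 \<Longrightarrow> k \<circ> h \<in> Diff0"
  unfolding Diff0_iff
  by (auto simp: bij_comp o_inv_distrib simp del: o_apply
      intro!: continuous_on_compose intro: continuous_on_subset)

lemma Diff0_inv: "h \<in> Diff0 \<Longrightarrow> inv h \<in> Diff0"
  unfolding Diff0_iff by (simp add: bij_imp_bij_inv inv_inv_eq)

lemma Diff0_inverse:
  assumes "h \<in> Diff0"
  shows "inv h (h t) = t" "h (inv h t) = t" "inv (inv h) = h"
  using assms unfolding Diff0_iff by (auto simp: bij_is_inj bij_is_surj surj_f_inv_f inv_inv_eq)

section \<open>Two estimates on sequences: geometric convergence and Hoelder interpolation\<close>

lemma geometric_convergence:
  fixes u :: "nat \<Rightarrow> 'a::metric_space"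
  assumes c: "compact (UNIV :: 'a set)" and r: "0 \<le> r" "r < 1"
    and u: "\<And>n. dist (u n) (u (Suc n)) \<le> a * r ^ n"
  obtains l where "u \<longlonglongrightarrow> l" "\<And>n. dist (u n) l \<le> a / (1 - r) * r ^ n"
proof -
  have a: "a \<ge> 0" using order_trans[OF zero_le_dist u[of 0]] by simp
  \<comment> \<open>The factor \<open>1 - r ^ k\<close> records the exact finite geometric sum; with
    the bound for the whole series the induction would not close.\<close>
  have part: "dist (u n) (u (n + k)) \<le> a / (1 - r) * r ^ n * (1 - r ^ k)" for n k
  proof (induction k)
    case (Suc k)
    have "dist (u n) (u (n + Suc k)) \<le> dist (u n) (u (n + k)) + dist (u (n + k)) (u (Suc (n + k)))"
      by (metis add_Suc_right dist_triangle)
    also have "\<dots> \<le> a / (1 - r) * r ^ n * (1 - r ^ k) + a * r ^ (n + k)" using Suc u by (intro add_mono)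
    also have "\<dots> = a / (1 - r) * r ^ n * (1 - r ^ Suc k)" using r by (simp add: field_simps power_add)
    finally show ?case .
  qed simp
  have le: "dist (u n) (u m) \<le> a / (1 - r) * r ^ n" if "m \<ge> n" for n m
  proof -
    have "a / (1 - r) * r ^ n * (1 - r ^ (m - n)) \<le> a / (1 - r) * r ^ n * 1"
      using r a by (intro mult_left_mono) auto
    then show ?thesis using part[of n "m - n"] that by simp
  qed
  have "(\<lambda>n. a / (1 - r) * r ^ n) \<longlonglongrightarrow> a / (1 - r) * 0"
    using r by (intro tendsto_intros LIMSEQ_realpow_zero)
  then have lim0: "(\<lambda>n. a / (1 - r) * r ^ n) \<longlonglongrightarrow> 0" by simp
  have "Cauchy u"
  proof (rule metric_CauchyI)
    fix e :: real assume "e > 0"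
    then have "\<forall>\<^sub>F n in sequentially. a / (1 - r) * r ^ n < e / 2"
      by (intro order_tendstoD(2)[OF lim0]) simp
    then obtain n0 where n0: "a / (1 - r) * r ^ n0 < e / 2" by (auto simp: eventually_sequentially)
    show "\<exists>M. \<forall>m\<ge>M. \<forall>n\<ge>M. dist (u m) (u n) < e"
    proof (intro exI allI impI)
      fix m n assume "m \<ge> n0" "n \<ge> n0"
      then show "dist (u m) (u n) < e"
        using le[of n0 m] le[of n0 n] n0 dist_triangle3[of "u m" "u n" "u n0"] by linarith
    qed
  qed
  then obtain l where l: "u \<longlonglongrightarrow> l" using compact_imp_complete[OF c] unfolding complete_def by auto
  show thesis
  proof (rule that[OF l])
    fix n
    have "(\<lambda>m. dist (u n) (u m)) \<longlonglongrightarrow> dist (u n) l" by (intro tendsto_intros l)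
    then show "dist (u n) l \<le> a / (1 - r) * r ^ n"
      by (rule LIMSEQ_le_const2) (use le in auto)
  qed
qed

text \<open>Choosing \<open>n\<close> with \<open>L ^ n\<close> about \<open>d powr (- 1 / 2)\<close> makes both summands powers of \<open>d\<close>.\<close>

lemma holder_interpolation:
  fixes a b r L D :: real
  assumes r: "0 < r" "r < 1" and L: "1 < L" and nn: "0 \<le> a" "0 \<le> b" "0 \<le> D"
  obtains \<alpha> C where "0 < \<alpha>" "\<alpha> \<le> 1"
    "\<And>d z. 0 < d \<Longrightarrow> z \<le> D \<Longrightarrow> (\<And>n. z \<le> a * r ^ n + b * L ^ n * d) \<Longrightarrow> z \<le> C * d powr \<alpha>"
proof -
  \<comment> \<open>Chosen so that \<open>r = L powr (- \<kappa>)\<close>. When \<open>L ^ n\<close>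
    is about \<open>d powr (- 1 / 2)\<close>, \<open>r ^ n\<close> is about
    \<open>d powr (\<kappa> / 2)\<close>, and the smaller of the two resulting exponents is
    kept.\<close>
  define \<kappa> where "\<kappa> = - ln r / ln L"
  define \<alpha> where "\<alpha> = min (1/2) (\<kappa> / 2)"
  \<comment> \<open>\<open>D\<close> covers \<open>d \<ge> 1\<close>, where the power of
    \<open>d\<close> is at least 1. The quotient \<open>a / r\<close> pays for rounding the ideal
    real exponent down to an integer.\<close>
  define C where "C = D + a / r + b"
  have lnL: "ln L > 0" using L by simp
  have "\<kappa> > 0" using r lnL by (simp add: \<kappa>_def divide_neg_pos)
  then have \<alpha>: "0 < \<alpha>" "\<alpha> \<le> 1" "\<alpha> \<le> 1/2" "\<alpha> \<le> \<kappa> / 2" by (auto simp: \<alpha>_def)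
  have C: "D \<le> C" "a / r + b \<le> C" "0 \<le> C" using nn r by (auto simp: C_def)
  have "z \<le> C * d powr \<alpha>" if d: "0 < d" and z: "z \<le> D" "\<And>n. z \<le> a * r ^ n + b * L ^ n * d" for d z
  proof (cases "d \<ge> 1")
    case True
    then have "1 \<le> d powr \<alpha>" using \<alpha> by (simp add: ge_one_powr_ge_zero)
    then have "C * 1 \<le> C * d powr \<alpha>" using C by (intro mult_left_mono)
    then show ?thesis using z(1) C by linarith
  next
    case False
    define x where "x = - (ln d / ln L) / 2"
    define n where "n = nat \<lfloor>x\<rfloor>"
    have x0: "x \<ge> 0" using False d lnL by (simp add: x_def divide_nonpos_pos)
    then have n: "real n \<le> x" "x < real n + 1" unfolding n_def by linarith+
    have "L ^ n = L powr real n" using L by (simp add: powr_realpow)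
    also have "\<dots> \<le> L powr x" using n L by (intro powr_mono) auto
    also have "\<dots> = d powr (-1/2)" using L d lnL by (simp add: powr_def x_def)
    finally have "L ^ n * d \<le> d powr (-1/2) * d powr 1" using d by simp
    also have "\<dots> = d powr (1/2)" unfolding powr_add[symmetric] by simp
    also have "\<dots> \<le> d powr \<alpha>" using \<alpha> d False by (intro powr_mono') auto
    finally have 1: "b * (L ^ n * d) \<le> b * d powr \<alpha>" using nn by (intro mult_left_mono)
    have "r * r powr n = r powr (n + 1)" using r by (simp add: powr_add)
    also have "\<dots> \<le> r powr x" using n r by (intro powr_mono') auto
    also have "\<dots> = d powr (\<kappa> / 2)" using r d lnL by (simp add: powr_def x_def \<kappa>_def)
    also have "\<dots> \<le> d powr \<alpha>" using \<alpha> d False by (intro powr_mono') auto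
    finally have "r ^ n \<le> d powr \<alpha> / r" using r by (simp add: field_simps powr_realpow)
    then have 2: "a * r ^ n \<le> a * (d powr \<alpha> / r)" using nn by (intro mult_left_mono)
    have "z \<le> (a / r + b) * d powr \<alpha>" using z(2)[of n] 1 2 by (simp add: algebra_simps)
    also have "\<dots> \<le> C * d powr \<alpha>" using C by (intro mult_right_mono) auto
    finally show ?thesis .
  qed
  then show thesis using that \<alpha> by blast
qed

section \<open>The metric space of homeomorphisms of a compact space\<close>

context
  assumes comp: "compact (UNIV :: 'm::metric_space set)"
begin

lemma dist_le_dist0: "dist (g t) (h t) \<le> dist0 g h" for g h :: "'m \<Rightarrow> 'm"
proof -
  obtain d where "\<And>x y :: 'm. dist x y \<le> d"
    using compact_imp_bounded[OF comp] unfolding bounded_two_points by auto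
  then show ?thesis unfolding dist0_def by (intro cSUP_upper) (auto intro!: bdd_aboveI)
qed

lemma dist0_le: "(\<And>t. dist (g t) (h t) \<le> e) \<Longrightarrow> dist0 g h \<le> e" for g h :: "'m \<Rightarrow> 'm"
  unfolding dist0_def by (intro cSUP_least) auto

lemma dist0_nonneg: "0 \<le> dist0 g h" for g h :: "'m \<Rightarrow> 'm"
  by (rule order_trans[OF zero_le_dist dist_le_dist0])

lemma distC0_commute: "distC0 g h = distC0 h g"
  by (simp add: distC0_def dist0_def dist_commute)

lemma dist0_triangle: "dist0 g k \<le> dist0 g h + dist0 h k" for g h k :: "'m \<Rightarrow> 'm"
  by (rule dist0_le) (meson add_mono dist_le_dist0 dist_triangle order_trans)

lemma distC0_self: "distC0 g g = 0"
  by (simp add: distC0_def dist0_def)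

lemma
  fixes g h :: "'m \<Rightarrow> 'm"
  shows dist_le_distC0: "dist (g t) (h t) \<le> distC0 g h"
    and dist_inv_le_distC0: "dist (inv g t) (inv h t) \<le> distC0 g h"
    and distC0_nonneg: "0 \<le> distC0 g h"
  using dist_le_dist0[of g t h] dist_le_dist0[of "inv g" t "inv h"] dist0_nonneg[of g h] dist0_nonneg[of "inv g" "inv h"]
  by (auto simp: distC0_def)

lemma Metric_space_Diff0: "Metric_space Diff0 (distC0 :: ('m \<Rightarrow> 'm) \<Rightarrow> _)"
proof
  fix g h k :: "'m \<Rightarrow> 'm"
  show "0 \<le> distC0 g h" by (rule distC0_nonneg)
  show "distC0 g h = distC0 h g" by (rule distC0_commute)
  show "distC0 g k \<le> distC0 g h + distC0 h k"
    using dist0_triangle[of g k h] dist0_triangle[of "inv g" "inv k" "inv h"] by (simp add: distC0_def)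
  show "distC0 g h = 0 \<longleftrightarrow> g = h"
  proof
    assume "distC0 g h = 0"
    then have "dist (g t) (h t) \<le> 0" for t using dist_le_distC0[of g t h] by simp
    then show "g = h" by auto
  qed (simp add: distC0_self)
qed

end


text \<open>Differentiability survives only in the two Lipschitz bounds, and the fibre is just a
  compact metric space. Contraction of the base is not part of the locale; it is a property of
  pairs, with constants that vary.\<close>

locale holder_cocycle =
  fixes X :: "'x::metric_space set" and f :: "'x \<Rightarrow> 'x" and A :: "'x \<Rightarrow> 'm::metric_space \<Rightarrow> 'm"
    and \<beta> C L \<sigma> lam :: real
  assumes comp: "compact (UNIV :: 'm set)" and f: "f ` X \<subseteq> X"
    and A: "\<And>x. x \<in> X \<Longrightarrow> A x \<in> Diff0"
    and holder: "\<And>x y. x \<in> X \<Longrightarrow> y \<in> X \<Longrightarrow> distC0 (A x) (A y) \<le> C * dist x y powr \<beta>" and C: "0 \<le> C"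
    and lip: "\<And>x n s t. x \<in> X \<Longrightarrow>
      dist (cocycle_nat f A n x s) (cocycle_nat f A n x t) \<le> L * \<sigma> ^ n * dist s t"
    and lip_inv: "\<And>x n s t. x \<in> X \<Longrightarrow>
      dist (inv (cocycle_nat f A n x) s) (inv (cocycle_nat f A n x) t) \<le> L * \<sigma> ^ n * dist s t"
    and L: "0 \<le> L" and \<sigma>: "1 \<le> \<sigma>" and lam: "0 < lam" and \<beta>: "0 < \<beta>"
    and dominated: "\<sigma> * lam powr \<beta> < 1"
begin

abbreviation "cn \<equiv> cocycle_nat f A"

text \<open>The constant is an explicit parameter because uniformity in the pair matters: local
  stable sets share one \<open>c\<close>, and the estimates below depend on the pair only through
  \<open>c\<close>.\<close>

definition asymptotic :: "real \<Rightarrow> 'x \<Rightarrow> 'x \<Rightarrow> bool" where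
  "asymptotic c x y \<longleftrightarrow> x \<in> X \<and> y \<in> X \<and> (\<forall>n. dist ((f ^^ n) x) ((f ^^ n) y) \<le> c * lam ^ n)"

definition hol :: "nat \<Rightarrow> 'x \<Rightarrow> 'x \<Rightarrow> 'm \<Rightarrow> 'm" where
  "hol n x y = inv (cn n y) \<circ> cn n x"

definition hol_lim :: "'x \<Rightarrow> 'x \<Rightarrow> 'm \<Rightarrow> 'm" where
  "hol_lim x y t = lim (\<lambda>n. hol n x y t)"

definition \<rho> :: real where "\<rho> = \<sigma> * lam powr \<beta>"

text \<open>The bounds of \<open>hol_step\<close> from index \<open>n\<close> on add up to
  \<open>rate c * \<rho> ^ n\<close>, which therefore controls the distance to the limit.\<close>

definition rate :: "real \<Rightarrow> real" where
  "rate c = L * C * c powr \<beta> / (1 - \<rho>)"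

lemma \<rho>: "0 < \<rho>" "\<rho> < 1"
  using \<sigma> lam dominated by (auto simp: \<rho>_def)

lemma funpow_X: "x \<in> X \<Longrightarrow> (f ^^ n) x \<in> X"
  using f by (induction n) auto

lemma asymptotic_sym: "asymptotic c x y \<Longrightarrow> asymptotic c y x"
  by (auto simp: asymptotic_def dist_commute)

lemma asymptotic_nonneg: "asymptotic c x y \<Longrightarrow> 0 \<le> c"
  unfolding asymptotic_def by (metis mult.right_neutral order_trans power_0 zero_le_dist)

lemma rate_nonneg: "0 \<le> rate c"
  using L C \<rho> by (simp add: rate_def)

lemma cn_Diff0: "x \<in> X \<Longrightarrow> cn n x \<in> Diff0"
proof (induction n)
  case 0
  show ?case using bij_id by (simp add: Diff0_iff id_def)
next
  case (Suc n)
  then show ?case using Diff0_comp[OF Suc.IH A[OF funpow_X]] by (simp del: o_apply)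
qed

lemma hol_swap: "x \<in> X \<Longrightarrow> y \<in> X \<Longrightarrow> hol n y x (hol n x y t) = t"
  by (simp add: hol_def Diff0_inverse[OF cn_Diff0])

lemma
  assumes "x \<in> X" "y \<in> X"
  shows hol_Diff0: "hol n x y \<in> Diff0" and inv_hol: "inv (hol n x y) = hol n y x"
proof -
  show "hol n x y \<in> Diff0" unfolding hol_def by (intro Diff0_comp Diff0_inv cn_Diff0 assms)
  show "inv (hol n x y) = hol n y x" by (rule inv_equality) (simp_all add: hol_swap assms)
qed

lemma hol_lipschitz:
  assumes "x \<in> X" "y \<in> X"
  shows "dist (hol n x y s) (hol n x y t) \<le> L\<^sup>2 * (\<sigma>\<^sup>2) ^ n * dist s t"
proof -
  have "dist (hol n x y s) (hol n x y t) \<le> L * \<sigma> ^ n * dist (cn n x s) (cn n x t)"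
    unfolding hol_def o_apply by (rule lip_inv[OF assms(2)])
  also have "\<dots> \<le> L * \<sigma> ^ n * (L * \<sigma> ^ n * dist s t)"
    using L \<sigma> by (intro mult_left_mono lip[OF assms(1)]) auto
  finally show ?thesis by (simp add: power2_eq_square power_mult_distrib mult_ac)
qed

text \<open>Step \<open>n + 1\<close> inserts \<open>inv (A ?y) \<circ> A ?x\<close> between
  \<open>inv (cn n y)\<close> and \<open>cn n x\<close>. The Hoelder condition makes this factor
  close to the identity, and the outer map magnifies the error by at most
  \<open>L * \<sigma> ^ n\<close>.\<close>

lemma hol_step:
  assumes "asymptotic c x y"
  shows "dist (hol n x y t) (hol (Suc n) x y t) \<le> L * C * c powr \<beta> * \<rho> ^ n"
proof -
  have xy: "x \<in> X" "y \<in> X" and d: "dist ((f ^^ n) x) ((f ^^ n) y) \<le> c * lam ^ n"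
    using assms by (auto simp: asymptotic_def)
  let ?x = "(f ^^ n) x" and ?y = "(f ^^ n) y"
  define u where "u = cn n x t"
  have "inv (cn (Suc n) y) = inv (cn n y) \<circ> inv (A ?y)"
    using cn_Diff0[OF xy(2)] A[OF funpow_X[OF xy(2)]] by (simp add: Diff0_iff o_inv_distrib)
  then have "dist (hol n x y t) (hol (Suc n) x y t) =
      dist (inv (cn n y) u) (inv (cn n y) (inv (A ?y) (A ?x u)))" by (simp add: hol_def u_def)
  also have "\<dots> \<le> L * \<sigma> ^ n * dist u (inv (A ?y) (A ?x u))" by (rule lip_inv[OF xy(2)])
  finally have 1: "dist (hol n x y t) (hol (Suc n) x y t) \<le> \<dots>" .
  \<comment> \<open>Writing \<open>u\<close> as \<open>inv (A ?x) (A ?x u)\<close> leaves a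
    comparison of two inverses at one point, which \<open>distC0\<close> controls.\<close>
  have "dist u (inv (A ?y) (A ?x u)) = dist (inv (A ?x) (A ?x u)) (inv (A ?y) (A ?x u))"
    using A[OF funpow_X[OF xy(1)]] by (simp add: Diff0_inverse)
  also have "\<dots> \<le> C * dist ?x ?y powr \<beta>"
    using dist_inv_le_distC0[OF comp] holder[OF funpow_X[OF xy(1)] funpow_X[OF xy(2)]] order_trans by blast
  also have "\<dots> \<le> C * (c * lam ^ n) powr \<beta>"
    using d \<beta> by (intro mult_left_mono powr_mono2 C) auto
  also have "(c * lam ^ n) powr \<beta> = c powr \<beta> * (lam powr \<beta>) ^ n"
    using lam asymptotic_nonneg[OF assms]
    by (simp add: powr_mult powr_powr powr_realpow[symmetric] mult.commute)
  finally have "L * \<sigma> ^ n * dist u (inv (A ?y) (A ?x u)) \<le>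
      L * \<sigma> ^ n * (C * (c powr \<beta> * (lam powr \<beta>) ^ n))"
    using L \<sigma> by (intro mult_left_mono) auto
  with 1 show ?thesis by (simp add: \<rho>_def power_mult_distrib mult_ac)
qed

lemma
  assumes "asymptotic c x y"
  shows hol_tendsto: "(\<lambda>n. hol n x y t) \<longlonglongrightarrow> hol_lim x y t"
    and hol_rate: "dist (hol n x y t) (hol_lim x y t) \<le> rate c * \<rho> ^ n"
proof -
  obtain l where l: "(\<lambda>n. hol n x y t) \<longlonglongrightarrow> l" "\<And>n. dist (hol n x y t) l \<le> rate c * \<rho> ^ n"
    unfolding rate_def
    by (rule geometric_convergence[OF comp less_imp_le[OF \<rho>(1)] \<rho>(2), where u = "\<lambda>n. hol n x y t"])
      (use hol_step[OF assms] in blast)+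
  moreover have "hol_lim x y t = l" unfolding hol_lim_def using l(1) by (rule limI)
  ultimately show "(\<lambda>n. hol n x y t) \<longlonglongrightarrow> hol_lim x y t" "dist (hol n x y t) (hol_lim x y t) \<le> rate c * \<rho> ^ n"
    by simp_all
qed

lemma rate_tendsto_0: "(\<lambda>n. rate c * \<rho> ^ n) \<longlonglongrightarrow> 0"
  using \<rho> by (intro tendsto_mult_right_zero LIMSEQ_realpow_zero) auto

text \<open>The interpolation sees the pair only through \<open>c\<close>, so exponent and constant
  are the same for all pairs with that \<open>c\<close>.\<close>

lemma hol_lim_holder:
  obtains \<alpha> H where "0 < \<alpha>" "\<alpha> \<le> 1"
    "\<And>x y s t. asymptotic c x y \<Longrightarrow> dist (hol_lim x y s) (hol_lim x y t) \<le> H * dist s t powr \<alpha>"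
proof -
  obtain D where D: "\<And>x y :: 'm. dist x y \<le> D"
    using compact_imp_bounded[OF comp] unfolding bounded_two_points by auto
  have "0 \<le> D" using D[of undefined undefined] by simp
  \<comment> \<open>Interpolation needs a base greater than 1, while \<open>\<sigma>\<close> may
    equal 1; raising the base to at least 2 only weakens the Lipschitz bound.\<close>
  obtain \<alpha> H where aH: "0 < \<alpha>" "\<alpha> \<le> 1" "\<And>d z. 0 < d \<Longrightarrow> z \<le> D \<Longrightarrow>
      (\<And>n. z \<le> 2 * rate c * \<rho> ^ n + L\<^sup>2 * (max 2 (\<sigma>\<^sup>2)) ^ n * d) \<Longrightarrow> z \<le> H * d powr \<alpha>"
    by (rule holder_interpolation[OF \<rho>, of "max 2 (\<sigma>\<^sup>2)" "2 * rate c" "L\<^sup>2" D])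
      (use rate_nonneg \<open>0 \<le> D\<close> in auto)
  show thesis
  proof (rule that[OF aH(1,2)])
    fix x y s t assume a: "asymptotic c x y"
    then have xy: "x \<in> X" "y \<in> X" by (auto simp: asymptotic_def)
    show "dist (hol_lim x y s) (hol_lim x y t) \<le> H * dist s t powr \<alpha>"
    proof (cases "s = t")
      case False
      show ?thesis
      proof (rule aH(3)[OF _ D])
        fix n
        have "dist (hol_lim x y s) (hol_lim x y t) \<le> dist (hol n x y s) (hol_lim x y s)
            + dist (hol n x y t) (hol_lim x y t) + dist (hol n x y s) (hol n x y t)"
          by (smt (verit) dist_commute dist_triangle)
        also have "\<dots> \<le> rate c * \<rho> ^ n + rate c * \<rho> ^ n + L\<^sup>2 * (\<sigma>\<^sup>2) ^ n * dist s t"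
          by (intro add_mono hol_rate hol_lipschitz a xy)
        also have "\<dots> \<le> rate c * \<rho> ^ n + rate c * \<rho> ^ n + L\<^sup>2 * (max 2 (\<sigma>\<^sup>2)) ^ n * dist s t"
          by (intro add_left_mono mult_right_mono mult_left_mono power_mono) auto
        finally show "dist (hol_lim x y s) (hol_lim x y t) \<le>
            2 * rate c * \<rho> ^ n + L\<^sup>2 * (max 2 (\<sigma>\<^sup>2)) ^ n * dist s t" by (simp add: mult_ac)
      qed (use False in simp)
    qed simp
  qed
qed

lemma continuous_on_hol_lim:
  assumes "asymptotic c x y"
  shows "continuous_on UNIV (hol_lim x y)"
proof (rule uniform_limit_theorem[where f = "\<lambda>n. hol n x y" and F = sequentially])
  have "x \<in> X" "y \<in> X" using assms by (auto simp: asymptotic_def)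
  then show "\<forall>\<^sub>F n in sequentially. continuous_on UNIV (hol n x y)"
    using hol_Diff0 by (auto simp: Diff0_iff)
  show "uniform_limit UNIV (\<lambda>n. hol n x y) (hol_lim x y) sequentially"
  proof (rule uniform_limitI)
    fix e :: real assume "e > 0"
    then have "\<forall>\<^sub>F n in sequentially. rate c * \<rho> ^ n < e" by (rule order_tendstoD(2)[OF rate_tendsto_0])
    then show "\<forall>\<^sub>F n in sequentially. \<forall>t\<in>UNIV. dist (hol n x y t) (hol_lim x y t) < e"
      by eventually_elim (use hol_rate[OF assms] le_less_trans in blast)
  qed
qed simp

text \<open>\<open>hol_lim y x (hol n x y t)\<close> is computed in two ways. Continuity gives the
  left side as its limit; since \<open>hol n y x\<close> is uniformly close to
  \<open>hol_lim y x\<close> and exactly inverts \<open>hol n x y\<close>, the limit is also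
  \<open>t\<close>.\<close>

lemma hol_lim_swap:
  assumes "asymptotic c x y"
  shows "hol_lim y x (hol_lim x y t) = t"
proof -
  note yx = asymptotic_sym[OF assms]
  have xy: "x \<in> X" "y \<in> X" using assms by (auto simp: asymptotic_def)
  have "(\<lambda>n. hol_lim y x (hol n x y t)) \<longlonglongrightarrow> hol_lim y x (hol_lim x y t)"
    by (rule continuous_on_tendsto_compose[OF continuous_on_hol_lim[OF yx] hol_tendsto[OF assms]]) auto
  moreover have "(\<lambda>n. hol_lim y x (hol n x y t)) \<longlonglongrightarrow> t"
    unfolding tendsto_dist_iff[of _ t]
  proof (rule Lim_null_comparison[OF always_eventually rate_tendsto_0[of c]], rule allI)
    show "norm (dist (hol_lim y x (hol n x y t)) t) \<le> rate c * \<rho> ^ n" for n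
      using hol_rate[OF yx, of n "hol n x y t"] by (simp add: hol_swap[OF xy] dist_commute)
  qed
  ultimately show ?thesis by (rule LIMSEQ_unique)
qed

lemma
  assumes "asymptotic c x y"
  shows hol_lim_Diff0: "hol_lim x y \<in> Diff0" and inv_hol_lim: "inv (hol_lim x y) = hol_lim y x"
  using Diff0I[OF continuous_on_hol_lim[OF assms] continuous_on_hol_lim[OF asymptotic_sym[OF assms]]]
    hol_lim_swap[OF assms] hol_lim_swap[OF asymptotic_sym[OF assms]] by blast+

lemma distC0_hol_rate:
  assumes "asymptotic c x y"
  shows "distC0 (hol n x y) (hol_lim x y) \<le> 2 * rate c * \<rho> ^ n"
proof -
  have xy: "x \<in> X" "y \<in> X" using assms by (auto simp: asymptotic_def)
  have "dist0 (hol n x y) (hol_lim x y) \<le> rate c * \<rho> ^ n" "dist0 (hol n y x) (hol_lim y x) \<le> rate c * \<rho> ^ n"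
    by (intro dist0_le[OF comp] hol_rate assms asymptotic_sym)+
  then show ?thesis by (simp add: distC0_def inv_hol[OF xy] inv_hol_lim[OF assms])
qed

sublocale D: Metric_space "Diff0 :: ('m \<Rightarrow> 'm) set" distC0
  by (rule Metric_space_Diff0[OF comp])

lemma is_stable_holonomy_hol_lim:
  assumes "asymptotic c x y"
  shows "is_stable_holonomy X f A x y (hol_lim x y)"
proof -
  have xy: "x \<in> X" "y \<in> X" using assms by (auto simp: asymptotic_def)
  have "limitin D.mtopology (\<lambda>n. hol n x y) (hol_lim x y) sequentially"
    unfolding D.limitin_metric
  proof (intro conjI allI impI hol_lim_Diff0[OF assms])
    fix e :: real assume "e > 0"
    have "(\<lambda>n. 2 * (rate c * \<rho> ^ n)) \<longlonglongrightarrow> 0" by (intro tendsto_mult_right_zero rate_tendsto_0)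
    then have "\<forall>\<^sub>F n in sequentially. 2 * (rate c * \<rho> ^ n) < e"
      using \<open>e > 0\<close> by (rule order_tendstoD(2))
    then show "\<forall>\<^sub>F n in sequentially. hol n x y \<in> Diff0 \<and> distC0 (hol n x y) (hol_lim x y) < e"
      by eventually_elim (use distC0_hol_rate[OF assms] hol_Diff0[OF xy] le_less_trans in \<open>fastforce simp: mult.assoc\<close>)
  qed
  then show ?thesis
    by (simp add: is_stable_holonomy_def Diff0_topology_def hol_def cocycle_def)
qed

lemma stable_holonomy_eq:
  assumes "asymptotic c x y"
  shows "stable_holonomy X f A x y = hol_lim x y"
  unfolding stable_holonomy_def
proof (rule the_equality[where a = "hol_lim x y"])
  show "is_stable_holonomy X f A x y (hol_lim x y)" by (rule is_stable_holonomy_hol_lim[OF assms])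
  fix H assume "is_stable_holonomy X f A x y H"
  then show "H = hol_lim x y"
    using is_stable_holonomy_hol_lim[OF assms] D.Hausdorff_space_mtopology
    unfolding is_stable_holonomy_def Diff0_topology_def
    by (meson limitin_Hausdorff_unique trivial_limit_sequentially)
qed


section \<open>Continuous dependence of the holonomies on the pair of points\<close>

lemma cn_Suc_distC0:
  assumes x: "x \<in> X" and y: "y \<in> X"
  shows "distC0 (cn (Suc n) x) (cn (Suc n) y) \<le>
    (1 + L * \<sigma> ^ n) * distC0 (A ((f ^^ n) x)) (A ((f ^^ n) y)) + (1 + L * \<sigma>) * distC0 (cn n x) (cn n y)"
proof -
  let ?x = "(f ^^ n) x" and ?y = "(f ^^ n) y"
  note D0 = dist_le_dist0[OF comp]
  \<comment> \<open>A value of the generator is the cocycle at time 1 based at the orbit point, so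
    it inherits the Lipschitz bound.\<close>
  have A1: "dist (A ?y s) (A ?y t) \<le> L * \<sigma> * dist s t" for s t
    using lip[OF funpow_X[OF y], of 1 n s t] by simp
  have inv: "inv (cn (Suc n) z) t = inv (cn n z) (inv (A ((f ^^ n) z)) t)" if "z \<in> X" for z t
    using cn_Diff0[OF that] A[OF funpow_X[OF that]] by (simp add: Diff0_iff o_inv_distrib)
  \<comment> \<open>In the iterate the new factor is outermost, so its Lipschitz constant multiplies
    the old distance.\<close>
  have "dist0 (cn (Suc n) x) (cn (Suc n) y) \<le> dist0 (A ?x) (A ?y) + L * \<sigma> * dist0 (cn n x) (cn n y)"
  proof (rule dist0_le[OF comp])
    fix t
    have "dist (cn (Suc n) x t) (cn (Suc n) y t) \<le> dist (A ?x (cn n x t)) (A ?y (cn n x t))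
        + dist (A ?y (cn n x t)) (A ?y (cn n y t))" by (simp add: dist_triangle)
    also have "\<dots> \<le> dist0 (A ?x) (A ?y) + L * \<sigma> * dist (cn n x t) (cn n y t)"
      by (intro add_mono D0 A1)
    also have "\<dots> \<le> dist0 (A ?x) (A ?y) + L * \<sigma> * dist0 (cn n x) (cn n y)"
      using L \<sigma> by (intro add_left_mono mult_left_mono D0) auto
    finally show "dist (cn (Suc n) x t) (cn (Suc n) y t) \<le> \<dots>" .
  qed
  \<comment> \<open>In the inverse the new factor is innermost, so here the constant of the
    \<open>n\<close>-th inverse iterate multiplies the new distance.\<close>
  moreover have "dist0 (inv (cn (Suc n) x)) (inv (cn (Suc n) y)) \<le>
      dist0 (inv (cn n x)) (inv (cn n y)) + L * \<sigma> ^ n * dist0 (inv (A ?x)) (inv (A ?y))"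
  proof (rule dist0_le[OF comp])
    fix t
    have "dist (inv (cn (Suc n) x) t) (inv (cn (Suc n) y) t) \<le>
        dist (inv (cn n x) (inv (A ?x) t)) (inv (cn n y) (inv (A ?x) t))
        + dist (inv (cn n y) (inv (A ?x) t)) (inv (cn n y) (inv (A ?y) t))"
      unfolding inv[OF x] inv[OF y] by (rule dist_triangle)
    also have "\<dots> \<le> dist0 (inv (cn n x)) (inv (cn n y)) + L * \<sigma> ^ n * dist (inv (A ?x) t) (inv (A ?y) t)"
      by (intro add_mono D0 lip_inv y)
    also have "\<dots> \<le> dist0 (inv (cn n x)) (inv (cn n y)) + L * \<sigma> ^ n * dist0 (inv (A ?x)) (inv (A ?y))"
      using L \<sigma> by (intro add_left_mono mult_left_mono D0) auto
    finally show "dist (inv (cn (Suc n) x) t) (inv (cn (Suc n) y) t) \<le> \<dots>" .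
  qed
  moreover have "0 \<le> L * \<sigma> ^ n * dist0 (A ?x) (A ?y)" "0 \<le> L * \<sigma> * dist0 (inv (cn n x)) (inv (cn n y))"
    using L \<sigma> dist0_nonneg[OF comp] by auto
  moreover have "0 \<le> dist0 (cn n x) (cn n y)" "0 \<le> dist0 (inv (A ?x)) (inv (A ?y))"
    by (rule dist0_nonneg[OF comp])+
  ultimately show ?thesis
    unfolding distC0_def ring_distribs mult_1 by linarith
qed

text \<open>For a fixed number of steps the growth of the constants with \<open>n\<close> is
  harmless; each step adds only the continuity of the orbit point and the Hoelder condition
  there.\<close>

lemma cn_continuous:
  assumes cf: "continuous_on X f" and x0: "x0 \<in> X"
  shows "((\<lambda>x. distC0 (cn n x) (cn n x0)) \<longlongrightarrow> 0) (at x0 within X)"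
proof (induction n)
  case 0
  show ?case by (simp add: distC0_self[OF comp])
next
  case (Suc n)
  have X: "\<forall>\<^sub>F x in at x0 within X. x \<in> X" by (simp add: eventually_at_filter)
  have "continuous_on X (f ^^ n)"
  proof (induction n)
    case (Suc n)
    have "continuous_on X (\<lambda>x. f ((f ^^ n) x))"
      by (rule continuous_on_compose2[OF cf Suc]) (use funpow_X in auto)
    then show ?case by (simp add: o_def)
  qed simp
  then have "((\<lambda>x. dist ((f ^^ n) x) ((f ^^ n) x0)) \<longlongrightarrow> 0) (at x0 within X)"
    using x0 by (simp add: continuous_on_def tendsto_dist_iff[symmetric])
  then have p: "((\<lambda>x. dist ((f ^^ n) x) ((f ^^ n) x0) powr \<beta>) \<longlongrightarrow> 0) (at x0 within X)"
    using \<beta> by (intro tendsto_zero_powrI[OF _ tendsto_const]) auto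
  have "((\<lambda>x. (1 + L * \<sigma> ^ n) * (C * dist ((f ^^ n) x) ((f ^^ n) x0) powr \<beta>)
      + (1 + L * \<sigma>) * distC0 (cn n x) (cn n x0)) \<longlongrightarrow> 0) (at x0 within X)"
    by (intro tendsto_add_zero tendsto_mult_right_zero p Suc)
  then show ?case
  proof (rule Lim_null_comparison[rotated])
    show "\<forall>\<^sub>F x in at x0 within X. norm (distC0 (cn (Suc n) x) (cn (Suc n) x0)) \<le>
        (1 + L * \<sigma> ^ n) * (C * dist ((f ^^ n) x) ((f ^^ n) x0) powr \<beta>)
      + (1 + L * \<sigma>) * distC0 (cn n x) (cn n x0)"
      using X
    proof eventually_elim
      case (elim x)
      have "(1 + L * \<sigma> ^ n) * distC0 (A ((f ^^ n) x)) (A ((f ^^ n) x0)) \<le>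
          (1 + L * \<sigma> ^ n) * (C * dist ((f ^^ n) x) ((f ^^ n) x0) powr \<beta>)"
        using L \<sigma> by (intro mult_left_mono holder funpow_X elim x0) auto
      then show ?case
        using cn_Suc_distC0[OF elim x0, of n] distC0_nonneg[OF comp, of "cn (Suc n) x" "cn (Suc n) x0"]
        unfolding real_norm_def by linarith
    qed
  qed
qed

text \<open>Inverting \<open>hol\<close> swaps its two points, so one estimate for
  \<open>dist0\<close>, applied to both orders, bounds both parts of \<open>distC0\<close>.\<close>

lemma distC0_hol:
  assumes X: "x \<in> X" "y \<in> X" "x' \<in> X" "y' \<in> X"
  shows "distC0 (hol n x y) (hol n x' y') \<le>
    (1 + L * \<sigma> ^ n) * (distC0 (cn n x) (cn n x') + distC0 (cn n y) (cn n y'))"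
proof -
  have *: "dist0 (hol n x y) (hol n x' y') \<le>
      dist0 (inv (cn n y)) (inv (cn n y')) + L * \<sigma> ^ n * dist0 (cn n x) (cn n x')"
    if X: "x \<in> X" "y \<in> X" "x' \<in> X" "y' \<in> X" for x y x' y'
  proof (rule dist0_le[OF comp])
    fix t
    have "dist (hol n x y t) (hol n x' y' t) \<le> dist (inv (cn n y) (cn n x t)) (inv (cn n y') (cn n x t))
        + dist (inv (cn n y') (cn n x t)) (inv (cn n y') (cn n x' t))"
      unfolding hol_def o_apply by (rule dist_triangle)
    also have "\<dots> \<le> dist0 (inv (cn n y)) (inv (cn n y')) + L * \<sigma> ^ n * dist (cn n x t) (cn n x' t)"
      by (intro add_mono dist_le_dist0[OF comp] lip_inv X)
    also have "\<dots> \<le> dist0 (inv (cn n y)) (inv (cn n y')) + L * \<sigma> ^ n * dist0 (cn n x) (cn n x')"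
      using L \<sigma> by (intro add_left_mono mult_left_mono dist_le_dist0[OF comp]) auto
    finally show "dist (hol n x y t) (hol n x' y' t) \<le> \<dots>" .
  qed
  have "0 \<le> L * \<sigma> ^ n * dist0 (inv (cn n x)) (inv (cn n x'))" "0 \<le> L * \<sigma> ^ n * dist0 (inv (cn n y)) (inv (cn n y'))"
    using L \<sigma> dist0_nonneg[OF comp] by auto
  then show ?thesis
    using *[OF X] *[OF X(2,1,4,3)] dist0_nonneg[OF comp, of "cn n x" "cn n x'"] dist0_nonneg[OF comp, of "cn n y" "cn n y'"]
    unfolding distC0_def inv_hol[OF X(1,2)] inv_hol[OF X(3,4)] by (simp add: algebra_simps)
qed

text \<open>A uniform limit of continuous maps. Because \<open>c\<close> is common to all pairs, one
  index \<open>n\<close> approximates the holonomies of all of them, and only the continuity of that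
  approximation is needed.\<close>

lemma continuous_map_stable_holonomy:
  assumes cf: "continuous_on X f" and W: "\<And>x y. x \<in> X \<Longrightarrow> y \<in> W x \<Longrightarrow> asymptotic c x y"
  shows "continuous_map (top_of_set (SIGMA x:X. W x)) Diff0_topology (\<lambda>(x, y). stable_holonomy X f A x y)"
  unfolding Diff0_topology_def D.continuous_map_to_metric
proof (intro ballI allI impI)
  fix p and e :: real
  assume "p \<in> topspace (top_of_set (SIGMA x:X. W x))" and e: "e > 0"
  then obtain x0 y0 where p: "p = (x0, y0)" "x0 \<in> X" "y0 \<in> W x0" by auto
  have y0: "y0 \<in> X" using W[OF p(2,3)] by (simp add: asymptotic_def)
  \<comment> \<open>Each of the two approximation errors is at most
    \<open>2 * rate c * \<rho> ^ n\<close>, hence below \<open>e / 3\<close>.\<close>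
  have "\<forall>\<^sub>F n in sequentially. rate c * \<rho> ^ n < e / 6" using e by (intro order_tendstoD(2)[OF rate_tendsto_0]) simp
  then obtain n where n: "rate c * \<rho> ^ n < e / 6" by (auto simp: eventually_sequentially)
  define k where "k = 1 + L * \<sigma> ^ n"
  have k: "k > 0" using L \<sigma> by (simp add: k_def add_pos_nonneg)
  \<comment> \<open>\<open>distC0_hol\<close> adds two such distances and multiplies by
    \<open>k\<close>, which yields the remaining \<open>e / 3\<close>.\<close>
  have "\<exists>d>0. \<forall>x\<in>X. dist x z < d \<longrightarrow> distC0 (cn n x) (cn n z) < e / (6 * k)" if "z \<in> X" for z
  proof -
    have "\<forall>\<^sub>F x in at z within X. distC0 (cn n x) (cn n z) < e / (6 * k)"
      using e k by (intro order_tendstoD(2)[OF cn_continuous[OF cf that]]) simp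
    then obtain d where "d > 0" "\<forall>x\<in>X. x \<noteq> z \<and> dist x z < d \<longrightarrow> distC0 (cn n x) (cn n z) < e / (6 * k)"
      by (auto simp: eventually_at)
    moreover have "distC0 (cn n z) (cn n z) < e / (6 * k)" using e k by (simp add: distC0_self[OF comp])
    ultimately show ?thesis by metis
  qed
  then obtain d1 d2 where
    d1: "d1 > 0" "\<And>x. x \<in> X \<Longrightarrow> dist x x0 < d1 \<Longrightarrow> distC0 (cn n x) (cn n x0) < e / (6 * k)" and
    d2: "d2 > 0" "\<And>y. y \<in> X \<Longrightarrow> dist y y0 < d2 \<Longrightarrow> distC0 (cn n y) (cn n y0) < e / (6 * k)"
    using p(2) y0 by metis
  let ?U = "(SIGMA x:X. W x) \<inter> (ball x0 d1 \<times> ball y0 d2)"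
  show "\<exists>U. openin (top_of_set (SIGMA x:X. W x)) U \<and> p \<in> U \<and>
      (\<forall>q\<in>U. (case q of (x, y) \<Rightarrow> stable_holonomy X f A x y)
        \<in> D.mball (case p of (x, y) \<Rightarrow> stable_holonomy X f A x y) e)"
  proof (intro exI[of _ ?U] conjI ballI)
    show "openin (top_of_set (SIGMA x:X. W x)) ?U" by (intro openin_open_Int open_Times) auto
    show "p \<in> ?U" using p d1(1) d2(1) by simp
    fix q assume "q \<in> ?U"
    then obtain x y where q: "q = (x, y)" "x \<in> X" "y \<in> W x" "dist x x0 < d1" "dist y y0 < d2"
      by (auto simp: dist_commute)
    note a = W[OF q(2,3)] and a0 = W[OF p(2,3)]
    have y: "y \<in> X" using a by (simp add: asymptotic_def)
    have "distC0 (hol n x0 y0) (hol n x y) \<le> k * (distC0 (cn n x) (cn n x0) + distC0 (cn n y) (cn n y0))"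
      using distC0_hol[OF q(2) y p(2) y0] by (simp add: k_def distC0_commute[OF comp])
    also have "\<dots> \<le> k * (e / (6 * k) + e / (6 * k))"
      using k d1(2)[OF q(2,4)] d2(2)[OF y q(5)] by (intro mult_left_mono) auto
    also have "\<dots> = e / 3" using k by (simp add: field_simps)
    finally have 1: "distC0 (hol n x0 y0) (hol n x y) \<le> e / 3" .
    note D0 = hol_lim_Diff0[OF a0] hol_lim_Diff0[OF a] hol_Diff0[OF q(2) y] hol_Diff0[OF p(2) y0]
    have "distC0 (hol_lim x0 y0) (hol_lim x y) \<le> distC0 (hol_lim x0 y0) (hol n x0 y0)
        + distC0 (hol n x0 y0) (hol n x y) + distC0 (hol n x y) (hol_lim x y)"
      by (rule order_trans[OF D.triangle[OF D0(1,3,2)] add_right_mono[OF D.triangle[OF D0(1,4,3)]]])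
    also have "\<dots> < e"
      using 1 n distC0_hol_rate[OF a, of n] distC0_hol_rate[OF a0, of n] e
        distC0_commute[OF comp, of "hol_lim x0 y0" "hol n x0 y0"] by linarith
    finally show "(case q of (x, y) \<Rightarrow> stable_holonomy X f A x y)
        \<in> D.mball (case p of (x, y) \<Rightarrow> stable_holonomy X f A x y) e"
      using D0 by (simp add: p q stable_holonomy_eq[OF a] stable_holonomy_eq[OF a0])
  qed
qed

lemma has_stable_holonomies:
  assumes cf: "continuous_on X f" and Wl: "\<And>x y. x \<in> X \<Longrightarrow> y \<in> Wl x \<Longrightarrow> asymptotic c x y"
    and Ws: "\<And>x y. x \<in> X \<Longrightarrow> y \<in> Ws x \<Longrightarrow> \<exists>c. asymptotic c x y"
  shows "has_stable_holonomies X f Ws Wl A"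
proof -
  obtain \<alpha> H where aH: "0 < \<alpha>" "\<alpha> \<le> 1"
    "\<And>x y s t. asymptotic c x y \<Longrightarrow> dist (hol_lim x y s) (hol_lim x y t) \<le> H * dist s t powr \<alpha>"
    using hol_lim_holder[of c] by blast
  show ?thesis
    unfolding has_stable_holonomies_def
  proof (intro conjI ballI)
    show "\<exists>H. is_stable_holonomy X f A x y H" if "x \<in> X" "y \<in> Ws x" for x y
      using Ws[OF that] is_stable_holonomy_hol_lim by blast
    show "continuous_map (top_of_set (SIGMA x:X. Wl x)) Diff0_topology (\<lambda>(x, y). stable_holonomy X f A x y)"
      by (rule continuous_map_stable_holonomy[OF cf Wl])
    have "dist (stable_holonomy X f A x y s) (stable_holonomy X f A x y t) \<le> H * dist s t powr \<alpha>"
      if "x \<in> X" "y \<in> Wl x" for x y s t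
      using aH(3)[OF Wl[OF that]] by (simp add: stable_holonomy_eq[OF Wl[OF that]])
    then show "\<exists>\<alpha> C. 0 < \<alpha> \<and> \<alpha> \<le> 1 \<and> (\<forall>x\<in>X. \<forall>y\<in>Wl x. \<forall>s t.
        dist (stable_holonomy X f A x y s) (stable_holonomy X f A x y t) \<le> C * dist s t powr \<alpha>)"
      using aH(1,2) by blast
  qed
qed

end

section \<open>Conjugacies and stable holonomies\<close>

lemma stable_holonomy_conjugacy:
  fixes A B :: "'x::metric_space \<Rightarrow> 'm::metric_space \<Rightarrow> 'm"
  assumes hA: "holder_cocycle X f A \<beta> CA LA \<sigma> lam" and hB: "holder_cocycle X f B \<beta> CB LB \<sigma> lam"
    and \<Phi>: "holder_Diff0 \<beta> X \<Phi>" and conj: "conjugacy X f A B \<Phi>"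
    and as: "holder_cocycle.asymptotic X f lam c x y"
  shows "stable_holonomy X f A x y = \<Phi> y \<circ> stable_holonomy X f B x y \<circ> inv (\<Phi> x)"
proof
  interpret A: holder_cocycle X f A \<beta> CA LA \<sigma> lam by (rule hA)
  interpret B: holder_cocycle X f B \<beta> CB LB \<sigma> lam by (rule hB)
  have xy: "x \<in> X" "y \<in> X" and d: "dist ((f ^^ n) x) ((f ^^ n) y) \<le> c * lam ^ n" for n
    using as by (auto simp: A.asymptotic_def)
  have \<Phi>0: "\<Phi> z \<in> Diff0" if "z \<in> X" for z using \<Phi> that by (simp add: holder_Diff0_def)
  obtain C where C: "\<And>x y. x \<in> X \<Longrightarrow> y \<in> X \<Longrightarrow> distC0 (\<Phi> x) (\<Phi> y) \<le> C * dist x y powr \<beta>"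
    using \<Phi> unfolding holder_Diff0_def by blast
  \<comment> \<open>The intermediate conjugacies cancel along the orbit, leaving only those at its
    two ends.\<close>
  have cn: "A.cn n z (\<Phi> z t) = \<Phi> ((f ^^ n) z) (B.cn n z t)" if "z \<in> X" for n z t
  proof (induction n)
    case (Suc n)
    have z: "(f ^^ n) z \<in> X" by (rule A.funpow_X[OF that])
    then have "A ((f ^^ n) z) = \<Phi> (f ((f ^^ n) z)) \<circ> B ((f ^^ n) z) \<circ> inv (\<Phi> ((f ^^ n) z))"
      using conj by (simp add: conjugacy_def)
    then show ?case using Suc by (simp add: Diff0_inverse[OF \<Phi>0[OF z]])
  qed simp
  fix t
  define s where "s = inv (\<Phi> x) t"
  have t: "t = \<Phi> x s" by (simp add: s_def Diff0_inverse[OF \<Phi>0[OF xy(1)]])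
  \<comment> \<open>If \<open>\<Phi>\<close> agreed at the two orbit points, \<open>v n\<close>
    would be \<open>B.cn n x s\<close> and the intertwining would hold exactly at time
    \<open>n\<close>. The mismatch is all that has to be estimated.\<close>
  define v where "v n = inv (\<Phi> ((f ^^ n) y)) (\<Phi> ((f ^^ n) x) (B.cn n x s))" for n
  have "A.hol n x y t = \<Phi> y (inv (B.cn n y) (v n))" for n
  proof -
    have "A.cn n y (\<Phi> y (inv (B.cn n y) (v n))) = A.cn n x t"
      using Diff0_inverse[OF B.cn_Diff0[OF xy(2)]] Diff0_inverse[OF \<Phi>0[OF A.funpow_X[OF xy(2)]]]
      by (simp add: cn[OF xy(2)] t cn[OF xy(1)] v_def)
    then have "inv (A.cn n y) (A.cn n y (\<Phi> y (inv (B.cn n y) (v n)))) = A.hol n x y t"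
      by (simp add: A.hol_def)
    then show ?thesis by (simp add: Diff0_inverse(1)[OF A.cn_Diff0[OF xy(2)]])
  qed
  moreover have "(\<lambda>n. \<Phi> y (inv (B.cn n y) (v n))) \<longlonglongrightarrow> \<Phi> y (B.hol_lim x y s)"
  proof -
    have bound: "dist (inv (B.cn n y) (v n)) (B.hol_lim x y s) \<le>
        (LB * \<bar>C\<bar> * c powr \<beta>) * B.\<rho> ^ n + B.rate c * B.\<rho> ^ n" for n
    proof -
      let ?u = "B.cn n x s" and ?x = "(f ^^ n) x" and ?y = "(f ^^ n) y"
      have X: "?x \<in> X" "?y \<in> X" using A.funpow_X xy by auto
      have "dist (v n) ?u = dist (inv (\<Phi> ?y) (\<Phi> ?x ?u)) (inv (\<Phi> ?x) (\<Phi> ?x ?u))"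
        by (simp add: v_def Diff0_inverse[OF \<Phi>0[OF X(1)]])
      also have "\<dots> \<le> C * dist ?y ?x powr \<beta>"
        using dist_inv_le_distC0[OF A.comp] C[OF X(2,1)] order_trans by blast
      also have "\<dots> \<le> \<bar>C\<bar> * dist ?x ?y powr \<beta>" by (simp add: dist_commute mult_right_mono)
      also have "\<dots> \<le> \<bar>C\<bar> * (c * lam ^ n) powr \<beta>"
        using d[of n] A.\<beta> by (intro mult_left_mono powr_mono2) auto
      also have "(c * lam ^ n) powr \<beta> = c powr \<beta> * (lam powr \<beta>) ^ n"
        using A.lam A.asymptotic_nonneg[OF as]
        by (simp add: powr_mult powr_powr powr_realpow[symmetric] mult.commute)
      finally have vu: "dist (v n) ?u \<le> \<bar>C\<bar> * (c powr \<beta> * (lam powr \<beta>) ^ n)" .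
      have "dist (inv (B.cn n y) (v n)) (inv (B.cn n y) ?u) \<le> LB * \<sigma> ^ n * dist (v n) ?u"
        by (rule B.lip_inv[OF xy(2)])
      also have "\<dots> \<le> LB * \<sigma> ^ n * (\<bar>C\<bar> * (c powr \<beta> * (lam powr \<beta>) ^ n))"
        using B.L B.\<sigma> by (intro mult_left_mono vu) auto
      also have "\<dots> = (LB * \<bar>C\<bar> * c powr \<beta>) * B.\<rho> ^ n"
        by (simp add: B.\<rho>_def power_mult_distrib mult_ac)
      finally have "dist (inv (B.cn n y) (v n)) (inv (B.cn n y) ?u) \<le> (LB * \<bar>C\<bar> * c powr \<beta>) * B.\<rho> ^ n" .
      moreover have "dist (inv (B.cn n y) ?u) (B.hol_lim x y s) \<le> B.rate c * B.\<rho> ^ n"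
        using B.hol_rate[OF as, of n s] by (simp add: B.hol_def)
      ultimately show ?thesis by (rule order_trans[OF dist_triangle add_mono])
    qed
    have "(\<lambda>n. (LB * \<bar>C\<bar> * c powr \<beta>) * B.\<rho> ^ n + B.rate c * B.\<rho> ^ n) \<longlonglongrightarrow> 0"
      using B.\<rho> by (intro tendsto_add_zero B.rate_tendsto_0 tendsto_mult_right_zero LIMSEQ_realpow_zero) auto
    then have "(\<lambda>n. dist (inv (B.cn n y) (v n)) (B.hol_lim x y s)) \<longlonglongrightarrow> 0"
      by (rule Lim_null_comparison[rotated]) (use bound in auto)
    then have "(\<lambda>n. inv (B.cn n y) (v n)) \<longlonglongrightarrow> B.hol_lim x y s"
      by (rule tendsto_dist_iff[THEN iffD2])
    moreover have "continuous_on UNIV (\<Phi> y)" using \<Phi>0[OF xy(2)] by (simp add: Diff0_iff)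
    ultimately show ?thesis using continuous_on_tendsto_compose[of UNIV "\<Phi> y"] by auto
  qed
  ultimately have "(\<lambda>n. A.hol n x y t) \<longlonglongrightarrow> \<Phi> y (B.hol_lim x y s)" by presburger
  then have "A.hol_lim x y t = \<Phi> y (B.hol_lim x y s)"
    by (rule LIMSEQ_unique[OF A.hol_tendsto[OF as]])
  then show "stable_holonomy X f A x y t = (\<Phi> y \<circ> stable_holonomy X f B x y \<circ> inv (\<Phi> x)) t"
    by (simp add: A.stable_holonomy_eq[OF as] B.stable_holonomy_eq[OF as] s_def)
qed

section \<open>Contraction along stable sets\<close>

text \<open>In box coordinates a plaque is a convex disc, so two of its points are joined by a
  segment. The tangency of the plaques to \<open>E\<close> makes its image an admissible curve of
  finite length in the leaf.\<close>

lemma leaf_edist_plaque_finite: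
  fixes N :: "('x::metric_space, 'k::euclidean_space) chart set"
  assumes N: "smooth_manifold N" and g: "riemannian_metric N g"
    and S: "subspace S" and b: "foliation_box S b" "plaques_tangent N S b E"
    and W: "\<And>z. same_plaque S b x z \<Longrightarrow> z \<in> W x" and y: "same_plaque S b x y"
  shows "leaf_edist N g E W x y < \<infinity>"
proof -
  have xy: "x \<in> fst b" "y \<in> fst b" "snd b x - snd b y \<in> S"
    using y by (auto simp: same_plaque_def)
  have im: "snd b ` fst b = {p + q | p q. p \<in> S \<inter> ball 0 1 \<and> q \<in> S\<^sup>\<bottom> \<inter> ball 0 1}"
    and hom: "homeomorphism (fst b) (snd b ` fst b) (snd b) (chart_inv b)"
    using b(1) by (auto simp: foliation_box_def)
  obtain p0 q p1 q1 where p: "snd b x = p0 + q" "p0 \<in> S \<inter> ball 0 1" "q \<in> S\<^sup>\<bottom> \<inter> ball 0 1"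
    "snd b y = p1 + q1" "p1 \<in> S \<inter> ball 0 1" "q1 \<in> S\<^sup>\<bottom> \<inter> ball 0 1"
    using im xy by (smt (verit, ccfv_threshold) image_eqI mem_Collect_eq)
  have "q1 = q"
  proof -
    have "(p0 + q) - (p1 + q1) \<in> S" using xy p by simp
    moreover have "p0 - p1 \<in> S" using p by (intro subspace_diff[OF S]) auto
    ultimately have "(p0 + q) - (p1 + q1) - (p0 - p1) \<in> S" by (rule subspace_diff[OF S])
    then have "q - q1 \<in> S" by (simp add: algebra_simps)
    moreover have "q - q1 \<in> S\<^sup>\<bottom>"
      using p by (intro subspace_diff[OF subspace_orthogonal_comp]) auto
    ultimately have "orthogonal (q - q1) (q - q1)" by (auto simp: orthogonal_comp_def)
    then show ?thesis by (simp add: orthogonal_def)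
  qed
  define v where "v = p1 - p0"
  define l where "l = (\<lambda>t::real. p0 + t *\<^sub>R v)"
  define \<gamma> where "\<gamma> = (\<lambda>t. chart_inv b (l t + q))"
  \<comment> \<open>An open set of parameters containing \<open>{0..1}\<close>, so that the curve
    has two-sided derivatives at the endpoints as well.\<close>
  define I where "I = l -` ball 0 1"
  have v: "v \<in> S" using p S by (auto simp: v_def intro: subspace_diff)
  have lS: "l t \<in> S" for t using p v S by (auto simp: l_def intro!: subspace_add subspace_scale)
  have cl: "continuous_on UNIV l" unfolding l_def by (intro continuous_intros)
  have I: "open I" unfolding I_def using cl by (intro open_vimage open_ball)
  have sub: "{0..1} \<subseteq> I"
  proof
    fix t :: real assume "t \<in> {0..1}"
    then have "(1 - t) *\<^sub>R p0 + t *\<^sub>R p1 \<in> ball 0 1"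
      using p by (intro convexD[OF convex_ball]) auto
    then show "t \<in> I" by (simp add: I_def l_def v_def algebra_simps)
  qed
  have lim: "l t + q \<in> snd b ` fst b" if "t \<in> I" for t
    unfolding im using lS that p by (auto simp: I_def)
  have \<gamma>U: "\<gamma> t \<in> fst b" "snd b (\<gamma> t) = l t + q" if "t \<in> I" for t
    using lim[OF that] hom unfolding homeomorphism_def \<gamma>_def by (metis imageI, metis)
  have \<gamma>W: "\<gamma> t \<in> W x" if "t \<in> I" for t
  proof (rule W)
    have "p0 - l t \<in> S" using p lS by (intro subspace_diff S) auto
    then show "same_plaque S b x (\<gamma> t)"
      using \<gamma>U[OF that] xy p by (simp add: same_plaque_def)
  qed
  have "continuous_on I \<gamma>"
    unfolding \<gamma>_def
    by (rule continuous_on_compose2[of "snd b ` fst b"])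
      (use hom lim cl in \<open>auto simp: homeomorphism_def intro!: continuous_intros intro: continuous_on_subset\<close>)
  then have cont: "isCont \<gamma> t" if "t \<in> I" for t using I that by (simp add: continuous_on_eq_continuous_at)
  have "\<exists>D. (\<forall>t\<in>I \<inter> \<gamma> -` fst c. ((snd c \<circ> \<gamma>) has_vector_derivative D t) (at t) \<and>
        chart_vec N c (\<gamma> t) (D t) \<in> E (\<gamma> t)) \<and> continuous_on (I \<inter> \<gamma> -` fst c) D" if c: "c \<in> N" for c
  proof -
    define P where "P = {p \<in> S \<inter> ball 0 1. chart_inv b (p + q) \<in> fst c}"
    obtain D :: "'k \<Rightarrow> 'k \<Rightarrow>\<^sub>L 'k" where D: "continuous_on P D"
      "\<And>p. p \<in> P \<Longrightarrow> ((\<lambda>p. snd c (chart_inv b (p + q))) has_derivative blinfun_apply (D p)) (at p within S)"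
      "\<And>p. p \<in> P \<Longrightarrow> chart_vec N c (chart_inv b (p + q)) ` (blinfun_apply (D p) ` S) = E (chart_inv b (p + q))"
      using bspec[OF bspec[OF b(2)[unfolded plaques_tangent_def Let_def] p(3)] c]
      unfolding P_def[symmetric] by blast
    have lP: "l t \<in> P" if "t \<in> I \<inter> \<gamma> -` fst c" for t
      using that lS by (auto simp: P_def I_def \<gamma>_def)
    show ?thesis
    proof (intro exI[of _ "\<lambda>t. D (l t) v"] conjI ballI)
      fix t assume t: "t \<in> I \<inter> \<gamma> -` fst c"
      have "(l has_derivative (\<lambda>s. s *\<^sub>R v)) (at t)"
        unfolding l_def by (auto intro!: derivative_eq_intros)
      \<comment> \<open>The plaque is known to be differentiable only within \<open>S\<close>. The
        whole line \<open>l\<close> lies in \<open>S\<close>, so this still gives an ordinary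
        derivative in the real parameter.\<close>
      moreover have "((\<lambda>p. snd c (chart_inv b (p + q))) has_derivative blinfun_apply (D (l t)))
          (at (l t) within range l)"
        by (rule has_derivative_subset[OF D(2)[OF lP[OF t]]]) (use lS in auto)
      ultimately have "((\<lambda>s. snd c (chart_inv b (l s + q))) has_derivative (\<lambda>s. D (l t) (s *\<^sub>R v))) (at t)"
        by (rule has_derivative_in_compose)
      then show "((snd c \<circ> \<gamma>) has_vector_derivative D (l t) v) (at t)"
        by (simp add: has_vector_derivative_def \<gamma>_def o_def blinfun.scaleR_right)
      show "chart_vec N c (\<gamma> t) (D (l t) v) \<in> E (\<gamma> t)"
        using D(3)[OF lP[OF t]] v unfolding \<gamma>_def by blast
    next
      show "continuous_on (I \<inter> \<gamma> -` fst c) (\<lambda>t. D (l t) v)"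
        by (intro continuous_intros continuous_on_compose2[OF D(1)] continuous_on_subset[OF cl])
          (use lP in auto)
    qed
  qed
  then obtain D where D: "\<And>c t. c \<in> N \<Longrightarrow> t \<in> I \<inter> \<gamma> -` fst c \<Longrightarrow> ((snd c \<circ> \<gamma>) has_vector_derivative D c t) (at t)"
    "\<And>c t. c \<in> N \<Longrightarrow> t \<in> I \<inter> \<gamma> -` fst c \<Longrightarrow> chart_vec N c (\<gamma> t) (D c t) \<in> E (\<gamma> t)"
    "\<And>c. c \<in> N \<Longrightarrow> continuous_on (I \<inter> \<gamma> -` fst c) (D c)" by metis
  have C1: "C1_curve_on N {0..1} \<gamma>"
    unfolding C1_curve_on_def C1_differentiable_on_def
  proof (intro conjI ballI)
    show "isCont \<gamma> t" if "t \<in> {0..1}" for t using cont sub that by blast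
    show "\<exists>D. (\<forall>t\<in>{0..1} \<inter> \<gamma> -` fst c. ((snd c \<circ> \<gamma>) has_vector_derivative D t) (at t)) \<and>
        continuous_on ({0..1} \<inter> \<gamma> -` fst c) D" if c: "c \<in> N" for c
    proof (intro exI[of _ "D c"] conjI ballI)
      show "((snd c \<circ> \<gamma>) has_vector_derivative D c t) (at t)" if "t \<in> {0..1} \<inter> \<gamma> -` fst c" for t
        using D(1)[OF c] sub that by blast
      show "continuous_on ({0..1} \<inter> \<gamma> -` fst c) (D c)"
        by (rule continuous_on_subset[OF D(3)[OF c]]) (use sub in auto)
    qed
  qed
  have vel: "velocity N \<gamma> t \<in> E (\<gamma> t)" if t: "t \<in> {0..1}" for t
  proof -
    define c where "c = chart_at N (\<gamma> t)"
    have c: "c \<in> N" "\<gamma> t \<in> fst c" using chart_at[OF N] by (auto simp: c_def)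
    have t': "t \<in> I \<inter> \<gamma> -` fst c" using c t sub by auto
    show ?thesis
      using velocity_chart[OF N C1 c(1) t c(2) D(1)[OF c(1) t']] D(2)[OF c(1) t'] by simp
  qed
  have "\<gamma> 0 = x" "\<gamma> 1 = y"
    using p xy hom \<open>q1 = q\<close> unfolding \<gamma>_def l_def v_def homeomorphism_def by (metis add.right_neutral scaleR_zero_left, metis add_diff_cancel_left' add_diff_eq scaleR_one)
  moreover have "finite {t \<in> {0..1}. velocity N \<gamma> t \<notin> E (\<gamma> t)}"
    by (rule finite_subset[of _ "{}"]) (use vel in auto)
  ultimately show ?thesis
    using C1_curve_on_finite_length[OF N g C1] \<gamma>W subsetD[OF sub] unfolding leaf_edist_def INF_less_iff
    by (intro bexI[of _ \<gamma>]) simp_all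
qed

text \<open>Images of admissible curves are admissible: invariance keeps them in a leaf and tangent
  to \<open>E\<close> up to finitely many parameters. Only vectors of \<open>E\<close> then enter
  the length estimate.\<close>

lemma leaf_edist_comp_le:
  fixes N :: "('x::metric_space, 'k::euclidean_space) chart set"
  assumes N: "smooth_manifold N" and f: "C1_map_on N N UNIV f" and r: "0 \<le> r"
    and inv: "\<And>x. mderiv N N f x ` E x \<subseteq> E (f x)" "\<And>x. f ` W x \<subseteq> W (f x)"
    and contr: "\<And>x v. v \<in> E x \<Longrightarrow> rnorm g (f x) (mderiv N N f x v) \<le> r * rnorm g x v"
    and fin: "leaf_edist N g E W x y < \<infinity>"
  shows "leaf_edist N g E W (f x) (f y) \<le> ennreal r * leaf_edist N g E W x y"
proof -
  let ?C = "\<lambda>x y. {\<gamma>. piecewise_C1_curve N \<gamma> \<and> \<gamma> 0 = x \<and> \<gamma> 1 = y \<and> (\<forall>t\<in>{0..1}. \<gamma> t \<in> W x) \<and>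
                finite {t\<in>{0..1}. velocity N \<gamma> t \<notin> E (\<gamma> t)}}"
  have le: "leaf_edist N g E W (f x) (f y) \<le> ennreal r * curve_length N g \<gamma>" if \<gamma>: "\<gamma> \<in> ?C x y" for \<gamma>
  proof -
    let ?T = "{t\<in>{0..1}. velocity N \<gamma> t \<notin> E (\<gamma> t)}"
    have p: "piecewise_C1_curve N \<gamma>" and T: "finite ?T" using \<gamma> by auto
    have "{t\<in>{0..1}. velocity N (f \<circ> \<gamma>) t \<notin> E ((f \<circ> \<gamma>) t)} \<subseteq>
        ?T \<union> {t\<in>{0..1}. velocity N (f \<circ> \<gamma>) t \<noteq> mderiv N N f (\<gamma> t) (velocity N \<gamma> t)}"
      using inv(1) by (auto simp: image_subset_iff)
    then have "finite {t\<in>{0..1}. velocity N (f \<circ> \<gamma>) t \<notin> E ((f \<circ> \<gamma>) t)}"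
      using T finite_velocity_comp[OF N N f p] by (rule finite_subset[OF _ finite_UnI])
    moreover have "\<forall>t\<in>{0..1}. (f \<circ> \<gamma>) t \<in> W (f x)" using \<gamma> inv(2) by (auto simp: image_subset_iff)
    ultimately have "f \<circ> \<gamma> \<in> ?C (f x) (f y)"
      using \<gamma> piecewise_C1_curve_comp[OF N N f p] by simp
    then have "leaf_edist N g E W (f x) (f y) \<le> curve_length N g (f \<circ> \<gamma>)"
      unfolding leaf_edist_def by (rule INF_lower)
    also have "\<dots> \<le> ennreal r * curve_length N g \<gamma>"
      by (rule curve_length_comp_le[OF N N f p r T]) (use contr in auto)
    finally show ?thesis .
  qed
  have "?C x y \<noteq> {}" using fin unfolding leaf_edist_def by (auto simp: INF_less_iff)
  then show ?thesis
    unfolding leaf_edist_def[of N g E W x] by (rule le_mult_INF_ennreal) (rule le)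
qed

lemma dist_le_leaf_edist:
  assumes "riemannian_manifold N g" and "leaf_edist N g E W x y \<le> ennreal e" and "0 \<le> e"
  shows "dist x y \<le> e"
proof -
  have "riemannian_edist N g x y \<le> leaf_edist N g E W x y"
    unfolding riemannian_edist_def leaf_edist_def by (rule INF_superset_mono) auto
  then have le: "riemannian_edist N g x y \<le> ennreal e" using assms(2) by (rule order_trans)
  then have "riemannian_edist N g x y < \<infinity>" by (simp add: order_le_less_trans ennreal_less_top)
  then have "ennreal (dist x y) = riemannian_edist N g x y"
    using assms(1) by (simp add: riemannian_manifold_def)
  then have "ennreal (dist x y) \<le> ennreal e" using le by simp
  then show ?thesis using assms(3) by (simp add: ennreal_le_iff)
qed

lemma SUP_continuous_bounds:
  fixes l :: "'x::metric_space \<Rightarrow> real"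
  assumes "compact X" "X \<noteq> {}" "continuous_on X l" "\<And>x. x \<in> X \<Longrightarrow> 0 < l x \<and> l x < 1"
  shows "0 < (SUP x\<in>X. l x)" "(SUP x\<in>X. l x) < 1" "\<And>x. x \<in> X \<Longrightarrow> l x \<le> (SUP x\<in>X. l x)"
proof -
  obtain z where z: "z \<in> X" "\<And>x. x \<in> X \<Longrightarrow> l x \<le> l z"
    using continuous_attains_sup[OF assms(1-3)] by blast
  have "(SUP x\<in>X. l x) = l z" by (rule cSup_eq_maximum) (use z in auto)
  then show "0 < (SUP x\<in>X. l x)" "(SUP x\<in>X. l x) < 1" "\<And>x. x \<in> X \<Longrightarrow> l x \<le> (SUP x\<in>X. l x)"
    using assms(4)[OF z(1)] z by auto
qed

section \<open>Exponential contraction as the common feature of all systems\<close>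

definition contracted :: "('x::metric_space \<Rightarrow> 'x) \<Rightarrow> real \<Rightarrow> real \<Rightarrow> 'x \<Rightarrow> 'x \<Rightarrow> bool" where
  "contracted f lam c x y \<longleftrightarrow> (\<forall>n. dist ((f ^^ n) x) ((f ^^ n) y) \<le> c * lam ^ n)"

lemma contracted_trans: "contracted f lam c x y \<Longrightarrow> contracted f lam d y z \<Longrightarrow> contracted f lam (c + d) x z"
  unfolding contracted_def distrib_right
  by (intro allI order_trans[OF dist_triangle add_mono]) blast+

text \<open>An estimate valid from time \<open>N\<close> on costs only a larger constant at earlier
  times: each of the first \<open>N\<close> quotients is at most the sum of them all.\<close>

lemma contracted_funpow:
  assumes c: "contracted f lam c ((f ^^ N) x) ((f ^^ N) y)" and lam: "0 < lam"
  shows "\<exists>c. contracted f lam c x y"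
proof -
  let ?u = "\<lambda>n. dist ((f ^^ n) x) ((f ^^ n) y) / lam ^ n"
  have "?u n \<le> \<bar>c\<bar> / lam ^ N + sum ?u {..<N}" for n
  proof (cases "n < N")
    case True
    then have "?u n \<le> sum ?u {..<N}" using lam by (intro member_le_sum) auto
    moreover have "0 \<le> \<bar>c\<bar> / lam ^ N" using lam by simp
    ultimately show ?thesis by linarith
  next
    case False
    define m where "m = n - N"
    have n: "n = m + N" using False by (simp add: m_def)
    have "dist ((f ^^ n) x) ((f ^^ n) y) \<le> c * lam ^ m"
      using c unfolding contracted_def n funpow_add by simp
    also have "\<dots> \<le> \<bar>c\<bar> * lam ^ m" using lam by (intro mult_right_mono) auto
    finally have "?u n \<le> \<bar>c\<bar> / lam ^ N" using lam by (simp add: n power_add field_simps)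
    moreover have "0 \<le> sum ?u {..<N}" using lam by (intro sum_nonneg) auto
    ultimately show ?thesis by linarith
  qed
  then have "contracted f lam (\<bar>c\<bar> / lam ^ N + sum ?u {..<N}) x y"
    unfolding contracted_def using lam by (simp add: pos_divide_le_eq)
  then show ?thesis by blast
qed

text \<open>All that the cocycle argument uses of the base. The order of quantifiers is essential:
  the constant is uniform on local stable sets but may depend on the pair on global ones.\<close>

definition contracting_system :: "'x::metric_space set \<Rightarrow> ('x \<Rightarrow> 'x) \<Rightarrow> real \<Rightarrow> ('x \<Rightarrow> 'x set) \<Rightarrow> ('x \<Rightarrow> 'x set) \<Rightarrow> bool" where
  "contracting_system X f lam Ws Wl \<longleftrightarrow> X \<noteq> {} \<and> f ` X \<subseteq> X \<and> inj_on f X \<and> continuous_on X f \<and>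
     0 < lam \<and> lam < 1 \<and>
     (\<exists>c. \<forall>x\<in>X. \<forall>y\<in>Wl x. y \<in> X \<and> contracted f lam c x y) \<and>
     (\<forall>x\<in>X. \<forall>y\<in>Ws x. y \<in> X \<and> (\<exists>c. contracted f lam c x y))"

text \<open>The radius \<open>r\<close> is a uniform constant, since points of a local stable set
  are within \<open>r\<close> at time 0. If distances tend to 0 they stay below \<open>r\<close>
  from some time \<open>N\<close> on, and then the images under \<open>f ^^ N\<close> lie in a
  common local stable set.\<close>

lemma stable_sets_contracted:
  assumes st: "stable_sets X f l Ws Wl" and f: "f ` X \<subseteq> X" and lam: "lam = (SUP x\<in>X. l x)" "0 < lam"
  shows "\<exists>c. \<forall>x\<in>X. \<forall>y\<in>Wl x. y \<in> X \<and> contracted f lam c x y"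
    and "\<forall>x\<in>X. \<forall>y\<in>Ws x. y \<in> X \<and> (\<exists>c. contracted f lam c x y)"
proof -
  have Ws: "Ws x = {y\<in>X. (\<lambda>n. dist ((f ^^ n) x) ((f ^^ n) y)) \<longlonglongrightarrow> 0}" if "x \<in> X" for x
    using st that by (simp add: stable_sets_def)
  obtain r where r: "r > 0" "\<And>x. x \<in> X \<Longrightarrow> Wl x = {y\<in>X. \<forall>n. dist ((f ^^ n) x) ((f ^^ n) y) \<le> r}"
    using st unfolding stable_sets_def by blast
  have c: "dist ((f ^^ n) x) ((f ^^ n) y) \<le> lam ^ n * dist x y" if "x \<in> X" "y \<in> Wl x" for x y n
    using st that unfolding stable_sets_def lam(1) by blast
  have Wl: "y \<in> X \<and> contracted f lam r x y" if "x \<in> X" "y \<in> Wl x" for x y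
  proof
    show "y \<in> X" using r(2) that by blast
    have d: "dist x y \<le> r" using r(2)[OF that(1)] that(2) by (auto dest: spec[of _ 0])
    have "lam ^ n * dist x y \<le> r * lam ^ n" for n using mult_left_mono[OF d, of "lam ^ n"] lam(2) by (simp add: mult.commute)
    then show "contracted f lam r x y" unfolding contracted_def using c[OF that] order_trans by blast
  qed
  then show "\<exists>c. \<forall>x\<in>X. \<forall>y\<in>Wl x. y \<in> X \<and> contracted f lam c x y" by blast
  show "\<forall>x\<in>X. \<forall>y\<in>Ws x. y \<in> X \<and> (\<exists>c. contracted f lam c x y)"
  proof (intro ballI conjI)
    fix x y assume x: "x \<in> X" and y: "y \<in> Ws x"
    then show "y \<in> X" using Ws by blast
    have "(\<lambda>n. dist ((f ^^ n) x) ((f ^^ n) y)) \<longlonglongrightarrow> 0" using x y Ws by blast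
    then have "\<forall>\<^sub>F n in sequentially. dist ((f ^^ n) x) ((f ^^ n) y) < r" using r(1) by (rule order_tendstoD(2))
    then obtain N where N: "\<And>n. n \<ge> N \<Longrightarrow> dist ((f ^^ n) x) ((f ^^ n) y) < r"
      by (auto simp: eventually_sequentially)
    have "dist ((f ^^ m) ((f ^^ N) x)) ((f ^^ m) ((f ^^ N) y)) \<le> r" for m
      using N[of "m + N"] by (simp add: funpow_add)
    then have "(f ^^ N) y \<in> Wl ((f ^^ N) x)"
      using r(2)[OF funpow_in[OF f x, of N]] funpow_in[OF f \<open>y \<in> X\<close>, of N] by simp
    then show "\<exists>c. contracted f lam c x y"
      using Wl[OF funpow_in[OF f x]] contracted_funpow[OF _ lam(2)] by blast
  qed
qed

lemma hyperbolic_splitting_rate: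
  assumes "hyperbolic_splitting N g X f l"
  shows "continuous_on X l" "x \<in> X \<Longrightarrow> 0 < l x \<and> l x < 1"
  using assms unfolding hyperbolic_splitting_def by (elim exE conjE, simp)+

lemma transitive_anosov_contracting:
  assumes sys: "transitive_anosov_system N X f l Ws Wl"
  shows "contracting_system X f (SUP x\<in>X. l x) Ws Wl"
proof -
  have X: "X = UNIV" "compact X" and f: "f \<in> Diff1 N" and st: "stable_sets X f l Ws Wl"
    using sys unfolding transitive_anosov_system_def by - (elim conjE exE, assumption)+
  moreover obtain g where "hyperbolic_splitting N g X f l"
    using sys unfolding transitive_anosov_system_def by (elim conjE exE)
  then have "continuous_on X l" "\<And>x. x \<in> X \<Longrightarrow> 0 < l x \<and> l x < 1"
    by (rule hyperbolic_splitting_rate)+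
  ultimately have lam: "0 < (SUP x\<in>X. l x)" "(SUP x\<in>X. l x) < 1" using SUP_continuous_bounds[of X l] by auto
  have "X \<noteq> {}" "f ` X \<subseteq> X" "inj_on f X" "continuous_on X f"
    using f X by (simp_all add: Diff1_iff C1_map_on_def bij_def)
  then show ?thesis
    unfolding contracting_system_def
    using lam stable_sets_contracted[OF st _ refl lam(1)] by blast
qed

lemma mixing_hyperbolic_set_contracting:
  assumes sys: "mixing_hyperbolic_set_system N X f l Ws Wl"
  shows "contracting_system X f (SUP x\<in>X. l x) Ws Wl"
proof -
  have X: "X \<noteq> {}" "compact X" "f ` X = X" and st: "stable_sets X f l Ws Wl"
    using sys unfolding mixing_hyperbolic_set_system_def by - (elim conjE exE, assumption)+
  moreover obtain g where "hyperbolic_splitting N g X f l"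
    using sys unfolding mixing_hyperbolic_set_system_def by (elim conjE exE)
  then have "continuous_on X l" "\<And>x. x \<in> X \<Longrightarrow> 0 < l x \<and> l x < 1"
    by (rule hyperbolic_splitting_rate)+
  ultimately have lam: "0 < (SUP x\<in>X. l x)" "(SUP x\<in>X. l x) < 1" using SUP_continuous_bounds[of X l] by auto
  obtain U where U: "X \<subseteq> U" "C1_diffeo_on N U f"
    using sys unfolding mixing_hyperbolic_set_system_def by (elim conjE exE)
  have "inj_on f X" "continuous_on X f"
    using U inj_on_subset[of f U X] continuous_on_subset[of U f X]
    by (simp_all add: C1_diffeo_on_def C1_map_on_def)
  then show ?thesis
    unfolding contracting_system_def
    using X lam stable_sets_contracted[OF st equalityD1[OF X(3)] refl lam(1)] by blast
qed

text \<open>Sequences that agree at all nonnegative indices can differ, after \<open>n\<close>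
  shifts, only at indices below \<open>- n\<close>, so they are within \<open>\<theta> ^ n\<close>;
  the uniform constant is 1.\<close>

lemma mixing_sft_contracting:
  assumes sys: "mixing_sft_system X f l Ws Wl"
  shows "contracting_system X f (SUP x\<in>X. l x) Ws Wl"
proof -
  obtain k F and s :: "'a \<Rightarrow> int \<Rightarrow> nat" and \<theta> where \<theta>: "0 < \<theta>" "\<theta> < 1" and X: "X \<noteq> {}"
    and s: "bij_betw s X (subshift_of_finite_type k F)"
    and f': "\<forall>x\<in>X. f x \<in> X \<and> s (f x) = (\<lambda>i. s x (i + 1))"
    and d': "\<forall>x\<in>X. \<forall>y\<in>X. x \<noteq> y \<longrightarrow> dist x y = \<theta> ^ (LEAST n. \<exists>i. n = nat \<bar>i\<bar> \<and> s x i \<noteq> s y i)"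
    and lW: "\<forall>x\<in>X. l x = \<theta> \<and> Wl x = {y\<in>X. \<forall>i\<ge>0. s y i = s x i} \<and>
      Ws x = {y\<in>X. \<exists>n. (f ^^ n) y \<in> Wl ((f ^^ n) x)}"
    using sys unfolding mixing_sft_system_def by (elim exE conjE)
  have f: "f x \<in> X" "s (f x) = (\<lambda>i. s x (i + 1))" if "x \<in> X" for x
    using f' that by simp_all
  have d: "dist x y = \<theta> ^ (LEAST n. \<exists>i. n = nat \<bar>i\<bar> \<and> s x i \<noteq> s y i)"
    if "x \<in> X" "y \<in> X" "x \<noteq> y" for x y using d' that by simp
  have l: "l x = \<theta>" and Wl: "Wl x = {y\<in>X. \<forall>i\<ge>0. s y i = s x i}"
    and Ws: "Ws x = {y\<in>X. \<exists>n. (f ^^ n) y \<in> Wl ((f ^^ n) x)}" if "x \<in> X" for x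
    using bspec[OF lW that] by - (elim conjE, assumption)+
  have lam: "(SUP x\<in>X. l x) = \<theta>" using SUP_cong[OF refl l, of X] X by simp
  have fX: "f ` X \<subseteq> X" using f by auto
  have inj: "x = y" if "x \<in> X" "y \<in> X" "s x = s y" for x y
    using s that by (auto simp: bij_betw_def inj_on_def)
  have ex: "\<exists>i. dist x y = \<theta> ^ nat \<bar>i\<bar> \<and> s x i \<noteq> s y i" if "x \<in> X" "y \<in> X" "x \<noteq> y" for x y
  proof -
    have "\<exists>n i. n = nat \<bar>i\<bar> \<and> s x i \<noteq> s y i" using inj[OF that(1,2)] that(3) by blast
    from LeastI_ex[OF this] show ?thesis using d[OF that] by metis
  qed
  have le: "\<theta> ^ nat \<bar>i\<bar> \<le> dist x y" if "x \<in> X" "y \<in> X" "s x i \<noteq> s y i" for x y i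
  proof -
    have "(LEAST n. \<exists>i. n = nat \<bar>i\<bar> \<and> s x i \<noteq> s y i) \<le> nat \<bar>i\<bar>" by (rule Least_le) (use that in auto)
    moreover have "x \<noteq> y" using that by auto
    ultimately show ?thesis using d[OF that(1,2)] \<theta> by (simp add: power_decreasing)
  qed
  have sn: "s ((f ^^ n) x) i = s x (i + int n)" if "x \<in> X" for x n i
  proof (induction n arbitrary: i)
    case (Suc n)
    then show ?case using f(2)[OF funpow_in[OF fX that]] by (simp add: add.assoc)
  qed simp
  have Wlc: "y \<in> X \<and> contracted f \<theta> 1 x y" if x: "x \<in> X" and y: "y \<in> Wl x" for x y
  proof
    show yX: "y \<in> X" using x y Wl by blast
    show "contracted f \<theta> 1 x y"
      unfolding contracted_def
    proof
      fix n
      let ?x = "(f ^^ n) x" and ?y = "(f ^^ n) y"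
      have X: "?x \<in> X" "?y \<in> X" using funpow_in[OF fX] x yX by auto
      show "dist ?x ?y \<le> 1 * \<theta> ^ n"
      proof (cases "?x = ?y")
        case False
        then obtain i where i: "dist ?x ?y = \<theta> ^ nat \<bar>i\<bar>" "s x (i + int n) \<noteq> s y (i + int n)"
          using ex[OF X] sn x yX by metis
        then have "i + int n < 0" using y Wl[OF x] by (auto simp: not_le[symmetric])
        then have "n \<le> nat \<bar>i\<bar>" by linarith
        then show ?thesis using i(1) \<theta> by (simp add: power_decreasing)
      qed (use \<theta> in simp)
    qed
  qed
  \<comment> \<open>A shift moves a disagreement by one place and thus changes its distance from
    index 0 by at most 1, whence the Lipschitz constant \<open>1 / \<theta>\<close>.\<close>
  have "dist (f x) (f y) \<le> 1 / \<theta> * dist x y" if X: "x \<in> X" "y \<in> X" for x y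
  proof (cases "f x = f y")
    case False
    then obtain i where i: "dist (f x) (f y) = \<theta> ^ nat \<bar>i\<bar>" "s x (i + 1) \<noteq> s y (i + 1)"
      using ex[OF f(1)[OF X(1)] f(1)[OF X(2)]] f(2) X by auto
    have "\<theta> ^ Suc (nat \<bar>i\<bar>) \<le> \<theta> ^ nat \<bar>i + 1\<bar>" using \<theta> by (intro power_decreasing) auto
    also have "\<dots> \<le> dist x y" by (rule le[OF X i(2)])
    finally show ?thesis using i(1) \<theta> by (simp add: field_simps)
  qed (use \<theta> in simp)
  then have "continuous_on X f"
    using \<theta> by (intro lipschitz_on_continuous_on[of "1 / \<theta>"] lipschitz_onI) auto
  moreover have "inj_on f X"
  proof (rule inj_onI)
    fix x y assume X: "x \<in> X" "y \<in> X" and "f x = f y"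
    then have "s x (i + 1) = s y (i + 1)" for i using f(2) X by metis
    from this[of "_ - 1"] have "s x = s y" by (simp add: fun_eq_iff)
    then show "x = y" using inj X by blast
  qed
  moreover have "y \<in> X \<and> (\<exists>c. contracted f \<theta> c x y)" if x: "x \<in> X" and y: "y \<in> Ws x" for x y
  proof -
    obtain n where n: "y \<in> X" "(f ^^ n) y \<in> Wl ((f ^^ n) x)" using Ws[OF x] y by blast
    then show ?thesis using Wlc[OF funpow_in[OF fX x] n(2)] contracted_funpow[OF _ \<theta>(1)] by blast
  qed
  ultimately show ?thesis
    unfolding contracting_system_def lam using X fX \<theta> Wlc by blast
qed

text \<open>Leaf distance contracts at each step, and the radius of the local leaves is the uniform
  constant. A general point of the leaf is reached by a chain of plaques, each link at finite leaf
  distance, and the constants of the links add up.\<close>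

lemma partially_hyperbolic_contracting:
  fixes N :: "('x::metric_space, 'k::euclidean_space) chart set"
  assumes sys: "partially_hyperbolic_system N X f l Ws Wl"
  shows "contracting_system X f (SUP x\<in>X. l x) Ws Wl"
proof -
  have X: "X = UNIV" "compact X" and f: "f \<in> Diff1 N"
    using sys unfolding partially_hyperbolic_system_def by - (elim conjE exE, assumption)+
  obtain g and Es Ec Eu :: "'x \<Rightarrow> 'k set" and lh xi xih :: "'x \<Rightarrow> real" and r
    where Ng: "riemannian_manifold N g" and l: "continuous_on X l"
    and l': "\<forall>x. 0 < l x \<and> l x < 1 \<and> 0 < lh x \<and> lh x < 1 \<and> 0 < xi x \<and> 0 < xih x"
    and E: "\<forall>x. subspace (Es x) \<and> subspace (Ec x) \<and> subspace (Eu x) \<and> Es x \<noteq> {0} \<and> Eu x \<noteq> {0} \<and>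
           (\<forall>v. \<exists>!(a, b, c). a \<in> Es x \<and> b \<in> Ec x \<and> c \<in> Eu x \<and> v = a + b + c) \<and>
           mderiv N N f x ` Es x = Es (f x) \<and>
           mderiv N N f x ` Ec x = Ec (f x) \<and>
           mderiv N N f x ` Eu x = Eu (f x) \<and>
           (\<forall>v\<in>Es x. rnorm g x v = 1 \<longrightarrow> rnorm g (f x) (mderiv N N f x v) < l x) \<and>
           l x < xi x \<and>
           (\<forall>v\<in>Ec x. rnorm g x v = 1 \<longrightarrow>
              xi x < rnorm g (f x) (mderiv N N f x v) \<and>
              rnorm g (f x) (mderiv N N f x v) < inverse (xih x)) \<and>
           inverse (xih x) < inverse (lh x) \<and>
           (\<forall>v\<in>Eu x. rnorm g x v = 1 \<longrightarrow> inverse (lh x) < rnorm g (f x) (mderiv N N f x v))"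
    and fol: "foliation_tangent_to N Es Ws" and Ws': "\<forall>x. f ` Ws x = Ws (f x)"
    and r: "r > 0" and Wl': "\<forall>x. Wl x = {y. leaf_edist N g Es Ws x y < ennreal r}"
    using sys unfolding partially_hyperbolic_system_def by (elim conjE exE)
  have l01: "0 < l x \<and> l x < 1" and Ws: "f ` Ws x = Ws (f x)"
    and Wl: "Wl x = {y. leaf_edist N g Es Ws x y < ennreal r}" for x
    using l' Ws' Wl' by simp_all
  have Es: "subspace (Es x)" "mderiv N N f x ` Es x = Es (f x)"
    "\<forall>v\<in>Es x. rnorm g x v = 1 \<longrightarrow> rnorm g (f x) (mderiv N N f x v) < l x" for x
    using spec[OF E, of x] by - (elim conjE, assumption)+
  have N: "smooth_manifold N" and g: "riemannian_metric N g"
    using Ng by (auto simp: riemannian_manifold_def)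
  have C1: "C1_map_on N N UNIV f" and bij: "bij f" using f by (auto simp: Diff1_iff)
  define lam where "lam = (SUP x\<in>X. l x)"
  have "X \<noteq> {}" using X by simp
  have lam: "0 < lam" "lam < 1" "\<And>x. l x \<le> lam"
    using SUP_continuous_bounds[OF X(2) \<open>X \<noteq> {}\<close> l l01] X(1) by (simp_all add: lam_def)
  have contr: "rnorm g (f x) (mderiv N N f x v) \<le> lam * rnorm g x v" if v: "v \<in> Es x" for x v
  proof (cases "v = 0")
    case True
    then show ?thesis using linear_0[OF linear_mderiv[OF N N C1], of x] rnorm_eq_0_iff[OF N g, of _ 0] by simp
  next
    case False
    then have pos: "rnorm g x v > 0" using rnorm_eq_0_iff[OF N g] rnorm_nonneg[OF N g] by (metis less_eq_real_def)
    define u where "u = inverse (rnorm g x v) *\<^sub>R v"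
    have vu: "v = rnorm g x v *\<^sub>R u" using pos by (simp add: u_def)
    have "u \<in> Es x" using v Es(1) by (simp add: u_def subspace_scale)
    moreover have "rnorm g x u = 1" using pos by (simp add: u_def rnorm_scaleR[OF N g])
    ultimately have "rnorm g (f x) (mderiv N N f x u) \<le> lam" using Es(3) lam(3) by (meson less_imp_le order_trans)
    then have "rnorm g x v * rnorm g (f x) (mderiv N N f x u) \<le> rnorm g x v * lam"
      using pos by (intro mult_left_mono) auto
    moreover have "rnorm g (f x) (mderiv N N f x v) = rnorm g x v * rnorm g (f x) (mderiv N N f x u)"
      using pos by (subst vu) (simp add: linear_scale[OF linear_mderiv[OF N N C1]] rnorm_scaleR[OF N g])
    ultimately show ?thesis by (simp add: mult.commute)
  qed
  \<comment> \<open>The induction runs on the leaf distance, which dominates \<open>dist\<close>; a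
    curve realising the ambient distance might leave the leaf and need not shrink.\<close>
  have leaf: "contracted f lam e x y" if e: "leaf_edist N g Es Ws x y \<le> ennreal e" "0 \<le> e" for x y e
  proof -
    have "leaf_edist N g Es Ws ((f ^^ n) x) ((f ^^ n) y) \<le> ennreal (e * lam ^ n)" for n
    proof (induction n)
      case (Suc n)
      have "leaf_edist N g Es Ws ((f ^^ n) x) ((f ^^ n) y) < \<infinity>"
        using Suc by (simp add: order_le_less_trans ennreal_less_top)
      then have "leaf_edist N g Es Ws (f ((f ^^ n) x)) (f ((f ^^ n) y)) \<le>
          ennreal lam * leaf_edist N g Es Ws ((f ^^ n) x) ((f ^^ n) y)"
        using lam Es(2) Ws by (intro leaf_edist_comp_le[OF N C1 _ _ _ contr]) auto
      also have "\<dots> \<le> ennreal lam * ennreal (e * lam ^ n)" by (intro mult_left_mono Suc) simp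
      also have "\<dots> = ennreal (e * lam ^ Suc n)"
        using lam e(2) by (simp add: ennreal_mult[symmetric] mult_ac)
      finally show ?case by simp
    qed (use e in simp)
    then show ?thesis
      unfolding contracted_def using lam e(2) by (intro allI dist_le_leaf_edist[OF Ng]) auto
  qed
  have "contracted f lam r x y" if "y \<in> Wl x" for x y
    using that Wl r by (intro leaf) (auto intro: less_imp_le)
  moreover have "\<exists>c. contracted f lam c x y" if y: "y \<in> Ws x" for x y
  proof -
    obtain S \<B> where S: "subspace S" and \<B>: "\<forall>b\<in>\<B>. foliation_box S b \<and> plaques_tangent N S b Es"
      and W: "\<forall>x. Ws x = {y. (x, y) \<in> {(y, z). \<exists>b\<in>\<B>. same_plaque S b y z}\<^sup>*}"
      using fol unfolding foliation_tangent_to_def by (elim exE conjE)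
    have "(x, y) \<in> {(y, z). \<exists>b\<in>\<B>. same_plaque S b y z}\<^sup>*" using y W by blast
    then show ?thesis
    proof (induction rule: rtrancl_induct)
      case base
      show ?case using lam by (intro exI[of _ 0]) (simp add: contracted_def)
    next
      case (step y z)
      then obtain c b where c: "contracted f lam c x y" and b: "b \<in> \<B>" "same_plaque S b y z" by blast
      have "leaf_edist N g Es Ws y z < \<infinity>"
      proof (rule leaf_edist_plaque_finite[OF N g S _ _ _ b(2)])
        show "foliation_box S b" "plaques_tangent N S b Es" using \<B> b(1) by simp_all
        show "w \<in> Ws y" if "same_plaque S b y w" for w
          using that b(1) W by (auto intro!: r_into_rtrancl)
      qed
      then obtain e where "0 \<le> e" "leaf_edist N g Es Ws y z = ennreal e"
        by (metis ennreal_cases infinity_ennreal_def less_irrefl)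
      then show ?case using contracted_trans[OF c leaf[of y z e]] by auto
    qed
  qed
  ultimately show ?thesis
    unfolding contracting_system_def lam_def[symmetric]
    using X(1) lam bij C1 by (auto simp: bij_def C1_map_on_def)
qed

section \<open>From the manifold hypotheses to the abstract cocycle\<close>

lemma Diff1_subset_Diff0: "Diff1 M \<subseteq> Diff0"
  by (auto simp: Diff1_iff Diff0_iff C1_map_on_def)

lemma Diff1_holder_cocycle:
  fixes M :: "('m::metric_space, 'e::euclidean_space) chart set" and X :: "'x::metric_space set"
  assumes comp: "compact (UNIV :: 'm set)" and Mg: "riemannian_manifold M g"
    and sys: "contracting_system X f lam Ws Wl"
    and A: "\<forall>x\<in>X. A x \<in> Diff1 M" and hA: "holder_Diff0 \<beta> X A" and \<beta>: "0 < \<beta>"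
    and dom: "\<sigma> * lam powr \<beta> < 1"
    and K: "\<forall>x\<in>X. \<forall>n::int. deriv_norm M g (cocycle X f A n x) \<le> K * \<sigma> ^ nat \<bar>n\<bar>"
  shows "\<exists>C L. holder_cocycle X f A \<beta> C L (max 1 \<sigma>) lam"
proof -
  have f: "inj_on f X" "f ` X \<subseteq> X" "X \<noteq> {}" and lam: "0 < lam" "lam < 1"
    using sys by (simp_all add: contracting_system_def)
  obtain L where L: "L \<ge> 0"
    "\<And>x n s t. x \<in> X \<Longrightarrow> dist (cocycle_nat f A n x s) (cocycle_nat f A n x t) \<le> L * max 1 \<sigma> ^ n * dist s t"
    "\<And>x n s t. x \<in> X \<Longrightarrow>
      dist (inv (cocycle_nat f A n x) s) (inv (cocycle_nat f A n x) t) \<le> L * max 1 \<sigma> ^ n * dist s t"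
    using cocycle_lipschitz[OF comp Mg A f K] by blast
  obtain C where C: "\<And>x y. x \<in> X \<Longrightarrow> y \<in> X \<Longrightarrow> distC0 (A x) (A y) \<le> C * dist x y powr \<beta>"
    using hA unfolding holder_Diff0_def by blast
  have "lam powr \<beta> < 1" using powr_less_mono2[OF \<beta> _ lam(2)] lam(1) by simp
  then have "max 1 \<sigma> * lam powr \<beta> < 1" using dom by (simp add: max_def)
  moreover have "distC0 (A x) (A y) \<le> \<bar>C\<bar> * dist x y powr \<beta>" if "x \<in> X" "y \<in> X" for x y
    using C[OF that] mult_right_mono[OF abs_ge_self[of C], of "dist x y powr \<beta>"] by simp
  ultimately have "holder_cocycle X f A \<beta> \<bar>C\<bar> L (max 1 \<sigma>) lam"
    using A Diff1_subset_Diff0[of M] by (intro holder_cocycle.intro comp f L lam \<beta>) auto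
  then show ?thesis by blast
qed

theorem proposition1p9:
  fixes M :: "('m::metric_space, 'e::euclidean_space) chart set"
    and g :: "'m \<Rightarrow> 'e \<Rightarrow> 'e \<Rightarrow> real"
    and N :: "('x::metric_space, 'k::euclidean_space) chart set"
    and X :: "'x set" and f :: "'x \<Rightarrow> 'x" and l :: "'x \<Rightarrow> real"
    and Ws Wl :: "'x \<Rightarrow> 'x set"
    and A B :: "'x \<Rightarrow> 'm \<Rightarrow> 'm"
    and \<beta> lam K \<sigma> :: real
  assumes "compact (UNIV :: 'm set)" and "riemannian_manifold M g"
    and "hyperbolic_system N X f l Ws Wl \<or> partially_hyperbolic_system N X f l Ws Wl"
    and "lam = (SUP x\<in>X. l x)"
    and "\<forall>x\<in>X. A x \<in> Diff1 M" and "\<forall>x\<in>X. B x \<in> Diff1 M"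
    and "0 < \<beta>" and "\<beta> \<le> 1"
    and "holder_Diff0 \<beta> X A" and "holder_Diff0 \<beta> X B"
    and "\<sigma> * lam powr \<beta> < 1"
    and "\<forall>x\<in>X. \<forall>n::int. deriv_norm M g (cocycle X f A n x) \<le> K * \<sigma> ^ nat \<bar>n\<bar>"
    and "\<forall>x\<in>X. \<forall>n::int. deriv_norm M g (cocycle X f B n x) \<le> K * \<sigma> ^ nat \<bar>n\<bar>"
  shows "has_stable_holonomies X f Ws Wl A \<and> has_stable_holonomies X f Ws Wl B \<and>
    (\<forall>\<Phi>. holder_Diff0 \<beta> X \<Phi> \<and> conjugacy X f A B \<Phi> \<longrightarrow>
       (\<forall>x\<in>X. \<forall>y\<in>Ws x.
          stable_holonomy X f A x y = \<Phi> y \<circ> stable_holonomy X f B x y \<circ> inv (\<Phi> x)))"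
proof -
  note comp = assms(1) and Mg = assms(2)
  have sys: "contracting_system X f lam Ws Wl"
    using assms(3) unfolding assms(4) hyperbolic_system_def
    by (elim disjE) (rule transitive_anosov_contracting mixing_hyperbolic_set_contracting
        mixing_sft_contracting partially_hyperbolic_contracting, assumption)+
  obtain CA LA where hA: "holder_cocycle X f A \<beta> CA LA (max 1 \<sigma>) lam"
    using Diff1_holder_cocycle[OF comp Mg sys assms(5,9,7,11,12)] by blast
  obtain CB LB where hB: "holder_cocycle X f B \<beta> CB LB (max 1 \<sigma>) lam"
    using Diff1_holder_cocycle[OF comp Mg sys assms(6,10,7,11,13)] by blast
  \<comment> \<open>Outside the locale \<open>asymptotic\<close> depends only on \<open>X\<close>,
    \<open>f\<close> and \<open>lam\<close>, so the contraction of the base serves both cocycles at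
    once.\<close>
  have as: "holder_cocycle.asymptotic X f lam c x y \<longleftrightarrow> x \<in> X \<and> y \<in> X \<and> contracted f lam c x y" for c x y
    by (simp add: holder_cocycle.asymptotic_def[OF hA] contracted_def)
  obtain c where Wl: "\<And>x y. x \<in> X \<Longrightarrow> y \<in> Wl x \<Longrightarrow> holder_cocycle.asymptotic X f lam c x y"
    using sys unfolding contracting_system_def as by blast
  have Ws: "\<exists>c. holder_cocycle.asymptotic X f lam c x y" if "x \<in> X" "y \<in> Ws x" for x y
    using sys that unfolding contracting_system_def as by blast
  have cf: "continuous_on X f" using sys by (simp add: contracting_system_def)
  show ?thesis
  proof (intro conjI allI impI ballI)
    show "has_stable_holonomies X f Ws Wl A" "has_stable_holonomies X f Ws Wl B"
      using holder_cocycle.has_stable_holonomies[OF hA cf Wl Ws]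
        holder_cocycle.has_stable_holonomies[OF hB cf Wl Ws] by blast+
    fix \<Phi> x y assume \<Phi>: "holder_Diff0 \<beta> X \<Phi> \<and> conjugacy X f A B \<Phi>" and xy: "x \<in> X" "y \<in> Ws x"
    obtain c where "holder_cocycle.asymptotic X f lam c x y" using Ws[OF xy] by blast
    then show "stable_holonomy X f A x y = \<Phi> y \<circ> stable_holonomy X f B x y \<circ> inv (\<Phi> x)"
      using stable_holonomy_conjugacy[OF hA hB] \<Phi> by blast
  qed
qed

end
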